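(* Let $p,q\in(0,\infty]$, $\alpha\in\mathbb{R}$, and let $A$ be a Young function. Then $\ell^{p,q;\alpha}=\ell^A$ if and only if one of the following conditions holds: (1) $1<p<\infty$, $q=p$, $\alpha\in\mathbb{R}$ and $A(t)\sim t^p(1-\log t)^{\alpha p}$; (2) $p=q=1$, $\alpha\le 0$ and $A(t)\sim t(1-\log t)^{\alpha}$; (3) $p=q=\infty$, $\alpha>0$ and $A(t)\sim\exp(-t^{-1/\alpha})$; (4) either ($p=\infty$, $q<\infty$, $\alpha<-\frac1q$) or ($p=q=\infty$, $\alpha\le 0$), and $A\sim 0$.
   Context: $\mathcal{M}$ is the set of all sequences $a=\{a_n\}_{n=1}^\infty$ with values in $[-\infty,\infty]$; $m$ is the counting measure on $\mathbb{N}=\{1,2,\dots\}$. The non-increasing rearrangement of $a\in\mathcal{M}$ is $a_n^*=\inf\{\lambda\in[0,\infty): m(\{k:|a_k|>\lambda\})\le n-1\}$, $n\in\mathbb{N}$ ($\inf\emptyset=\infty$). Convention $1/\infty=0$. $\|a\|_q=(\sum_n|a_n|^q)^{1/q}$ for $0<q<\infty$ and $\|a\|_\infty=\sup_n|a_n|$. Lorentz--Zygmund space: for $p,q\in(0,\infty]$, $\alpha\in\mathbb{R}$, $\|a\|_{p,q;\alpha}=\big\|\{a_n^*\,n^{\frac1p-\frac1q}(1+\log n)^\alpha\}_n\big\|_q$ and $\ell^{p,q;\alpha}=\{a\in\mathcal{M}:\|a\|_{p,q;\alpha}<\infty\}$. Young function: $A:[0,\infty]\to[0,\infty]$, left-continuous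 and convex on $[0,\infty)$, $A(0)=0$, not constant on $(0,\infty)$ (and $A(\infty)=\lim_{t\to\infty}A(t)=\infty$). Orlicz space: $\|a\|_A=\inf\{\lambda>0:\sum_{n=1}^\infty A(|a_n|/\lambda)\le1\}$ and $\ell^A=\{a\in\mathcal{M}:\|a\|_A<\infty\}$. $F\sim G$ means: there are constants $c,C>0$ such that $F(ct)\le G(t)\le F(Ct)$ for all $t\geq 0$ in some neighborhood of $0$ (the functions written by formulas are understood to have value $0$, their limit, at $t=0$; thus $A\sim 0$ means $A=0$ on a neighborhood of $0$). For two such spaces $X,Y$, $X=Y$ means that they coincide with equivalent functionals: there are constants $c,C>0$ with $c\|a\|_X\le\|a\|_Y\le C\|a\|_X$ for all $a\in\mathcal{M}$. *)

theory Defs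
  imports "HOL-Analysis.Analysis"
begin

(* A sequence a = (a_n), n >= 1, with values in [-\<infinity>,\<infinity>] is a function nat \<Rightarrow> ereal whose value
   at index 0 is ignored by everything below. *)

definition rearr :: "(nat \<Rightarrow> ereal) \<Rightarrow> nat \<Rightarrow> ennreal" where
  "rearr a n = Inf {l. l < \<infinity> \<and>
     emeasure (count_space {1..}) {k \<in> {1..}. e2ennreal \<bar>a k\<bar> > l} \<le> of_nat (n - 1)}"

(* Used only for exponents r > 0. *)
definition enn_powr :: "ennreal \<Rightarrow> real \<Rightarrow> ennreal" where
  "enn_powr x r = (if x = \<infinity> then \<infinity> else ennreal (enn2real x powr r))"

definition lq_norm :: "ennreal \<Rightarrow> (nat \<Rightarrow> ennreal) \<Rightarrow> ennreal" where
  "lq_norm q x =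
     (if q = \<infinity> then (SUP n\<in>{1..}. x n)
      else enn_powr (\<Sum>n. enn_powr (x (Suc n)) (enn2real q)) (1 / enn2real q))"

(* 1/p as a real number, for p in (0,\<infinity>]; equals 0 for p = \<infinity>. *)
definition recip :: "ennreal \<Rightarrow> real" where
  "recip p = enn2real (1 / p)"

definition lz_norm :: "ennreal \<Rightarrow> ennreal \<Rightarrow> real \<Rightarrow> (nat \<Rightarrow> ereal) \<Rightarrow> ennreal" where
  "lz_norm p q \<alpha> a =
     lq_norm q (\<lambda>n. rearr a n * ennreal (real n powr (recip p - recip q) * (1 + ln (real n)) powr \<alpha>))"

definition lz_space :: "ennreal \<Rightarrow> ennreal \<Rightarrow> real \<Rightarrow> (nat \<Rightarrow> ereal) set" where
  "lz_space p q \<alpha> = {a. lz_norm p q \<alpha> a < \<infinity>}"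

definition young_function :: "(ennreal \<Rightarrow> ennreal) \<Rightarrow> bool" where
  "young_function A \<longleftrightarrow>
     A 0 = 0 \<and>
     (\<forall>t. 0 < t \<and> t < \<infinity> \<longrightarrow> (A \<longlongrightarrow> A t) (at_left t)) \<and>
     (\<forall>s t. \<forall>u\<in>{0..1}. s < \<infinity> \<and> t < \<infinity> \<longrightarrow>
        A (ennreal u * s + ennreal (1 - u) * t) \<le> ennreal u * A s + ennreal (1 - u) * A t) \<and>
     \<not> (\<exists>c. \<forall>t. 0 < t \<and> t < \<infinity> \<longrightarrow> A t = c) \<and>
     A \<infinity> = \<infinity> \<and> (A \<longlongrightarrow> A \<infinity>) (at_left \<infinity>)"

definition orlicz_norm :: "(ennreal \<Rightarrow> ennreal) \<Rightarrow> (nat \<Rightarrow> ereal) \<Rightarrow> ennreal" where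
  "orlicz_norm A a =
     Inf {l. 0 < l \<and> l < \<infinity> \<and> (\<Sum>n. A (e2ennreal \<bar>a (Suc n)\<bar> / l)) \<le> 1}"

definition orlicz_space :: "(ennreal \<Rightarrow> ennreal) \<Rightarrow> (nat \<Rightarrow> ereal) set" where
  "orlicz_space A = {a. orlicz_norm A a < \<infinity>}"

definition equivalent_functionals ::
    "((nat \<Rightarrow> ereal) \<Rightarrow> ennreal) \<Rightarrow> ((nat \<Rightarrow> ereal) \<Rightarrow> ennreal) \<Rightarrow> bool" where
  "equivalent_functionals N M \<longleftrightarrow>
     (\<exists>c C :: real. c > 0 \<and> C > 0 \<and>
        (\<forall>a. ennreal c * N a \<le> M a \<and> M a \<le> ennreal C * N a))"

definition lz_eq_orlicz :: "ennreal \<Rightarrow> ennreal \<Rightarrow> real \<Rightarrow> (ennreal \<Rightarrow> ennreal) \<Rightarrow> bool" where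
  "lz_eq_orlicz p q \<alpha> A \<longleftrightarrow>
     lz_space p q \<alpha> = orlicz_space A \<and> equivalent_functionals (lz_norm p q \<alpha>) (orlicz_norm A)"

definition equiv_near_0 :: "(real \<Rightarrow> ennreal) \<Rightarrow> (real \<Rightarrow> ennreal) \<Rightarrow> bool" where
  "equiv_near_0 F G \<longleftrightarrow>
     (\<exists>c C \<delta> :: real. c > 0 \<and> C > 0 \<and> \<delta> > 0 \<and>
        (\<forall>t. 0 \<le> t \<and> t < \<delta> \<longrightarrow> F (c * t) \<le> G t \<and> G t \<le> F (C * t)))"

(* A real formula on (0,\<infinity>), given the value 0 at t = 0. Without this, exp (- (0 powr r)) = 1
   because 0 powr r = 0. *)
definition zero_at_0 :: "(real \<Rightarrow> real) \<Rightarrow> real \<Rightarrow> ennreal" where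
  "zero_at_0 f t = (if t = 0 then 0 else ennreal (f t))"

end

theory Submission
  imports Defs "HOL-Real_Asymp.Real_Asymp"
begin

text \<open>
  Both functionals are rearrangement invariant and homogeneous, so the equality of the two spaces
  amounts to two modular implications between non-increasing real sequences.

  Testing on the sequences \<open>t, \<dots>, t, 0, 0, \<dots>\<close> with \<open>n\<close> non-zero terms gives \<open>t * \<phi>(n)\<close> on the Lorentz-Zygmund side
  and \<open>t\<close> divided by the generalised inverse of \<open>A\<close> at \<open>1/n\<close> on the Orlicz side; hence the fundamental function
  \<open>\<phi>\<close> determines \<open>A\<close> near \<open>0\<close>.
  For \<open>p < \<infinity>\<close> one has \<open>\<phi>(n) \<approx> n powr (1/p) * (1 + ln n) powr \<alpha>\<close>, and since a convex \<open>A\<close> is at most linear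
  at \<open>0\<close> this forces \<open>p > 1\<close>, or \<open>p = 1\<close> and \<open>\<alpha> \<le> 0\<close>. The Orlicz space of this \<open>A\<close> is the Lorentz-Zygmund space with
  \<open>q = p\<close>: in \<open>\<Sum> A(a\<^sub>n)\<close> the factor \<open>1 - ln a\<^sub>n\<close> may be exchanged for \<open>1 + ln n\<close>, up to a
  summable error, because in either space \<open>a\<^sub>n \<le> C * n powr (- 1/(2p))\<close>. Spaces with different \<open>q\<close> are
  distinct, so \<open>q = p\<close>.

  For \<open>p = \<infinity>\<close>, either \<open>\<phi>\<close> is bounded, and then both spaces are that of bounded sequences,
  or \<open>\<phi>(n\<^sup>2) \<le> C * \<phi>(n)\<close>, so that the Orlicz space with fundamental function \<open>\<phi>\<close> consists of the sequences with
  \<open>sup a\<^sub>n * \<phi>(n) < \<infinity>\<close>; this is a Lorentz-Zygmund space only for \<open>q = \<infinity>\<close>.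
\<close>

subsection \<open>Power-logarithmic weights\<close>

text \<open>The Lorentz-Zygmund functional is in general only a quasi-norm, so the argument compares
  unit balls and modulars and never adds sequences. Convexity of \<open>A\<close> acts through
  \<open>A (u * t) \<le> u * A t\<close> for \<open>u\<close> between 0 and 1: a modular bounded by
  \<open>S \<ge> 1\<close> drops below 1 when the sequence is divided by \<open>S\<close>, which
  makes additive errors of size \<open>1 / n^2\<close> harmless. The conclusion \<open>q = p\<close>
  is indirect. For \<open>p < \<infinity>\<close> the function \<phi> depends on \<open>q\<close>
  only up to constants, so \<open>A\<close> is known up to equivalence before \<open>q\<close> is.
  Sufficiency then identifies the Orlicz space of \<open>A\<close> with the space of second exponent
  \<open>p\<close> as well. No inverse of \<phi> is computed. A candidate \<open>G\<close> is
  correct as soon as \<open>t * \<phi> (\<kappa> / G t)\<close> has a positive limit at 0 for each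
  \<open>\<kappa> > 0\<close>; the freedom in \<kappa> pays for rounding \<open>1 / G t\<close> to
  an integer. At the borderline \<open>p = \<infinity>\<close>, \<open>\<alpha> = - 1 / q\<close>
  the function \<phi> grows like a power of an iterated logarithm, outside the family
  \<open>plog\<close>. The range \<open>p = \<infinity>\<close>, \<open>q < \<infinity>\<close>,
  \<open>\<alpha> \<ge> - 1 / q\<close> is therefore excluded without any formula for
  \<open>A\<close>.\<close>

definition plog :: "real \<Rightarrow> real \<Rightarrow> real \<Rightarrow> real" where
  "plog s \<beta> x = x powr s * (1 + ln x) powr \<beta>"

lemma one_plus_ln_pos: "x \<ge> 1 \<Longrightarrow> 0 < 1 + ln (x::real)"
  by (intro add_pos_nonneg) auto

lemma plog_pos: "x \<ge> 1 \<Longrightarrow> plog s \<beta> x > 0"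
  using one_plus_ln_pos[of x] by (simp add: plog_def)

lemma plog_1 [simp]: "plog s \<beta> 1 = 1"
  by (simp add: plog_def)

lemma plog_mult_powr: "plog s \<beta> x * x powr t = plog (s + t) \<beta> x"
  by (simp add: plog_def powr_add)

lemma plog_powr: "x \<ge> 1 \<Longrightarrow> plog s \<beta> x powr r = plog (s * r) (\<beta> * r) x"
  by (simp add: plog_def powr_mult powr_powr)

text \<open>The sign of \<beta> decides which end of the interval from \<kappa> to \<open>K\<close>
  controls the power of \<open>a / b\<close>; the maximum serves both signs at once.\<close>

lemma powr_comparable:
  fixes a b \<kappa> K \<beta> :: real
  assumes "0 < b" "0 < \<kappa>" "\<kappa> * b \<le> a" "a \<le> K * b"
  shows "a powr \<beta> \<le> max (\<kappa> powr \<beta>) (K powr \<beta>) * b powr \<beta>"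
proof -
  have ab: "\<kappa> \<le> a / b" "a / b \<le> K"
    using assms by (auto simp: field_simps)
  have "(a / b) powr \<beta> \<le> max (\<kappa> powr \<beta>) (K powr \<beta>)"
  proof (cases "\<beta> \<ge> 0")
    case True
    then show ?thesis
      using ab assms by (intro max.coboundedI2 powr_mono2) auto
  next
    case False
    then show ?thesis
      using ab assms by (intro max.coboundedI1 powr_mono2') auto
  qed
  moreover have "0 \<le> a"
    using mult_pos_pos[OF assms(2,1)] assms by linarith
  ultimately show ?thesis
    using assms by (simp add: powr_divide field_simps)
qed

lemma log_powr_le:
  fixes s \<beta> :: real
  assumes "s > 0"
  obtains C where "C > 0" "\<And>x. x \<ge> 1 \<Longrightarrow> (1 + ln x) powr \<beta> \<le> C * x powr s"
proof (cases "\<beta> > 0")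
  case False
  have "(1 + ln x) powr \<beta> \<le> 1 * x powr s" if "x \<ge> 1" for x
  proof -
    have "(1 + ln x) powr \<beta> \<le> 1 powr \<beta>"
      using False that by (intro powr_mono2') auto
    also have "\<dots> \<le> x powr s"
      using assms that by (simp add: ge_one_powr_ge_zero)
    finally show ?thesis by simp
  qed
  then show ?thesis
    by (rule that[OF zero_less_one])
next
  case True
  have "(1 + ln x) powr \<beta> \<le> (1 + \<beta> / s) powr \<beta> * x powr s" if "x \<ge> 1" for x
  proof -
    have "ln x \<le> (\<beta> / s) * x powr (s / \<beta>)"
      using ln_powr_bound[of x "s / \<beta>"] that assms True by (simp add: field_simps)
    moreover have "1 \<le> x powr (s / \<beta>)"
      using assms that True by (simp add: ge_one_powr_ge_zero)
    ultimately have "1 + ln x \<le> (1 + \<beta> / s) * x powr (s / \<beta>)"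
      by (simp add: algebra_simps)
    then have "(1 + ln x) powr \<beta> \<le> ((1 + \<beta> / s) * x powr (s / \<beta>)) powr \<beta>"
      using that True by (intro powr_mono2) auto
    also have "\<dots> = (1 + \<beta> / s) powr \<beta> * x powr s"
      using True assms by (simp add: powr_mult powr_powr)
    finally show ?thesis .
  qed
  moreover have "(1 + \<beta> / s) powr \<beta> > 0"
    using True assms add_pos_pos[of 1 "\<beta> / s"] by simp
  ultimately show ?thesis
    using that by blast
qed

text \<open>For \<open>\<beta> < - s\<close> the function decreases near 1, so a constant is
  unavoidable. Passing from \<open>x\<close> to \<open>y = x * u\<close> changes the logarithmic
  factor by at most \<open>(1 + ln u) powr \<bar>\<beta>\<bar>\<close>, because
  \<open>1 + ln (x * u) \<le> (1 + ln u) * (1 + ln x)\<close>, and the gain \<open>u powr s\<close>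
  absorbs this.\<close>

lemma plog_almost_mono:
  fixes s \<beta> :: real
  assumes "s > 0"
  obtains C where "C > 0" "\<And>x y. \<lbrakk>1 \<le> x; x \<le> y\<rbrakk> \<Longrightarrow> plog s \<beta> x \<le> C * plog s \<beta> y"
proof -
  obtain C where C: "C > 0" "\<And>x. x \<ge> 1 \<Longrightarrow> (1 + ln x) powr \<bar>\<beta>\<bar> \<le> C * x powr s"
    using log_powr_le[OF assms] by metis
  have "plog s \<beta> x \<le> C * plog s \<beta> y" if "1 \<le> x" "x \<le> y" for x y
  proof -
    have y: "ln y = ln x + ln (y / x)"
      using that by (simp add: ln_div)
    define u where "u = y / x"
    have u: "u \<ge> 1" "ln u \<ge> 0" "ln x \<ge> 0"
      using that by (auto simp: u_def)
    have "(1 + ln x) powr \<beta> \<le> (1 + ln u) powr \<bar>\<beta>\<bar> * (1 + ln y) powr \<beta>"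
    proof (cases "\<beta> \<ge> 0")
      case True
      have "(1 + ln x) powr \<beta> \<le> 1 * (1 + ln y) powr \<beta>"
        using that True by (auto intro!: powr_mono2)
      also have "\<dots> \<le> (1 + ln u) powr \<bar>\<beta>\<bar> * (1 + ln y) powr \<beta>"
        using u by (intro mult_right_mono ge_one_powr_ge_zero) auto
      finally show ?thesis .
    next
      case False
      have "1 + ln y \<le> (1 + ln u) * (1 + ln x)"
        using u by (simp add: y algebra_simps flip: u_def)
      then have "(1 + ln y) powr (- \<beta>) \<le> ((1 + ln u) * (1 + ln x)) powr (- \<beta>)"
        using False that by (intro powr_mono2) auto
      then have "(1 + ln y) powr (- \<beta>) \<le> (1 + ln u) powr (- \<beta>) * (1 + ln x) powr (- \<beta>)"
        using u by (simp add: powr_mult)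
      then have "inverse ((1 + ln y) powr \<beta>) \<le> (1 + ln u) powr (- \<beta>) * inverse ((1 + ln x) powr \<beta>)"
        by (simp only: powr_minus[of "1 + ln x"] powr_minus[of "1 + ln y"])
      moreover have "0 < (1 + ln x) powr \<beta>" "0 < (1 + ln y) powr \<beta>"
        using one_plus_ln_pos[of x] one_plus_ln_pos[of y] that by auto
      ultimately have "(1 + ln x) powr \<beta> \<le> (1 + ln u) powr (- \<beta>) * (1 + ln y) powr \<beta>"
        by (simp add: divide_simps mult_ac)
      then show ?thesis
        using False by simp
    qed
    also have "\<dots> \<le> (C * u powr s) * (1 + ln y) powr \<beta>"
      using C(2)[OF u(1)] by (intro mult_right_mono) auto
    finally have "x powr s * (1 + ln x) powr \<beta> \<le> x powr s * ((C * u powr s) * (1 + ln y) powr \<beta>)"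
      by (intro mult_left_mono) auto
    also have "\<dots> = C * plog s \<beta> y"
      using that by (simp add: plog_def u_def powr_divide)
    finally show ?thesis by (simp add: plog_def)
  qed
  with C(1) show ?thesis by (rule that)
qed

text \<open>Integral comparison, one mean value theorem per term; \<open>r \<le> 1\<close> makes the
  integrand \<open>x powr (r - 1)\<close> non-increasing.\<close>

lemma sum_powr_le:
  fixes r :: real
  assumes "0 < r" "r \<le> 1"
  shows "(\<Sum>k<n. real (Suc k) powr (r - 1)) \<le> real n powr r / r"
proof (induction n)
  case (Suc n)
  have "real (Suc n) powr (r - 1) \<le> (real (Suc n) powr r - real n powr r) / r"
  proof (cases "n = 0")
    case False
    have "\<exists>z>real n. z < real (Suc n) \<and>
        real (Suc n) powr r - real n powr r = (real (Suc n) - real n) * (r * z powr (r - 1))"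
      using False by (intro MVT2) (auto intro!: derivative_eq_intros)
    then obtain z where z: "z > real n" "z < real (Suc n)"
      "real (Suc n) powr r - real n powr r = r * z powr (r - 1)" by auto
    have "real (Suc n) powr (r - 1) \<le> z powr (r - 1)"
      using z assms by (intro powr_mono2') auto
    then show ?thesis using z assms by (simp add: field_simps)
  qed (use assms in auto)
  then show ?case
    using Suc.IH by (simp add: diff_divide_distrib)
qed auto

lemma sum_plog_le:
  fixes s \<beta> :: real
  assumes "s > 0"
  obtains C where "C > 0"
    "\<And>n. n \<ge> 1 \<Longrightarrow> (\<Sum>k<n. plog (s - 1) \<beta> (real (Suc k))) \<le> C * plog s \<beta> (real n)"
proof -
  \<comment> \<open>\<open>r < s\<close> leaves a positive exponent \<open>s - r\<close> whose
    factor, logarithm included, is almost increasing and can be replaced by its value at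
    \<open>n\<close>; \<open>r \<le> 1\<close> lets the remaining pure power be summed by
    \<open>sum_powr_le\<close>.\<close>
  define r where "r = min (s / 2) 1"
  have r: "0 < r" "r \<le> 1" "s - r > 0"
    using assms by (auto simp: r_def)
  obtain C where C: "C > 0"
    "\<And>x y. \<lbrakk>1 \<le> x; x \<le> y\<rbrakk> \<Longrightarrow> plog (s - r) \<beta> x \<le> C * plog (s - r) \<beta> y"
    using plog_almost_mono[OF r(3)] by metis
  have "(\<Sum>k<n. plog (s - 1) \<beta> (real (Suc k))) \<le> C / r * plog s \<beta> (real n)" if "n \<ge> 1" for n
  proof -
    have "(\<Sum>k<n. plog (s - 1) \<beta> (real (Suc k)))
        \<le> (\<Sum>k<n. C * plog (s - r) \<beta> (real n) * real (Suc k) powr (r - 1))"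
    proof (rule sum_mono)
      fix k assume "k \<in> {..<n}"
      then have "plog (s - r) \<beta> (real (Suc k)) * real (Suc k) powr (r - 1)
          \<le> C * plog (s - r) \<beta> (real n) * real (Suc k) powr (r - 1)"
        by (intro mult_right_mono C) auto
      moreover have "plog (s - r) \<beta> (real (Suc k)) * real (Suc k) powr (r - 1)
          = plog (s - 1) \<beta> (real (Suc k))"
        by (simp only: plog_mult_powr add_diff_eq diff_add_cancel)
      ultimately show "plog (s - 1) \<beta> (real (Suc k))
          \<le> C * plog (s - r) \<beta> (real n) * real (Suc k) powr (r - 1)" by (simp only:)
    qed
    also have "\<dots> \<le> C * plog (s - r) \<beta> (real n) * (real n powr r / r)"
      unfolding sum_distrib_left[symmetric]
      using C(1) plog_pos[of "real n" "s - r" \<beta>] that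
      by (intro mult_left_mono sum_powr_le r) auto
    also have "\<dots> = C / r * plog s \<beta> (real n)"
      using plog_mult_powr[of "s - r" \<beta> "real n" r] by (simp add: mult_ac)
    finally show ?thesis .
  qed
  moreover have "C / r > 0" using C r by simp
  ultimately show ?thesis using that by blast
qed

text \<open>The upper half of the range suffices: for \<open>k\<close> in
  \<open>{n div 2..<n}\<close> the argument \<open>Suc k\<close> lies between \<open>n / 2\<close>
  and \<open>n\<close>, so each term is comparable to the one at \<open>n\<close> whatever the signs
  of the exponents, and there are at least \<open>n / 2\<close> such terms.\<close>

lemma sum_plog_ge:
  fixes s \<beta> :: real
  obtains c where "c > 0"
    "\<And>n. n \<ge> 1 \<Longrightarrow> c * plog s \<beta> (real n) \<le> (\<Sum>k<n. plog (s - 1) \<beta> (real (Suc k)))"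
proof -
  have lo: "plog (s - 1) \<beta> (real n) \<le> 2 powr \<bar>\<beta>\<bar> * 2 powr \<bar>s - 1\<bar> * plog (s - 1) \<beta> x"
    if "real n \<le> 2 * x" "x \<le> real n" "x \<ge> 1" for n x
  proof -
    have "real n powr (s - 1) \<le> max (1 powr (s - 1)) (2 powr (s - 1)) * x powr (s - 1)"
      using that by (intro powr_comparable) auto
    also have "\<dots> \<le> 2 powr \<bar>s - 1\<bar> * x powr (s - 1)"
      by (intro mult_right_mono) (auto intro: powr_mono ge_one_powr_ge_zero)
    finally have 1: "real n powr (s - 1) \<le> 2 powr \<bar>s - 1\<bar> * x powr (s - 1)" .
    have "ln (real n) \<le> ln (2 * x)"
      using that by (intro ln_mono) auto
    also have "\<dots> = ln 2 + ln x" using that by (simp add: ln_mult)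
    finally have "1 + ln (real n) \<le> 2 * (1 + ln x)"
      using ln_2_less_1 ln_ge_zero[OF that(3)] by simp
    moreover have "ln x \<le> ln (real n)"
      using that by (intro ln_mono) auto
    ultimately have "(1 + ln (real n)) powr \<beta> \<le> max (1 powr \<beta>) (2 powr \<beta>) * (1 + ln x) powr \<beta>"
      using that one_plus_ln_pos[OF that(3)] by (intro powr_comparable) auto
    also have "\<dots> \<le> 2 powr \<bar>\<beta>\<bar> * (1 + ln x) powr \<beta>"
      by (intro mult_right_mono) (auto intro: powr_mono ge_one_powr_ge_zero)
    finally have 2: "(1 + ln (real n)) powr \<beta> \<le> 2 powr \<bar>\<beta>\<bar> * (1 + ln x) powr \<beta>" .
    show ?thesis
      using mult_mono[OF 1 2] by (simp add: plog_def mult_ac)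
  qed
  define c where "c = 1 / (2 * (2 powr \<bar>\<beta>\<bar> * 2 powr \<bar>s - 1\<bar>))"
  have c: "c > 0" by (simp add: c_def)
  have "c * plog s \<beta> (real n) \<le> (\<Sum>k<n. plog (s - 1) \<beta> (real (Suc k)))" if n: "n \<ge> 1" for n
  proof -
    have "real n / 2 \<le> real (card {n div 2..<n})" by simp
    then have "real n / 2 * (2 * c * plog (s - 1) \<beta> (real n))
        \<le> real (card {n div 2..<n}) * (2 * c * plog (s - 1) \<beta> (real n))"
      using c plog_pos[of "real n" "s - 1" \<beta>] n by (intro mult_right_mono) auto
    also have "\<dots> = (\<Sum>k\<in>{n div 2..<n}. 2 * c * plog (s - 1) \<beta> (real n))"
      by simp
    also have "\<dots> \<le> (\<Sum>k\<in>{n div 2..<n}. plog (s - 1) \<beta> (real (Suc k)))"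
    proof (rule sum_mono)
      fix k assume k: "k \<in> {n div 2..<n}"
      then have "n \<le> 2 * Suc k" by auto
      then have "real n \<le> 2 * real (Suc k)" by linarith
      then show "2 * c * plog (s - 1) \<beta> (real n) \<le> plog (s - 1) \<beta> (real (Suc k))"
        using lo[of n "real (Suc k)"] k by (simp add: c_def field_simps)
    qed
    also have "\<dots> \<le> (\<Sum>k<n. plog (s - 1) \<beta> (real (Suc k)))"
      by (intro sum_mono2) (auto intro!: less_imp_le[OF plog_pos])
    finally show ?thesis
      using plog_mult_powr[of "s - 1" \<beta> "real n" 1] n by (simp add: mult_ac)
  qed
  with c show ?thesis by (rule that)
qed

text \<open>Cauchy condensation needs non-increasing terms, which \<open>\<beta> < 0\<close>
  provides, and yields the series of \<open>(1 + n * ln 2) powr \<beta>\<close>; for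
  \<open>\<beta> \<ge> 0\<close> the harmonic series is a minorant. Both the threshold
  \<open>\<alpha> < - 1 / q\<close> and the separation of different second exponents rest on this
  dichotomy.\<close>

lemma summable_plog_iff: "summable (\<lambda>n. plog (-1) \<beta> (real (Suc n))) \<longleftrightarrow> \<beta> < -1"
proof (cases "\<beta> < 0")
  case False
  have "\<not> summable (\<lambda>n. plog (-1) \<beta> (real (Suc n)))"
  proof
    assume "summable (\<lambda>n. plog (-1) \<beta> (real (Suc n)))"
    then have "summable (\<lambda>n. inverse (real (Suc n)))"
    proof (rule summable_comparison_test'[where N = 0])
      fix n :: nat
      have "(1 + ln (real (Suc n))) powr \<beta> \<ge> 1"
        using False by (intro ge_one_powr_ge_zero) auto
      then show "norm (inverse (real (Suc n))) \<le> plog (-1) \<beta> (real (Suc n))"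
        by (simp add: plog_def powr_minus field_simps)
    qed
    then show False
      using not_summable_harmonic[where 'a = real]
        summable_Suc_iff[of "\<lambda>n. inverse (real n)"] by simp
  qed
  then show ?thesis using False by simp
next
  case True
  have "summable (\<lambda>n. plog (-1) \<beta> (real (Suc n))) \<longleftrightarrow> summable (\<lambda>n. plog (-1) \<beta> (real n))"
    by (rule summable_Suc_iff)
  also have "\<dots> \<longleftrightarrow> summable (\<lambda>n. 2^n * plog (-1) \<beta> (real (2^n)))"
  proof (rule condensation_test)
    fix m :: nat assume "0 < m"
    then show "plog (-1) \<beta> (real (Suc m)) \<le> plog (-1) \<beta> (real m)"
      unfolding plog_def using True
      by (intro mult_mono powr_mono2') (auto intro!: add_pos_nonneg)
  qed (auto simp: plog_def)
  also have "(\<lambda>n. 2^n * plog (-1) \<beta> (real (2^n))) = (\<lambda>n. (1 + real n * ln 2) powr \<beta>)"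
    by (auto simp: plog_def powr_minus ln_realpow)
  also have "summable \<dots> \<longleftrightarrow> summable (\<lambda>n. real (Suc n) powr \<beta>)"
  proof
    have *: "(1/2) * real (Suc n) \<le> 1 + real n * ln 2" "1 + real n * ln 2 \<le> 1 * real (Suc n)" for n
      using ln2_ge_two_thirds ln_2_less_1
        mult_left_mono[of "1/2" "ln 2" "real n"] mult_left_mono[of "ln 2" 1 "real n"]
      by (auto simp: algebra_simps)
    have pos: "0 < 1 + real n * ln 2" for n
      by (intro add_pos_nonneg) auto
    show "summable (\<lambda>n. (1 + real n * ln 2) powr \<beta>)" if "summable (\<lambda>n. real (Suc n) powr \<beta>)"
    proof (rule summable_comparison_test'[where N = 0])
      show "summable (\<lambda>n. max ((1/2) powr \<beta>) (1 powr \<beta>) * real (Suc n) powr \<beta>)"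
        by (intro summable_mult that)
      show "norm ((1 + real n * ln 2) powr \<beta>) \<le> max ((1/2) powr \<beta>) (1 powr \<beta>) * real (Suc n) powr \<beta>"
        for n
        using powr_comparable[OF _ _ *, of n \<beta>] by simp
    qed
    show "summable (\<lambda>n. real (Suc n) powr \<beta>)" if "summable (\<lambda>n. (1 + real n * ln 2) powr \<beta>)"
    proof (rule summable_comparison_test'[where N = 0])
      show "summable (\<lambda>n. max (1 powr \<beta>) (2 powr \<beta>) * (1 + real n * ln 2) powr \<beta>)"
        by (intro summable_mult that)
      show "norm (real (Suc n) powr \<beta>) \<le> max (1 powr \<beta>) (2 powr \<beta>) * (1 + real n * ln 2) powr \<beta>"
        for n
        using powr_comparable[OF pos[of n], of 1 "real (Suc n)" 2 \<beta>] *[of n] by simp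
    qed
  qed
  also have "\<dots> \<longleftrightarrow> \<beta> < -1"
    using summable_Suc_iff[of "\<lambda>n. real n powr \<beta>"] summable_real_powr_iff[of \<beta>] by simp
  finally show ?thesis .
qed

subsection \<open>Reduction to non-increasing real sequences\<close>

lemma young_functionD:
  assumes "young_function A"
  shows "A 0 = 0" "A \<infinity> = \<infinity>" "(A \<longlongrightarrow> A \<infinity>) (at_left \<infinity>)"
    "\<not> (\<exists>c. \<forall>t. 0 < t \<and> t < \<infinity> \<longrightarrow> A t = c)"
    "\<forall>s t. \<forall>u\<in>{0..1}. s < \<infinity> \<and> t < \<infinity> \<longrightarrow>
        A (ennreal u * s + ennreal (1 - u) * t) \<le> ennreal u * A s + ennreal (1 - u) * A t"
  using assms unfolding young_function_def by - (elim conjE, assumption)+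

lemma young_function_scale:
  assumes "young_function A" "0 \<le> u" "u \<le> 1" "t < \<infinity>"
  shows "A (ennreal u * t) \<le> ennreal u * A t"
proof -
  have "A (ennreal u * t + ennreal (1 - u) * 0) \<le> ennreal u * A t + ennreal (1 - u) * A 0"
    using young_functionD(5)[OF assms(1), rule_format, of u t 0] assms(2-4) by simp
  then show ?thesis
    using young_functionD[OF assms(1)] by simp
qed

text \<open>Monotonicity is not part of the definition. For finite \<open>t > 0\<close> it is
  scaling by \<open>s / t\<close>, that is, convexity against \<open>A 0 = 0\<close>; convexity is
  only given at finite arguments, so \<open>t = \<infinity>\<close> is settled by
  \<open>A \<infinity> = \<infinity>\<close>.\<close>

lemma young_function_mono:
  assumes "young_function A"
  shows "mono A"
proof
  fix s t :: ennreal assume st: "s \<le> t"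
  show "A s \<le> A t"
  proof (cases "t = \<infinity> \<or> s = t")
    case True
    then show ?thesis using young_functionD[OF assms] by auto
  next
    case False
    then obtain t' where t': "t = ennreal t'" "t' \<ge> 0"
      by (cases t) auto
    then obtain s' where s': "s = ennreal s'" "s' \<ge> 0"
      using st by (cases s) (auto simp: top_unique)
    have "s' \<le> t'" "t' > 0"
      using st s' t' False by (auto simp: less_le)
    then have "A (ennreal (s' / t') * t) \<le> ennreal (s' / t') * A t"
      using s' t' by (intro young_function_scale[OF assms]) auto
    also have "\<dots> \<le> 1 * A t"
      using \<open>s' \<le> t'\<close> \<open>t' > 0\<close> s' by (intro mult_right_mono) (auto simp: ennreal_le_1)
    also have "ennreal (s' / t') * t = s"
      using \<open>t' > 0\<close> s' t' by (simp flip: ennreal_mult)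
    finally show ?thesis by simp
  qed
qed

lemma young_function_large:
  assumes "young_function A"
  obtains T :: real where "T > 0" "A (ennreal T) > 1"
proof -
  have "(A \<longlongrightarrow> \<infinity>) (at_left \<infinity>)"
    using young_functionD(2,3)[OF assms] by simp
  then have "eventually (\<lambda>t. A t > 1) (at_left \<infinity>)"
    by (rule order_tendstoD) simp
  then obtain b where b: "b < \<infinity>" "\<And>t. \<lbrakk>b < t; t < \<infinity>\<rbrakk> \<Longrightarrow> A t > 1"
    unfolding eventually_at_left[OF ennreal_zero_less_top[folded infinity_ennreal_def]] by auto
  obtain t where t: "b < t" "t < \<infinity>"
    using dense[OF b(1)] by auto
  then obtain T where "t = ennreal T" "T \<ge> 0"
    by (cases t) auto
  with b(2)[OF t] t show ?thesis
    by (intro that[of T]) (auto simp: less_le ennreal_eq_0_iff)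
qed

text \<open>Since \<open>A\<close> is not constant on the positive reals, it is finite at some
  positive point, and below that point it lies under its chord from 0. The added 1 in the slope
  keeps \<open>B\<close> positive when \<open>A\<close> vanishes there.\<close>

lemma young_function_le_linear:
  assumes "young_function A"
  obtains t B :: real where "t > 0" "B > 0"
    "\<And>s. \<lbrakk>0 \<le> s; s \<le> t\<rbrakk> \<Longrightarrow> A (ennreal s) \<le> ennreal (B * s)"
proof -
  have "\<exists>t. 0 < t \<and> t < \<infinity> \<and> A t < \<infinity>"
  proof (rule ccontr)
    assume "\<not> ?thesis"
    then have "\<forall>t. 0 < t \<and> t < \<infinity> \<longrightarrow> A t = \<infinity>"
      by (auto simp: less_top[symmetric] zero_less_iff_neq_zero)
    then show False
      using young_functionD(4)[OF assms] by blast
  qed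
  then obtain t where "0 < t" "t < \<infinity>" "A t < \<infinity>" by blast
  then obtain t' b where t: "t' > 0" "A (ennreal t') = ennreal b" "b \<ge> 0"
    by (cases t; cases "A t") (auto simp: less_le ennreal_eq_0_iff)
  show ?thesis
  proof (rule that[of t' "b / t' + 1"])
    fix s assume s: "0 \<le> s" "s \<le> t'"
    then have "A (ennreal (s / t') * ennreal t') \<le> ennreal (s / t') * A (ennreal t')"
      using t by (intro young_function_scale[OF assms]) auto
    also have "\<dots> = ennreal (s / t' * b)"
      using s t by (simp flip: ennreal_mult)
    also have "\<dots> \<le> ennreal ((b / t' + 1) * s)"
      using s t by (intro ennreal_leI) (simp add: field_simps)
    also have "ennreal (s / t') * ennreal t' = ennreal s"
      using s t by (simp flip: ennreal_mult)
    finally show "A (ennreal s) \<le> ennreal ((b / t' + 1) * s)" .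
  qed (use t in \<open>auto simp: add_nonneg_pos\<close>)
qed

section \<open>The non-increasing rearrangement\<close>

lemma emeasure_count_space_le_iff:
  "X \<subseteq> S \<Longrightarrow> emeasure (count_space S) X \<le> of_nat m \<longleftrightarrow> finite X \<and> card X \<le> m"
  by (cases "finite X") (auto simp: emeasure_count_space_finite emeasure_count_space_infinite top_unique)

lemma rearr_altdef:
  "rearr a n = Inf {l. l < \<infinity> \<and> finite {k. 1 \<le> k \<and> l < e2ennreal \<bar>a k\<bar>} \<and>
     card {k. 1 \<le> k \<and> l < e2ennreal \<bar>a k\<bar>} \<le> n - 1}"
  unfolding rearr_def
  by (subst emeasure_count_space_le_iff) (auto intro!: arg_cong[where f = Inf])

lemma rearr_antimono: "m \<le> n \<Longrightarrow> rearr a n \<le> rearr a m"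
  unfolding rearr_altdef by (intro Inf_superset_mono) auto

text \<open>Every level below \<open>b\<close> is exceeded at the \<open>n + 1\<close> indices of
  \<open>F\<close>, one more than \<open>rearr a (Suc n)\<close> tolerates.\<close>

lemma le_rearr:
  assumes "finite F" "F \<subseteq> {1..}" "card F = Suc n" "\<And>k. k \<in> F \<Longrightarrow> b \<le> e2ennreal \<bar>a k\<bar>"
  shows "b \<le> rearr a (Suc n)"
  unfolding rearr_altdef
proof (rule Inf_greatest, rule ccontr)
  fix l assume l: "l \<in> {l. l < \<infinity> \<and> finite {k. 1 \<le> k \<and> l < e2ennreal \<bar>a k\<bar>} \<and>
     card {k. 1 \<le> k \<and> l < e2ennreal \<bar>a k\<bar>} \<le> Suc n - 1}" and "\<not> b \<le> l"
  then have "F \<subseteq> {k. 1 \<le> k \<and> l < e2ennreal \<bar>a k\<bar>}"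
    using assms(2,4) by (auto simp: not_le intro: less_le_trans)
  then have "card F \<le> n"
    using l card_mono[of "{k. 1 \<le> k \<and> l < e2ennreal \<bar>a k\<bar>}" F] by auto
  then show False using assms(3) by simp
qed

text \<open>This supplies the test sequences: any non-increasing \<open>y\<close> occurs as a
  rearrangement. The shift \<open>n - 1\<close> converts the indexing of \<open>y\<close> from 0 to
  that of sequences from 1.\<close>

lemma rearr_antimono_seq:
  fixes y :: "nat \<Rightarrow> ennreal"
  assumes "antimono y"
  shows "rearr (\<lambda>n. enn2ereal (y (n - 1))) (Suc n) = y n"
proof (rule antisym)
  let ?a = "\<lambda>n. enn2ereal (y (n - 1))"
  have a: "e2ennreal \<bar>?a k\<bar> = y (k - 1)" for k
    by (simp add: ereal_abs_leI abs_ereal_ge0 enn2ereal_nonneg)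
  show "rearr ?a (Suc n) \<le> y n"
  proof (cases "y n = \<infinity>")
    case False
    have "{k. 1 \<le> k \<and> y n < y (k - 1)} \<subseteq> {1..n}"
    proof safe
      fix k assume k: "1 \<le> k" "y n < y (k - 1)"
      then have "\<not> n \<le> k - 1"
        using antimonoD[OF assms, of n "k - 1"] by auto
      then show "k \<in> {1..n}" using k by auto
    qed
    then have "finite {k. 1 \<le> k \<and> y n < y (k - 1)}" "card {k. 1 \<le> k \<and> y n < y (k - 1)} \<le> n"
      using finite_subset card_mono[of "{1..n}"] by auto
    then show ?thesis
      unfolding rearr_altdef a using False by (intro Inf_lower) (auto simp: less_top)
  qed simp
  show "y n \<le> rearr ?a (Suc n)"
  proof (rule le_rearr)
    show "y n \<le> e2ennreal \<bar>?a k\<bar>" if "k \<in> {1..Suc n}" for k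
      using that unfolding a by (intro antimonoD[OF assms]) auto
  qed auto
qed

text \<open>Induction removing an index where the absolute value is smallest on \<open>F\<close>:
  this minimum is reached or exceeded at \<open>card F\<close> indices, hence is at most the
  rearrangement at \<open>card F\<close>.\<close>

lemma sum_le_sum_rearr:
  fixes g :: "ennreal \<Rightarrow> ennreal"
  assumes "mono g" "finite F" "F \<subseteq> {1..}"
  shows "(\<Sum>k\<in>F. g (e2ennreal \<bar>a k\<bar>)) \<le> (\<Sum>i<card F. g (rearr a (Suc i)))"
  using assms(2,3)
proof (induction "card F" arbitrary: F)
  case 0
  then show ?case by simp
next
  case (Suc n)
  then have "F \<noteq> {}" "finite F" by auto
  define b where "b = Min ((\<lambda>k. e2ennreal \<bar>a k\<bar>) ` F)"
  have "b \<in> (\<lambda>k. e2ennreal \<bar>a k\<bar>) ` F"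
    using \<open>F \<noteq> {}\<close> \<open>finite F\<close> unfolding b_def by (intro Min_in) auto
  then obtain k where k: "k \<in> F" "b = e2ennreal \<bar>a k\<bar>" by auto
  have "b \<le> rearr a (Suc n)"
    using Suc.prems Suc.hyps by (intro le_rearr[of F]) (auto simp: b_def)
  then have "g (e2ennreal \<bar>a k\<bar>) \<le> g (rearr a (Suc n))"
    using monoD[OF assms(1)] k by auto
  moreover have card: "card (F - {k}) = n"
    using Suc k by simp
  have "(\<Sum>k\<in>F - {k}. g (e2ennreal \<bar>a k\<bar>)) \<le> (\<Sum>i<card (F - {k}). g (rearr a (Suc i)))"
    using Suc.prems card by (intro Suc.hyps(1)) auto
  ultimately have "g (e2ennreal \<bar>a k\<bar>) + (\<Sum>k\<in>F - {k}. g (e2ennreal \<bar>a k\<bar>))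
      \<le> g (rearr a (Suc n)) + (\<Sum>i<n. g (rearr a (Suc i)))"
    unfolding card by (intro add_mono)
  then show ?case
    unfolding sum.remove[OF \<open>finite F\<close> k(1)] Suc.hyps(2)[symmetric]
    by (simp add: add.commute)
qed

lemma sum_less_rearr_le:
  fixes g :: "ennreal \<Rightarrow> ennreal"
  assumes "mono g" "\<And>i. r i < rearr a (Suc i) \<or> r i = 0"
  shows "(\<Sum>i<n. g (r i)) \<le> (\<Sum>k. g (e2ennreal \<bar>a (Suc k)\<bar>))"
proof -
  have "\<exists>F. finite F \<and> card F = n \<and> F \<subseteq> {1..} \<and>
      (\<Sum>i<n. g (r i)) \<le> (\<Sum>k\<in>F. g (e2ennreal \<bar>a k\<bar>))"
  proof (induction n)
    case (Suc n)
    then obtain F where F: "finite F" "card F = n" "F \<subseteq> {1..}"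
      "(\<Sum>i<n. g (r i)) \<le> (\<Sum>k\<in>F. g (e2ennreal \<bar>a k\<bar>))" by blast
    have "\<exists>k. 1 \<le> k \<and> k \<notin> F \<and> r n \<le> e2ennreal \<bar>a k\<bar>"
    proof (cases "r n = 0")
      case True
      have "infinite ({1..} - F)"
        using F(1) by (simp add: infinite_Ici)
      then obtain k where "k \<in> {1..} - F"
        using infinite_imp_nonempty by blast
      then show ?thesis
        using True by auto
    next
      case False
      then have less: "r n < rearr a (Suc n)" using assms(2) by auto
      show ?thesis
      proof (rule ccontr)
        assume "\<not> ?thesis"
        then have "{k. 1 \<le> k \<and> r n < e2ennreal \<bar>a k\<bar>} \<subseteq> F" by force
        then have "finite {k. 1 \<le> k \<and> r n < e2ennreal \<bar>a k\<bar>}"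
          "card {k. 1 \<le> k \<and> r n < e2ennreal \<bar>a k\<bar>} \<le> n"
          using F finite_subset card_mono by blast+
        then have "rearr a (Suc n) \<le> r n"
          using less unfolding rearr_altdef[of a "Suc n"]
          by (intro Inf_lower) (auto intro: less_le_trans)
        then show False using less by simp
      qed
    qed
    then obtain k where k: "1 \<le> k" "k \<notin> F" "r n \<le> e2ennreal \<bar>a k\<bar>" by blast
    have "g (r n) \<le> g (e2ennreal \<bar>a k\<bar>)"
      using monoD[OF assms(1) k(3)] .
    then show ?case
      using F k add_mono[OF F(4), of "g (r n)" "g (e2ennreal \<bar>a k\<bar>)"]
      by (intro exI[of _ "insert k F"]) (simp add: add.commute)
  qed auto
  then obtain F where F: "finite F" "F \<subseteq> {1..}"
      "(\<Sum>i<n. g (r i)) \<le> (\<Sum>k\<in>F. g (e2ennreal \<bar>a k\<bar>))" by blast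
  define F' where "F' = (\<lambda>k. k - 1) ` F"
  have "F = Suc ` F'"
    using F(2) by (force simp: F'_def image_image)
  then have "(\<Sum>k\<in>F. g (e2ennreal \<bar>a k\<bar>)) = (\<Sum>k\<in>F'. g (e2ennreal \<bar>a (Suc k)\<bar>))"
    by (simp add: sum.reindex)
  also have "\<dots> \<le> (\<Sum>k. g (e2ennreal \<bar>a (Suc k)\<bar>))"
    using F(1) by (intro sum_le_suminf) (auto simp: F'_def)
  finally show ?thesis using F(3) by simp
qed

section \<open>Both functionals as functionals of the rearrangement, and the modular
  criterion\<close>

definition orl_seq :: "(ennreal \<Rightarrow> ennreal) \<Rightarrow> (nat \<Rightarrow> ennreal) \<Rightarrow> ennreal" where
  "orl_seq A x = Inf {l. 0 < l \<and> l < \<infinity> \<and> (\<Sum>n. A (x n / l)) \<le> 1}"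

lemma orlicz_norm_eq: "orlicz_norm A a = orl_seq A (\<lambda>n. e2ennreal \<bar>a (Suc n)\<bar>)"
  by (simp add: orlicz_norm_def orl_seq_def)

lemma orlicz_norm_rearr:
  assumes "young_function A"
  shows "orlicz_norm A a = orl_seq A (\<lambda>n. rearr a (Suc n))"
proof (rule antisym)
  have mono: "mono (\<lambda>x. A (x / l))" for l
    using young_function_mono[OF assms] by (auto simp: mono_def divide_right_mono_ennreal)
  show "orlicz_norm A a \<le> orl_seq A (\<lambda>n. rearr a (Suc n))"
    unfolding orlicz_norm_eq orl_seq_def
  proof (rule Inf_superset_mono, safe)
    fix l assume l: "(\<Sum>n. A (rearr a (Suc n) / l)) \<le> 1"
    have "(\<Sum>n. A (e2ennreal \<bar>a (Suc n)\<bar> / l)) \<le> (\<Sum>n. A (rearr a (Suc n) / l))"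
    proof (rule suminf_le_const)
      fix n
      have "(\<Sum>i<n. A (e2ennreal \<bar>a (Suc i)\<bar> / l)) = (\<Sum>k\<in>Suc ` {..<n}. A (e2ennreal \<bar>a k\<bar> / l))"
        by (simp add: sum.reindex)
      also have "\<dots> \<le> (\<Sum>i<card (Suc ` {..<n}). A (rearr a (Suc i) / l))"
        by (intro sum_le_sum_rearr[where g = "\<lambda>x. A (x / l)"] mono) auto
      also have "\<dots> = (\<Sum>i<n. A (rearr a (Suc i) / l))"
        by (simp add: card_image)
      also have "\<dots> \<le> (\<Sum>n. A (rearr a (Suc n) / l))"
        by (intro sum_le_suminf) auto
      finally show "(\<Sum>i<n. A (e2ennreal \<bar>a (Suc i)\<bar> / l)) \<le> (\<Sum>n. A (rearr a (Suc n) / l))" .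
    qed auto
    then show "(\<Sum>n. A (e2ennreal \<bar>a (Suc n)\<bar> / l)) \<le> 1" using l by simp
  qed
  show "orl_seq A (\<lambda>n. rearr a (Suc n)) \<le> orlicz_norm A a"
    unfolding orlicz_norm_eq orl_seq_def[of A "\<lambda>n. e2ennreal \<bar>a (Suc n)\<bar>"]
  proof (rule Inf_greatest, safe)
    fix l assume l: "0 < l" "l < \<infinity>" "(\<Sum>n. A (e2ennreal \<bar>a (Suc n)\<bar> / l)) \<le> 1"
    obtain L where L: "l = ennreal L" "L > 0"
      using l by (cases l) auto
    obtain T where T: "T > 0" "A (ennreal T) > 1"
      using young_function_large[OF assms] .
    \<comment> \<open>A single term of the modular is at most 1 while \<open>A T > 1\<close>, so the
      sequence is bounded and its rearrangement is real-valued.\<close>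
    have le: "e2ennreal \<bar>a (Suc k)\<bar> \<le> ennreal (L * T)" for k
    proof -
      have "A (e2ennreal \<bar>a (Suc k)\<bar> / l) \<le> 1"
        using sum_le_suminf[of "\<lambda>n. A (e2ennreal \<bar>a (Suc n)\<bar> / l)" "{k}"] l(3) by simp
      then have "\<not> ennreal T \<le> e2ennreal \<bar>a (Suc k)\<bar> / l"
        using T(2) monoD[OF young_function_mono[OF assms]] by (metis le_less_trans less_le_not_le)
      then show ?thesis
        using L T by (cases "e2ennreal \<bar>a (Suc k)\<bar>") (auto simp: divide_ennreal ennreal_top_divide field_simps)
    qed
    have fin: "rearr a (Suc n) \<le> ennreal (L * T)" for n
    proof -
      have "{k. 1 \<le> k \<and> ennreal (L * T) < e2ennreal \<bar>a k\<bar>} = {}"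
      proof safe
        fix k :: nat assume "1 \<le> k" "ennreal (L * T) < e2ennreal \<bar>a k\<bar>"
        then show "k \<in> {}" using le[of "k - 1"] by simp
      qed
      then show ?thesis
        unfolding rearr_altdef by (intro Inf_lower) (simp only: mem_Collect_eq, simp)
    qed
    define R where "R n = enn2real (rearr a (Suc n))" for n
    have R: "rearr a (Suc n) = ennreal (R n)" "R n \<ge> 0" for n
      using order.strict_trans1[OF fin[of n] ennreal_less_top] by (simp_all add: R_def)
    \<comment> \<open>The rearrangement can be approached only strictly from below. Enlarging the
      radius to \<open>L + e\<close> shrinks each non-zero \<open>R i\<close> by the factor
      \<open>L / (L + e) < 1\<close>, as \<open>sum_less_rearr_le\<close> requires; \<open>e\<close>
      is arbitrary.\<close>
    show "orl_seq A (\<lambda>n. rearr a (Suc n)) \<le> l"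
    proof (rule ennreal_le_epsilon)
      fix e :: real assume e: "0 < e"
      have "(\<Sum>n. A (ennreal (R n) / ennreal (L + e))) \<le> 1"
      proof (rule suminf_le_const)
        fix n
        have "(\<Sum>i<n. A (ennreal (R i) / ennreal (L + e)))
            = (\<Sum>i<n. A (ennreal (L / (L + e) * R i) / l))"
          using L e R by (intro sum.cong refl arg_cong[where f = A]) (simp add: divide_ennreal del: ennreal_plus)
        also have "\<dots> \<le> (\<Sum>k. A (e2ennreal \<bar>a (Suc k)\<bar> / l))"
        proof (rule sum_less_rearr_le[where g = "\<lambda>x. A (x / l)", OF mono])
          fix i
          show "ennreal (L / (L + e) * R i) < rearr a (Suc i) \<or> ennreal (L / (L + e) * R i) = 0"
          proof (cases "R i = 0")
            case False
            then have "L / (L + e) * R i < 1 * R i"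
              using L e R(2)[of i] by (intro mult_strict_right_mono) auto
            then show ?thesis
              using R L e False R(2)[of i] by (auto intro!: ennreal_lessI simp: less_le)
          qed auto
        qed
        finally show "(\<Sum>i<n. A (ennreal (R i) / ennreal (L + e))) \<le> 1" using l(3) by simp
      qed auto
      then show "orl_seq A (\<lambda>n. rearr a (Suc n)) \<le> l + ennreal e"
        unfolding orl_seq_def R L(1) using L e by (intro Inf_lower) (auto simp flip: ennreal_plus)
    qed
  qed
qed


definition lz_seq :: "ennreal \<Rightarrow> ennreal \<Rightarrow> real \<Rightarrow> (nat \<Rightarrow> ennreal) \<Rightarrow> ennreal" where
  "lz_seq p q \<alpha> x =
     (if q = \<infinity> then (SUP n. x n * ennreal (plog (recip p - recip q) \<alpha> (real (Suc n))))
      else enn_powr (\<Sum>n. enn_powr (x n * ennreal (plog (recip p - recip q) \<alpha> (real (Suc n)))) (enn2real q))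
        (1 / enn2real q))"

lemma lz_norm_rearr: "lz_norm p q \<alpha> a = lz_seq p q \<alpha> (\<lambda>n. rearr a (Suc n))"
proof -
  have "{1..} = range Suc"
    by (metis One_nat_def UNIV_nat_eq atLeast_0 atLeast_Suc_greaterThan greaterThan_0)
  then have "(SUP n\<in>{1..}. f n) = (SUP n. f (Suc n))" for f :: "nat \<Rightarrow> ennreal"
    by (simp only: image_image)
  then show ?thesis
    by (simp add: lz_norm_def lq_norm_def lz_seq_def plog_def)
qed

text \<open>For \<open>y \<ge> 0\<close> and \<open>B \<ge> 0\<close> this says that the functional
  is at most \<open>B\<close>, with the outer root moved to the other side. The entry
  \<open>y n\<close> stands at position \<open>n + 1\<close>.\<close>

definition lz_le :: "ennreal \<Rightarrow> ennreal \<Rightarrow> real \<Rightarrow> real \<Rightarrow> (nat \<Rightarrow> real) \<Rightarrow> bool" where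
  "lz_le p q \<alpha> B y \<longleftrightarrow>
     (if q = \<infinity> then \<forall>n. y n * plog (recip p - recip q) \<alpha> (real (Suc n)) \<le> B
      else (\<Sum>n. ennreal ((y n * plog (recip p - recip q) \<alpha> (real (Suc n))) powr enn2real q))
        \<le> ennreal (B powr enn2real q))"

lemma plog_Suc_pos [simp]: "0 < plog s \<beta> (real (Suc n))" "0 \<le> plog s \<beta> (real (Suc n))"
  using plog_pos[of "real (Suc n)" s \<beta>] by auto

lemma enn_powr_ennreal: "0 \<le> x \<Longrightarrow> enn_powr (ennreal x) r = ennreal (x powr r)"
  by (simp add: enn_powr_def)

lemma enn_powr_inverse_le_iff:
  assumes "0 < r" "0 \<le> B"
  shows "enn_powr x (1 / r) \<le> ennreal B \<longleftrightarrow> x \<le> ennreal (B powr r)"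
proof (cases x)
  case (real u)
  have "u powr (1 / r) \<le> B \<longleftrightarrow> u \<le> B powr r"
  proof
    assume "u powr (1 / r) \<le> B"
    then have "(u powr (1 / r)) powr r \<le> B powr r"
      using assms by (intro powr_mono2) auto
    then show "u \<le> B powr r" using assms real by (simp add: powr_powr)
  next
    assume "u \<le> B powr r"
    then have "u powr (1 / r) \<le> (B powr r) powr (1 / r)"
      using assms real by (intro powr_mono2) auto
    then show "u powr (1 / r) \<le> B" using assms by (simp add: powr_powr)
  qed
  then show ?thesis
    using real assms by (simp add: enn_powr_ennreal)
qed (auto simp: enn_powr_def top_unique)

lemma exponent_pos: "0 < q \<Longrightarrow> q \<noteq> \<infinity> \<Longrightarrow> 0 < enn2real q"
  by (simp add: enn2real_positive_iff less_top)

lemma lz_seq_le_iff: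
  assumes "0 < q" "\<And>n. 0 \<le> y n" "0 \<le> B"
  shows "lz_seq p q \<alpha> (\<lambda>n. ennreal (y n)) \<le> ennreal B \<longleftrightarrow> lz_le p q \<alpha> B y"
proof -
  have "ennreal (y n) * ennreal (plog s \<alpha> (real (Suc n))) = ennreal (y n * plog s \<alpha> (real (Suc n)))"
    for n s
    using assms(2)[of n] by (simp add: ennreal_mult del: of_nat_Suc)
  moreover have "0 \<le> y n * plog s \<alpha> (real (Suc n))" for n s
    using assms(2)[of n] by (intro mult_nonneg_nonneg plog_Suc_pos)
  ultimately show ?thesis
    using assms exponent_pos[of q]
    by (simp add: lz_seq_def lz_le_def enn_powr_ennreal enn_powr_inverse_le_iff SUP_le_iff del: of_nat_Suc)
qed

lemma lz_seq_finiteD: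
  assumes "0 < q" "lz_seq p q \<alpha> x < \<infinity>"
  shows "x n < \<infinity>"
proof (rule ccontr)
  assume "\<not> x n < \<infinity>"
  then have xn: "x n * ennreal (plog (recip p - recip q) \<alpha> (real (Suc n))) = \<infinity>"
    using plog_Suc_pos(1)[of "recip p - recip q" \<alpha> n]
    by (simp add: less_top[symmetric] ennreal_top_mult del: of_nat_Suc plog_Suc_pos)
  have "lz_seq p q \<alpha> x = \<infinity>"
  proof (cases "q = \<infinity>")
    case True
    then show ?thesis
      using SUP_upper[of n UNIV "\<lambda>n. x n * ennreal (plog (recip p - recip q) \<alpha> (real (Suc n)))"] xn
      by (simp add: lz_seq_def top_unique del: of_nat_Suc)
  next
    case False
    define f where
      "f n = enn_powr (x n * ennreal (plog (recip p - recip q) \<alpha> (real (Suc n)))) (enn2real q)" for n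
    have "f n = \<infinity>"
      by (simp add: f_def xn enn_powr_def del: of_nat_Suc)
    then have "(\<Sum>n. f n) = \<infinity>"
      using sum_le_suminf[of f "{n}"] by (simp add: top_unique)
    then show ?thesis
      using False unfolding lz_seq_def f_def[symmetric] by (simp add: enn_powr_def)
  qed
  then show False using assms(2) by simp
qed

lemma lz_le_scale:
  assumes "0 < s" "0 \<le> B" "\<And>n. 0 \<le> y n"
  shows "lz_le p q \<alpha> (s * B) (\<lambda>n. s * y n) \<longleftrightarrow> lz_le p q \<alpha> B y"
proof (cases "q = \<infinity>")
  case True
  then show ?thesis
    using assms by (simp add: lz_le_def mult.assoc del: of_nat_Suc)
next
  case False
  define r where "r = enn2real q"
  define w where "w n = plog (recip p - recip q) \<alpha> (real (Suc n))" for n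
  have "(\<Sum>n. ennreal ((s * y n * w n) powr r)) = (\<Sum>n. ennreal (s powr r) * ennreal ((y n * w n) powr r))"
    using assms by (simp add: powr_mult ennreal_mult mult.assoc w_def del: of_nat_Suc)
  also have "\<dots> = ennreal (s powr r) * (\<Sum>n. ennreal ((y n * w n) powr r))"
    by (rule ennreal_suminf_cmult)
  finally have *: "(\<Sum>n. ennreal ((s * y n * w n) powr r))
    = ennreal (s powr r) * (\<Sum>n. ennreal ((y n * w n) powr r))" .
  have "ennreal ((s * B) powr r) = ennreal (s powr r) * ennreal (B powr r)"
    using assms by (simp add: powr_mult ennreal_mult)
  then show ?thesis
    using False assms * unfolding lz_le_def w_def[symmetric] r_def[symmetric]
    by (simp add: ennreal_mult_le_mult_iff)
qed

text \<open>Rearrangement invariance reduces to non-increasing sequences, and finiteness of either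
  functional makes the entries real. Homogeneity reduces the two norm inequalities to the unit
  balls, where the Orlicz norm is replaced by its modular. Equality of the spaces as sets is a
  consequence of the inequalities.\<close>

lemma lz_eq_orlicz_iff:
  assumes "0 < q" "young_function A"
  shows "lz_eq_orlicz p q \<alpha> A \<longleftrightarrow>
    (\<exists>C>0. \<forall>y. antimono y \<and> (\<forall>n. 0 \<le> y n) \<longrightarrow>
       (lz_le p q \<alpha> 1 y \<longrightarrow> (\<Sum>n. A (ennreal (y n / C))) \<le> 1) \<and>
       ((\<Sum>n. A (ennreal (y n))) \<le> 1 \<longrightarrow> lz_le p q \<alpha> C y))"
proof
  assume "lz_eq_orlicz p q \<alpha> A"
  then obtain c C where c: "c > 0" "C > 0"
    "\<And>a. ennreal c * lz_norm p q \<alpha> a \<le> orlicz_norm A a"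
    "\<And>a. orlicz_norm A a \<le> ennreal C * lz_norm p q \<alpha> a"
    unfolding lz_eq_orlicz_def equivalent_functionals_def by blast
  \<comment> \<open>The Orlicz norm is an infimum that need not be attained; \<open>K > C\<close>
    strictly yields an admissible radius below \<open>K\<close>.\<close>
  define K where "K = max (C + 1) (1 / c)"
  have K: "C < K" "1 / c \<le> K" "K > 0" using c by (auto simp: K_def)
  show "\<exists>C>0. \<forall>y. antimono y \<and> (\<forall>n. 0 \<le> y n) \<longrightarrow>
       (lz_le p q \<alpha> 1 y \<longrightarrow> (\<Sum>n. A (ennreal (y n / C))) \<le> 1) \<and>
       ((\<Sum>n. A (ennreal (y n))) \<le> 1 \<longrightarrow> lz_le p q \<alpha> C y)"
  proof (intro exI[of _ K] conjI allI impI K(3); elim conjE)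
    fix y :: "nat \<Rightarrow> real" assume y: "antimono y" "\<forall>n. 0 \<le> y n"
    define a where "a = (\<lambda>n. enn2ereal (ennreal (y (n - 1))))"
    have a: "rearr a (Suc n) = ennreal (y n)" for n
      unfolding a_def using y(1)
      by (intro rearr_antimono_seq[where y = "\<lambda>n. ennreal (y n)"]) (auto simp: monotone_def ennreal_leI)
    have norms: "lz_norm p q \<alpha> a = lz_seq p q \<alpha> (\<lambda>n. ennreal (y n))"
      "orlicz_norm A a = orl_seq A (\<lambda>n. ennreal (y n))"
      by (simp_all add: lz_norm_rearr orlicz_norm_rearr[OF assms(2)] a)
    {
      assume "lz_le p q \<alpha> 1 y"
      then have "lz_norm p q \<alpha> a \<le> 1"
        unfolding norms using lz_seq_le_iff[OF assms(1), of y 1] y by simp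
      then have "ennreal C * lz_norm p q \<alpha> a \<le> ennreal C * 1"
        by (intro mult_left_mono) auto
      with c(4)[of a] have "orlicz_norm A a \<le> ennreal C" by simp
      also have "\<dots> < ennreal K" using K c by (intro ennreal_lessI) auto
      finally obtain l where l: "0 < l" "l < \<infinity>" "l < ennreal K" "(\<Sum>n. A (ennreal (y n) / l)) \<le> 1"
        unfolding norms orl_seq_def Inf_less_iff by auto
      obtain L where L: "l = ennreal L" "L > 0" using l by (cases l) auto
      then have "L \<le> K" using l(3) K by (simp add: ennreal_less_iff)
      have "(\<Sum>n. A (ennreal (y n / K))) \<le> (\<Sum>n. A (ennreal (y n) / l))"
        unfolding L using L(2) y K \<open>L \<le> K\<close>
        by (intro suminf_le monoD[OF young_function_mono[OF assms(2)]])
           (auto simp: divide_ennreal intro!: ennreal_leI divide_left_mono)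
      with l(4) show "(\<Sum>n. A (ennreal (y n / K))) \<le> 1" by simp
    next
      assume "(\<Sum>n. A (ennreal (y n))) \<le> 1"
      then have "orlicz_norm A a \<le> 1"
        unfolding norms orl_seq_def by (intro Inf_lower) (auto simp: divide_ennreal_def)
      then have "ennreal c * lz_norm p q \<alpha> a \<le> 1"
        using c(3)[of a] by simp
      then have "ennreal (1 / c) * (ennreal c * lz_norm p q \<alpha> a) \<le> ennreal (1 / c) * 1"
        by (intro mult_left_mono) auto
      moreover have "ennreal (1 / c) * (ennreal c * lz_norm p q \<alpha> a) = lz_norm p q \<alpha> a"
        using c by (simp flip: mult.assoc ennreal_mult)
      ultimately have "lz_norm p q \<alpha> a \<le> ennreal (1 / c)" by simp
      also have "\<dots> \<le> ennreal K" using K by (intro ennreal_leI)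
      finally show "lz_le p q \<alpha> K y"
        unfolding norms using lz_seq_le_iff[OF assms(1), of y K] y K by simp
    }
  qed
next
  assume "\<exists>C>0. \<forall>y. antimono y \<and> (\<forall>n. 0 \<le> y n) \<longrightarrow>
       (lz_le p q \<alpha> 1 y \<longrightarrow> (\<Sum>n. A (ennreal (y n / C))) \<le> 1) \<and>
       ((\<Sum>n. A (ennreal (y n))) \<le> 1 \<longrightarrow> lz_le p q \<alpha> C y)"
  then obtain C where C: "C > 0"
    "\<And>y. \<lbrakk>antimono y; \<And>n. 0 \<le> y n; lz_le p q \<alpha> 1 y\<rbrakk> \<Longrightarrow> (\<Sum>n. A (ennreal (y n / C))) \<le> 1"
    "\<And>y. \<lbrakk>antimono y; \<And>n. 0 \<le> y n; (\<Sum>n. A (ennreal (y n))) \<le> 1\<rbrakk> \<Longrightarrow> lz_le p q \<alpha> C y"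
    by blast
  have *: "orlicz_norm A a \<le> ennreal C * lz_norm p q \<alpha> a"
       "lz_norm p q \<alpha> a \<le> ennreal C * orlicz_norm A a" for a
  proof -
    define x where "x n = rearr a (Suc n)" for n
    have x: "antimono x"
      by (auto simp: x_def monotone_def intro: rearr_antimono)
    have norms: "lz_norm p q \<alpha> a = lz_seq p q \<alpha> x" "orlicz_norm A a = orl_seq A x"
      by (simp_all add: lz_norm_rearr orlicz_norm_rearr[OF assms(2)] x_def[abs_def])
    have real: "antimono (\<lambda>n. enn2real (x n))" "x = (\<lambda>n. ennreal (enn2real (x n)))" if "\<And>n. x n < \<infinity>"
      using that x by (auto simp: monotone_def intro!: enn2real_mono)
    have 1: "orl_seq A x \<le> ennreal (C * s)" if s: "lz_seq p q \<alpha> x \<le> ennreal s" "s > 0" for s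
    proof -
      define y where "y n = enn2real (x n)" for n
      have "lz_seq p q \<alpha> x < \<infinity>" using le_less_trans[OF s(1) ennreal_less_top] by simp
      then have y: "antimono y" "x = (\<lambda>n. ennreal (y n))" "0 \<le> y n" for n
        using real lz_seq_finiteD[OF assms(1)] by (auto simp: y_def[abs_def])
      then have "lz_le p q \<alpha> (s * 1) (\<lambda>n. s * (y n / s))"
        using s lz_seq_le_iff[OF assms(1), of y s] by simp
      then have "lz_le p q \<alpha> 1 (\<lambda>n. y n / s)"
        using s y by (subst (asm) lz_le_scale) auto
      then have "(\<Sum>n. A (ennreal (y n / s / C))) \<le> 1"
        using y s by (intro C(2)) (auto simp: monotone_def divide_right_mono)
      then show ?thesis
        unfolding orl_seq_def y(2) using y(3) s C(1)
        by (intro Inf_lower) (auto simp: divide_ennreal mult_ac)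
    qed
    show "orlicz_norm A a \<le> ennreal C * lz_norm p q \<alpha> a"
    proof (cases "lz_seq p q \<alpha> x")
      case (real u)
      \<comment> \<open>The value \<open>u\<close> may be 0, where dividing by it is impossible;
        hence the normalisation by \<open>u + e / C\<close>.\<close>
      have "orl_seq A x \<le> ennreal (C * u) + ennreal e" if "e > 0" for e
        using 1[of "u + e / C"] real that C(1) add_nonneg_pos[of u "e / C"]
        by (auto simp: algebra_simps ennreal_leI simp flip: ennreal_plus)
      then have "orl_seq A x \<le> ennreal (C * u)"
        by (rule ennreal_le_epsilon) auto
      then show ?thesis unfolding norms using real C(1) by (simp add: ennreal_mult)
    qed (use C(1) norms in \<open>simp add: ennreal_mult_top\<close>)
    show "lz_norm p q \<alpha> a \<le> ennreal C * orlicz_norm A a"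
    proof -
      have "lz_seq p q \<alpha> x * ennreal (1 / C) \<le> orl_seq A x"
        unfolding orl_seq_def
      proof (rule Inf_greatest, safe)
        fix l assume l: "0 < l" "l < \<infinity>" "(\<Sum>n. A (x n / l)) \<le> 1"
        then obtain L where L: "l = ennreal L" "L > 0" by (cases l) auto
        have "x n < \<infinity>" for n
        proof (rule ccontr)
          assume "\<not> x n < \<infinity>"
          then have "A (x n / l) = \<infinity>"
            using L young_functionD(2)[OF assms(2)] by (simp add: less_top[symmetric] ennreal_top_divide)
          then show False
            using l(3) sum_le_suminf[of "\<lambda>n. A (x n / l)" "{n}"] by (simp add: top_unique)
        qed
        define y where "y n = enn2real (x n)" for n
        have y: "antimono y" "x = (\<lambda>n. ennreal (y n))" "0 \<le> y n" for n
          using real[OF \<open>\<And>n. x n < \<infinity>\<close>] by (auto simp: y_def[abs_def])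
        have "(\<Sum>n. A (ennreal (y n / L))) \<le> 1"
          using l(3) L y(3) unfolding y(2) by (simp add: divide_ennreal)
        then have "lz_le p q \<alpha> C (\<lambda>n. y n / L)"
          using y L by (intro C(3)) (auto simp: monotone_def divide_right_mono)
        then have "lz_le p q \<alpha> (L * C) (\<lambda>n. L * (y n / L))"
          using y(3) L C(1) by (subst lz_le_scale) auto
        then have "lz_seq p q \<alpha> x \<le> ennreal (L * C)"
          unfolding y(2) using L C(1) y(3) by (subst lz_seq_le_iff[OF assms(1)]) auto
        then have "lz_seq p q \<alpha> x * ennreal (1 / C) \<le> ennreal (L * C) * ennreal (1 / C)"
          by (intro mult_right_mono) auto
        also have "\<dots> = l" using L C(1) by (simp flip: ennreal_mult)
        finally show "lz_seq p q \<alpha> x * ennreal (1 / C) \<le> l" .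
      qed
      then have "ennreal C * (lz_seq p q \<alpha> x * ennreal (1 / C)) \<le> ennreal C * orl_seq A x"
        by (intro mult_left_mono) auto
      moreover have "ennreal C * (lz_seq p q \<alpha> x * ennreal (1 / C)) = lz_seq p q \<alpha> x"
        using C(1) by (simp add: mult.left_commute[of "ennreal C"] flip: ennreal_mult)
      ultimately show ?thesis unfolding norms by simp
    qed
  qed
  have "ennreal (1 / C) * lz_norm p q \<alpha> a \<le> orlicz_norm A a" for a
  proof -
    have "ennreal (1 / C) * lz_norm p q \<alpha> a \<le> ennreal (1 / C) * (ennreal C * orlicz_norm A a)"
      by (intro mult_left_mono *) auto
    also have "\<dots> = orlicz_norm A a"
      using C(1) by (simp flip: mult.assoc ennreal_mult)
    finally show ?thesis .
  qed
  then have "equivalent_functionals (lz_norm p q \<alpha>) (orlicz_norm A)"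
    unfolding equivalent_functionals_def using C(1) *(1)
    by (intro exI[of _ "1 / C"] exI[of _ C]) auto
  moreover have "lz_space p q \<alpha> = orlicz_space A"
    unfolding lz_space_def orlicz_space_def
    using le_less_trans[OF *(1)] le_less_trans[OF *(2)] by (auto simp: ennreal_mult_less_top)
  ultimately show "lz_eq_orlicz p q \<alpha> A"
    by (simp add: lz_eq_orlicz_def)
qed

subsection \<open>The case of equal finite exponents\<close>

lemma suminf_inverse_squares:
  obtains S :: real where "S \<ge> 0" "(\<Sum>n. ennreal (1 / real (Suc n) ^ 2)) = ennreal S"
proof -
  have "(\<lambda>n. 1 / real (Suc n) ^ 2) sums (pi\<^sup>2 / 6)"
    using inverse_squares_sums by (simp add: add.commute)
  then have "(\<Sum>n. ennreal (1 / real (Suc n) ^ 2)) = ennreal (pi\<^sup>2 / 6)"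
    by (intro suminf_ennreal_eq) auto
  then show ?thesis by (intro that[of "pi\<^sup>2 / 6"]) auto
qed

lemma mult_antimono_le_suminf:
  fixes f :: "nat \<Rightarrow> ennreal"
  assumes "antimono f"
  shows "of_nat (Suc n) * f n \<le> (\<Sum>k. f k)"
proof -
  have "of_nat (Suc n) * f n = (\<Sum>k<Suc n. f n)" by simp
  also have "\<dots> \<le> (\<Sum>k<Suc n. f k)"
    by (intro sum_mono antimonoD[OF assms]) auto
  also have "\<dots> \<le> (\<Sum>k. f k)"
    by (intro sum_le_suminf) auto
  finally show ?thesis .
qed

text \<open>Chebyshev's inequality: the first \<open>n + 1\<close> terms of the modular are each at
  least \<open>A (y n)\<close>.\<close>

lemma young_modular_decay:
  assumes "young_function A" "antimono y" "\<And>n. 0 \<le> y n" "(\<Sum>n. A (ennreal (y n))) \<le> 1"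
  shows "A (ennreal (y n)) \<le> ennreal (1 / real (Suc n))"
proof -
  have "antimono (\<lambda>n. A (ennreal (y n)))"
    using assms(2) by (auto simp: monotone_def intro!: monoD[OF young_function_mono[OF assms(1)]] ennreal_leI)
  then have "of_nat (Suc n) * A (ennreal (y n)) \<le> 1"
    by (rule order_trans[OF mult_antimono_le_suminf assms(4)])
  then have "ennreal (1 / real (Suc n)) * (ennreal (real (Suc n)) * A (ennreal (y n)))
      \<le> ennreal (1 / real (Suc n)) * 1"
    by (intro mult_left_mono) (auto simp: ennreal_of_nat_eq_real_of_nat)
  then show ?thesis
    by (simp add: mult.assoc[symmetric] ennreal_mult[symmetric] del: of_nat_Suc)
qed

text \<open>This is where convexity of \<open>A\<close> pays for constants: any finite bound on a
  modular becomes 1 after a dilation, so estimates of modulars may lose factors and summable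
  errors.\<close>

lemma young_modular_scale:
  assumes "young_function A" "\<And>n. 0 \<le> y n" "1 \<le> S" "(\<Sum>n. A (ennreal (y n))) \<le> ennreal S"
  shows "(\<Sum>n. A (ennreal (y n / S))) \<le> 1"
proof -
  have "A (ennreal (y n / S)) \<le> ennreal (1 / S) * A (ennreal (y n))" for n
    using young_function_scale[OF assms(1), of "1 / S" "ennreal (y n)"] assms(2)[of n] assms(3)
    by (simp flip: ennreal_mult)
  then have "(\<Sum>n. A (ennreal (y n / S))) \<le> (\<Sum>n. ennreal (1 / S) * A (ennreal (y n)))"
    by (intro suminf_le) auto
  also have "\<dots> = ennreal (1 / S) * (\<Sum>n. A (ennreal (y n)))"
    by (rule ennreal_suminf_cmult)
  also have "\<dots> \<le> ennreal (1 / S) * ennreal S"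
    by (intro mult_left_mono assms) auto
  also have "\<dots> = 1" using assms(3) by (simp flip: ennreal_mult)
  finally show ?thesis .
qed

lemma young_modular_bounded:
  assumes "young_function A" "A (ennreal T) > 1" "(\<Sum>n. A (ennreal (y n))) \<le> 1"
  shows "y n < T"
proof (rule ccontr)
  assume "\<not> y n < T"
  then have "A (ennreal T) \<le> A (ennreal (y n))"
    by (intro monoD[OF young_function_mono[OF assms(1)]] ennreal_leI) auto
  also have "\<dots> \<le> 1"
    using sum_le_suminf[of "\<lambda>n. A (ennreal (y n))" "{n}"] assms(3) by simp
  finally show False using assms(2) by simp
qed

text \<open>
  For \<open>z \<ge> N powr - K\<close> the logarithms of \<open>1 / z\<close> and of \<open>N\<close> are comparable; for smaller \<open>z\<close> both
  quantities are dominated by the summable error \<open>1 / N\<^sup>2\<close>.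
\<close>

lemma log_weight_exchange:
  fixes P \<beta> :: real
  assumes "P > 0"
  obtains C where "C > 0"
    "\<And>z N. \<lbrakk>0 < z; 1 \<le> N; z \<le> N powr (- 1 / (2 * P))\<rbrakk> \<Longrightarrow>
       z powr P * (1 - ln z) powr \<beta> \<le> C * (z powr P * (1 + ln N) powr \<beta> + 1 / N ^ 2)"
    "\<And>z N. \<lbrakk>0 < z; 1 \<le> N; z \<le> N powr (- 1 / (2 * P))\<rbrakk> \<Longrightarrow>
       z powr P * (1 + ln N) powr \<beta> \<le> C * (z powr P * (1 - ln z) powr \<beta> + 1 / N ^ 2)"
proof -
  obtain D1 where D1: "D1 > 0" "\<And>x. x \<ge> 1 \<Longrightarrow> (1 + ln x) powr \<beta> \<le> D1 * x powr (P / 2)"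
    using log_powr_le[of "P / 2" \<beta>] assms by auto
  obtain D2 where D2: "D2 > 0" "\<And>x. x \<ge> 1 \<Longrightarrow> (1 + ln x) powr \<beta> \<le> D2 * x powr 1"
    using log_powr_le[of 1 \<beta>] by auto
  \<comment> \<open>\<kappa> reflects the assumed decay, which gives
    \<open>- ln z \<ge> ln N / (2 * P)\<close>. \<open>K * P \<ge> 6\<close> makes both quantities
    small below the threshold: one is of order \<open>N powr (- K * P / 2)\<close>, the other of
    order \<open>N powr (1 - K * P)\<close>, and both exponents are at most -2.\<close>
  define K \<kappa> where "K = max 1 (6 / P)" and "\<kappa> = min 1 (1 / (2 * P))"
  have K: "K \<ge> 1" "K * P \<ge> 6" and \<kappa>: "\<kappa> > 0" "\<kappa> \<le> 1" "\<kappa> \<le> 1 / (2 * P)"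
    using assms by (auto simp: K_def \<kappa>_def max_def field_simps)
  define C where "C = D1 + D2 + max (\<kappa> powr \<beta>) (K powr \<beta>) + max ((1 / K) powr \<beta>) ((1 / \<kappa>) powr \<beta>)"
  have nonneg: "0 \<le> max (\<kappa> powr \<beta>) (K powr \<beta>)" "0 \<le> max ((1 / K) powr \<beta>) ((1 / \<kappa>) powr \<beta>)"
    by (auto simp: le_max_iff_disj)
  have C: "D1 \<le> C" "D2 \<le> C" "max (\<kappa> powr \<beta>) (K powr \<beta>) \<le> C"
      "max ((1 / K) powr \<beta>) ((1 / \<kappa>) powr \<beta>) \<le> C"
    unfolding C_def using D1(1) D2(1) nonneg by linarith+
  have main: "z powr P * (1 - ln z) powr \<beta> \<le> C * (z powr P * (1 + ln N) powr \<beta> + 1 / N ^ 2) \<and>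
       z powr P * (1 + ln N) powr \<beta> \<le> C * (z powr P * (1 - ln z) powr \<beta> + 1 / N ^ 2)"
    if zN: "0 < z" "1 \<le> N" "z \<le> N powr (- 1 / (2 * P))" for z N
  proof (cases "z \<ge> N powr (- K)")
    case True
    have "ln (N powr (- K)) \<le> ln z"
      using True zN by (intro ln_mono) auto
    then have up: "- ln z \<le> K * ln N" using zN by (simp add: ln_powr)
    have "ln z \<le> ln (N powr (- 1 / (2 * P)))"
      using zN by (intro ln_mono) auto
    then have lo: "1 / (2 * P) * ln N \<le> - ln z" using zN by (simp add: ln_powr)
    have N: "0 < 1 + ln N" "0 \<le> ln N" using zN one_plus_ln_pos[of N] by auto
    have "\<kappa> * ln N \<le> 1 / (2 * P) * ln N"
      using \<kappa> N by (intro mult_right_mono) auto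
    then have cmp: "\<kappa> * (1 + ln N) \<le> 1 - ln z" "1 - ln z \<le> K * (1 + ln N)"
      using lo up K \<kappa> by (auto simp: algebra_simps)
    then have pos: "0 < 1 - ln z" using \<kappa> N by (smt (verit) mult_pos_pos)
    have "(1 - ln z) powr \<beta> \<le> max (\<kappa> powr \<beta>) (K powr \<beta>) * (1 + ln N) powr \<beta>"
      using N \<kappa> cmp by (intro powr_comparable)
    also have "\<dots> \<le> C * (1 + ln N) powr \<beta>"
      by (intro mult_right_mono C) auto
    finally have 1: "(1 - ln z) powr \<beta> \<le> C * (1 + ln N) powr \<beta>" .
    have "(1 + ln N) powr \<beta> \<le> max ((1 / K) powr \<beta>) ((1 / \<kappa>) powr \<beta>) * (1 - ln z) powr \<beta>"
      using pos K \<kappa> cmp by (intro powr_comparable) (auto simp: field_simps)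
    also have "\<dots> \<le> C * (1 - ln z) powr \<beta>"
      by (intro mult_right_mono C) auto
    finally have 2: "(1 + ln N) powr \<beta> \<le> C * (1 - ln z) powr \<beta>" .
    have "0 \<le> C * (1 / N ^ 2)" using C D1(1) by auto
    then show ?thesis
      using mult_left_mono[OF 1, of "z powr P"] mult_left_mono[OF 2, of "z powr P"]
      by (auto simp: algebra_simps)
  next
    case False
    have N2: "N powr (- 2) = 1 / N ^ 2"
      using zN by (simp add: powr_minus powr_numeral field_simps)
    have "N powr (- 1 / (2 * P)) \<le> N powr 0"
      using zN assms by (intro powr_mono) auto
    then have z1: "z \<le> 1" using zN by simp
    then have "(1 + ln (1 / z)) powr \<beta> \<le> D1 * (1 / z) powr (P / 2)"
      using zN by (intro D1) auto
    then have "(1 - ln z) powr \<beta> \<le> D1 * z powr (- P / 2)"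
      using zN by (simp add: ln_div powr_divide powr_minus field_simps)
    then have "z powr P * (1 - ln z) powr \<beta> \<le> z powr P * (D1 * z powr (- P / 2))"
      by (intro mult_left_mono) auto
    also have "\<dots> = D1 * z powr (P / 2)"
      using powr_add[of z P "- P / 2"] by simp
    also have "\<dots> \<le> D1 * (N powr (- K)) powr (P / 2)"
      using False zN assms D1(1) by (intro mult_left_mono powr_mono2) auto
    also have "\<dots> = D1 * N powr (- (K * P / 2))" by (simp add: powr_powr)
    also have "\<dots> \<le> D1 * N powr (- 2)"
      using zN K D1(1) by (intro mult_left_mono powr_mono) auto
    also have "\<dots> \<le> C * (1 / N ^ 2)"
      unfolding N2 using C(1) by (intro mult_right_mono) auto
    finally have 1: "z powr P * (1 - ln z) powr \<beta> \<le> C * (1 / N ^ 2)" .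
    have "z powr P * (1 + ln N) powr \<beta> \<le> (N powr (- K)) powr P * (D2 * N powr 1)"
      using False zN assms by (intro mult_mono powr_mono2 D2) auto
    also have "\<dots> = D2 * N powr (1 - K * P)"
      using powr_add[of N "- K * P" 1] by (simp add: powr_powr)
    also have "\<dots> \<le> D2 * N powr (- 2)"
      using zN K D2(1) by (intro mult_left_mono powr_mono) auto
    also have "\<dots> \<le> C * (1 / N ^ 2)"
      unfolding N2 using C(2) by (intro mult_right_mono) auto
    finally have 2: "z powr P * (1 + ln N) powr \<beta> \<le> C * (1 / N ^ 2)" .
    have "0 \<le> C * (z powr P * (1 + ln N) powr \<beta>)" "0 \<le> C * (z powr P * (1 - ln z) powr \<beta>)"
      using C D1(1) by auto
    then show ?thesis using 1 2 by (auto simp: algebra_simps)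
  qed
  show ?thesis
    using C D1(1) main by (intro that[of C]) auto
qed

text \<open>Monotonicity bounds \<open>y n powr P\<close> times the sum of the first
  \<open>N = n + 1\<close> weights by 1. That sum is of order
  \<open>N * (1 + ln N) powr \<beta>\<close>, hence at least a multiple of
  \<open>N powr (1/2)\<close>: half of the power is spent on a logarithm of unknown sign. This is
  the origin of \<open>1 / (2 * P)\<close> in \<open>log_weight_exchange\<close>. \<open>D\<close>
  is uniform over all sequences.\<close>

lemma lz_modular_decay:
  fixes \<beta> P :: real
  assumes "P > 0"
  shows "\<exists>D>0. \<forall>y n. antimono y \<longrightarrow> (\<forall>n. 0 \<le> y n) \<longrightarrow>
      (\<Sum>n. ennreal (y n powr P * (1 + ln (real (Suc n))) powr \<beta>)) \<le> 1 \<longrightarrow>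
      y n \<le> D * real (Suc n) powr (- 1 / (2 * P))"
proof -
  obtain c where c: "c > 0"
    "\<And>n. n \<ge> 1 \<Longrightarrow> c * plog 1 \<beta> (real n) \<le> (\<Sum>k<n. plog (1 - 1) \<beta> (real (Suc k)))"
    using sum_plog_ge[of 1 \<beta>] by metis
  obtain E where E: "E > 0" "\<And>x. x \<ge> 1 \<Longrightarrow> (1 + ln x) powr (- \<beta>) \<le> E * x powr (1/2)"
    using log_powr_le[of "1/2" "- \<beta>"] by auto
  have main: "y n \<le> (E / c) powr (1 / P) * real (Suc n) powr (- 1 / (2 * P))"
    if y: "antimono y" "\<And>n. 0 \<le> y n"
      and le: "(\<Sum>n. ennreal (y n powr P * (1 + ln (real (Suc n))) powr \<beta>)) \<le> 1" for y n
  proof -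
    define N where "N = real (Suc n)"
    have N: "N \<ge> 1" by (simp add: N_def)
    have "ennreal (y n powr P * (\<Sum>k<Suc n. plog 0 \<beta> (real (Suc k))))
        = (\<Sum>k<Suc n. ennreal (y n powr P * (1 + ln (real (Suc k))) powr \<beta>))"
      by (simp add: sum_distrib_left plog_def del: of_nat_Suc sum.lessThan_Suc)
    also have "\<dots> \<le> (\<Sum>k<Suc n. ennreal (y k powr P * (1 + ln (real (Suc k))) powr \<beta>))"
      using assms y by (intro sum_mono ennreal_leI mult_right_mono powr_mono2) (auto simp: monotone_def)
    also have "\<dots> \<le> 1"
      by (rule order_trans[OF sum_le_suminf le]) auto
    finally have 1: "y n powr P * (\<Sum>k<Suc n. plog 0 \<beta> (real (Suc k))) \<le> 1"
      by (simp add: ennreal_le_1 del: sum.lessThan_Suc)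
    have "N powr (1/2) \<le> E * plog 1 \<beta> N"
    proof -
      have "1 \<le> E * N powr (1/2) * (1 + ln N) powr \<beta>"
        using E(2)[OF N] one_plus_ln_pos[OF N] by (simp add: powr_minus field_simps)
      then have "N powr (1/2) * 1 \<le> N powr (1/2) * (E * N powr (1/2) * (1 + ln N) powr \<beta>)"
        by (intro mult_left_mono) auto
      also have "\<dots> = E * ((N powr (1/2) * N powr (1/2)) * (1 + ln N) powr \<beta>)"
        by (simp only: mult_ac)
      also have "N powr (1/2) * N powr (1/2) = N"
        using N by (simp flip: powr_add)
      finally show ?thesis using N by (simp add: plog_def)
    qed
    also have "\<dots> \<le> E * ((\<Sum>k<Suc n. plog 0 \<beta> (real (Suc k))) / c)"
      using c(2)[of "Suc n"] c(1) E(1)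
      by (intro mult_left_mono) (auto simp: N_def field_simps)
    finally have "N powr (1/2) \<le> E / c * (\<Sum>k<Suc n. plog 0 \<beta> (real (Suc k)))" by simp
    then have "y n powr P * N powr (1/2) \<le> y n powr P * (E / c * (\<Sum>k<Suc n. plog 0 \<beta> (real (Suc k))))"
      by (intro mult_left_mono) auto
    also have "\<dots> = E / c * (y n powr P * (\<Sum>k<Suc n. plog 0 \<beta> (real (Suc k))))"
      by (simp only: mult_ac)
    also have "\<dots> \<le> E / c * 1"
      using 1 c(1) E(1) by (intro mult_left_mono) auto
    finally have "y n powr P * N powr (1/2) \<le> E / c" by simp
    then have "y n powr P \<le> (E / c) / N powr (1/2)"
      using N by (subst pos_le_divide_eq) auto
    then have "y n powr P \<le> E / c * N powr (- 1/2)"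
      using powr_minus_divide[of N "1/2"] by simp
    then have "(y n powr P) powr (1 / P) \<le> (E / c * N powr (- 1/2)) powr (1 / P)"
      using assms by (intro powr_mono2) auto
    also have "\<dots> = (E / c) powr (1 / P) * N powr (- 1 / (2 * P))"
      by (subst powr_mult) (use c(1) E(1) in \<open>auto simp: powr_powr\<close>)
    finally show ?thesis
      using assms y by (simp add: powr_powr N_def del: of_nat_Suc)
  qed
  have "(E / c) powr (1 / P) > 0" using c E by simp
  then show ?thesis using main by blast
qed

lemma finite_exponent:
  assumes "0 < p" "p < \<infinity>"
  shows "0 < enn2real p" "p \<noteq> \<infinity>"
  using assms exponent_pos[of p] by auto

lemma lz_le_diag:
  assumes "0 < p" "p < \<infinity>" "\<And>n. 0 \<le> y n"
  shows "lz_le p p \<alpha> B y \<longleftrightarrow> (\<Sum>n. ennreal (y n powr enn2real p *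
     (1 + ln (real (Suc n))) powr (\<alpha> * enn2real p))) \<le> ennreal (B powr enn2real p)"
  using finite_exponent[OF assms(1,2)] assms(3)
  by (simp add: lz_le_def plog_def powr_mult powr_powr del: of_nat_Suc)

text \<open>For \<open>q = p\<close> the power weight cancels and the functional is a weighted power
  sum. A dilation brings the sequence into the range where \<open>A\<close> is comparable to
  \<open>G\<close> and where it decays fast enough for \<open>log_weight_exchange\<close>; the error
  series sums to a multiple of \<open>S\<close>. In one direction the decay comes from
  \<open>lz_modular_decay\<close>, in the other from \<open>young_modular_decay\<close>.\<close>

lemma lz_eq_orlicz_diag:
  fixes A :: "ennreal \<Rightarrow> ennreal"
  assumes p: "0 < p" "p < \<infinity>" and A: "young_function A"
    and eq: "equiv_near_0 (\<lambda>t. A (ennreal t))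
      (zero_at_0 (\<lambda>t. t powr enn2real p * (1 - ln t) powr (\<alpha> * enn2real p)))"
  shows "lz_eq_orlicz p p \<alpha> A"
proof -
  define P \<beta> where "P = enn2real p" and "\<beta> = \<alpha> * enn2real p"
  define G where "G = (\<lambda>t. t powr P * (1 - ln t) powr \<beta>)"
  have P: "P > 0" using finite_exponent[OF p] by (simp add: P_def)
  note Amono = monoD[OF young_function_mono[OF A]]
  obtain c0 C0 \<delta> where c0: "c0 > 0" "C0 > 0" "\<delta> > 0"
    "\<And>t. \<lbrakk>0 \<le> t; t < \<delta>\<rbrakk> \<Longrightarrow> A (ennreal (c0 * t)) \<le> zero_at_0 G t"
    "\<And>t. \<lbrakk>0 \<le> t; t < \<delta>\<rbrakk> \<Longrightarrow> zero_at_0 G t \<le> A (ennreal (C0 * t))"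
    using eq unfolding equiv_near_0_def G_def P_def \<beta>_def by blast
  obtain C1 where C1: "C1 > 0"
    "\<And>z N. \<lbrakk>0 < z; 1 \<le> N; z \<le> N powr (- 1 / (2 * P))\<rbrakk> \<Longrightarrow>
       G z \<le> C1 * (z powr P * (1 + ln N) powr \<beta> + 1 / N ^ 2)"
    "\<And>z N. \<lbrakk>0 < z; 1 \<le> N; z \<le> N powr (- 1 / (2 * P))\<rbrakk> \<Longrightarrow>
       z powr P * (1 + ln N) powr \<beta> \<le> C1 * (G z + 1 / N ^ 2)"
    using log_weight_exchange[OF P, of \<beta>] unfolding G_def by metis
  obtain S where S: "S \<ge> 0" "(\<Sum>n. ennreal (1 / real (Suc n) ^ 2)) = ennreal S"
    using suminf_inverse_squares .
  have decay_le_1: "real (Suc n) powr (- 1 / (2 * P)) \<le> 1" for n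
    using P powr_mono[of "- 1 / (2 * P)" 0 "real (Suc n)"] by simp
  have lz: "lz_le p p \<alpha> B y \<longleftrightarrow>
      (\<Sum>n. ennreal (y n powr P * (1 + ln (real (Suc n))) powr \<beta>)) \<le> ennreal (B powr P)"
    if "\<And>n. 0 \<le> y n" for B y
    using lz_le_diag[OF p that] by (simp add: P_def \<beta>_def)

  obtain D where D: "D > 0"
    "\<And>y n. \<lbrakk>antimono y; \<And>n. 0 \<le> y n; (\<Sum>n. ennreal (y n powr P * (1 + ln (real (Suc n))) powr \<beta>)) \<le> 1\<rbrakk>
      \<Longrightarrow> y n \<le> D * real (Suc n) powr (- 1 / (2 * P))"
    using lz_modular_decay[OF P, of \<beta>] by blast
  \<comment> \<open>\<open>\<epsilon> * D\<close> below both 1 and \<delta> puts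
    \<open>\<epsilon> * y n\<close> under the decay required by the exchange and into the
    neighbourhood of 0 at once.\<close>
  define \<epsilon> where "\<epsilon> = min 1 \<delta> / (2 * D)"
  have \<epsilon>: "\<epsilon> > 0" "\<epsilon> * D < \<delta>" "\<epsilon> * D \<le> 1"
    using D c0 by (auto simp: \<epsilon>_def)
  \<comment> \<open>\<open>C1 * \<epsilon> powr P\<close> comes from the main term,
    \<open>C1 * S\<close> from the error series; \<open>young_modular_scale\<close> asks for a bound
    of at least 1.\<close>
  define V where "V = max 1 (C1 * (\<epsilon> powr P + S))"
  define K1 where "K1 = V / (c0 * \<epsilon>)"
  have V: "V \<ge> 1" by (simp add: V_def)
  have K1: "K1 > 0" using V c0 \<epsilon> by (auto simp: K1_def intro!: divide_pos_pos)
  have suff1: "(\<Sum>n. A (ennreal (y n / K1))) \<le> 1"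
    if y: "antimono y" "\<And>n. 0 \<le> y n" and le: "lz_le p p \<alpha> 1 y" for y
  proof -
    have le': "(\<Sum>n. ennreal (y n powr P * (1 + ln (real (Suc n))) powr \<beta>)) \<le> 1"
      using le lz[OF y(2)] by simp
    have bd: "A (ennreal (c0 * (\<epsilon> * y n))) \<le> ennreal (C1 * \<epsilon> powr P) *
        ennreal (y n powr P * (1 + ln (real (Suc n))) powr \<beta>) + ennreal C1 * ennreal (1 / real (Suc n) ^ 2)"
      for n
    proof (cases "y n = 0")
      case True
      then show ?thesis by (simp add: young_functionD[OF A])
    next
      case False
      then have yn: "y n > 0" using y(2)[of n] by simp
      have "\<epsilon> * y n \<le> \<epsilon> * (D * real (Suc n) powr (- 1 / (2 * P)))"
        using D(2)[OF y le'] \<epsilon> by (intro mult_left_mono) auto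
      then have le1: "\<epsilon> * y n \<le> (\<epsilon> * D) * real (Suc n) powr (- 1 / (2 * P))" by simp
      also have "\<dots> \<le> 1 * real (Suc n) powr (- 1 / (2 * P))"
        using \<epsilon> by (intro mult_right_mono) auto
      finally have small: "\<epsilon> * y n \<le> real (Suc n) powr (- 1 / (2 * P))" by simp
      have "(\<epsilon> * D) * real (Suc n) powr (- 1 / (2 * P)) \<le> (\<epsilon> * D) * 1"
        using \<epsilon> D decay_le_1 by (intro mult_left_mono) auto
      then have "\<epsilon> * y n < \<delta>" using le1 \<epsilon> by linarith
      then have "A (ennreal (c0 * (\<epsilon> * y n))) \<le> zero_at_0 G (\<epsilon> * y n)"
        using \<epsilon> yn by (intro c0(4)) auto
      also have "\<dots> = ennreal (G (\<epsilon> * y n))"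
        using \<epsilon> yn by (simp add: zero_at_0_def)
      also have "\<dots> \<le> ennreal (C1 * ((\<epsilon> * y n) powr P * (1 + ln (real (Suc n))) powr \<beta> + 1 / real (Suc n) ^ 2))"
        using \<epsilon> yn small by (intro ennreal_leI C1(2)) auto
      also have "\<dots> = ennreal (C1 * \<epsilon> powr P) *
        ennreal (y n powr P * (1 + ln (real (Suc n))) powr \<beta>) + ennreal C1 * ennreal (1 / real (Suc n) ^ 2)"
        using C1(1) \<epsilon> yn
        by (simp add: powr_mult distrib_left mult.assoc flip: ennreal_mult ennreal_plus del: of_nat_Suc)
      finally show ?thesis .
    qed
    have "(\<Sum>n. A (ennreal (c0 * (\<epsilon> * y n)))) \<le> (\<Sum>n. ennreal (C1 * \<epsilon> powr P) *
        ennreal (y n powr P * (1 + ln (real (Suc n))) powr \<beta>) + ennreal C1 * ennreal (1 / real (Suc n) ^ 2))"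
      by (intro suminf_le bd) auto
    also have "\<dots> = ennreal (C1 * \<epsilon> powr P) *
        (\<Sum>n. ennreal (y n powr P * (1 + ln (real (Suc n))) powr \<beta>)) + ennreal C1 * ennreal S"
      by (subst suminf_add[symmetric]) (simp_all only: ennreal_suminf_cmult S(2) summableI)
    also have "\<dots> \<le> ennreal (C1 * \<epsilon> powr P) * 1 + ennreal C1 * ennreal S"
      by (intro add_mono mult_left_mono le') auto
    also have "\<dots> = ennreal (C1 * (\<epsilon> powr P + S))"
      using C1(1) S(1) by (simp add: distrib_left flip: ennreal_mult ennreal_plus)
    also have "\<dots> \<le> ennreal V" by (intro ennreal_leI) (simp add: V_def)
    finally have "(\<Sum>n. A (ennreal (c0 * (\<epsilon> * y n) / V))) \<le> 1"
      using c0 \<epsilon> y(2) V by (intro young_modular_scale[OF A]) auto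
    then show ?thesis using c0 \<epsilon> by (simp add: K1_def mult_ac)
  qed

  obtain T where T: "T > 0" "A (ennreal T) > 1"
    using young_function_large[OF A] .
  obtain C2 where C2: "C2 > 0" "\<And>x. x \<ge> 1 \<Longrightarrow> (1 + ln x) powr (- \<beta>) \<le> C2 * x powr P"
    using log_powr_le[OF P, of "- \<beta>"] by metis
  \<comment> \<open>A pure power below \<open>G\<close> turns
    \<open>G (\<eta> * y n) \<le> 1 / (n + 1)\<close> into decay of order
    \<open>(n + 1) powr (- 1 / (2 * P))\<close>, exactly the rate the exchange asks for.\<close>
  have G_ge: "z powr (2 * P) \<le> C2 * G z" if "0 < z" "z \<le> 1" for z
  proof -
    have "(1 - ln z) powr (- \<beta>) \<le> C2 * z powr (- P)"
      using C2(2)[of "1 / z"] that by (simp add: ln_div powr_divide powr_minus field_simps)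
    moreover have "0 < 1 - ln z" using that by (smt (verit) ln_le_zero_iff)
    ultimately have "z powr P \<le> C2 * (1 - ln z) powr \<beta>"
      using that by (simp add: powr_minus field_simps)
    then have "z powr P * z powr P \<le> z powr P * (C2 * (1 - ln z) powr \<beta>)"
      by (intro mult_left_mono) auto
    then show ?thesis by (simp add: G_def mult_ac flip: powr_add)
  qed
  \<comment> \<open>\<open>C0 * \<eta> \<le> 1\<close> gives
    \<open>G (\<eta> * y n) \<le> A (y n)\<close>; as the modular bound forces
    \<open>y n < T\<close>, the second entry keeps \<open>\<eta> * y n\<close> below 1 and
    \<delta>.\<close>
  define \<eta> where "\<eta> = min (1 / C0) (min 1 \<delta> / (2 * T))"
  have \<eta>: "\<eta> > 0" "C0 * \<eta> \<le> 1" "\<eta> * T < \<delta>" "\<eta> * T \<le> 1"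
  proof -
    show "\<eta> > 0" using c0 T by (auto simp: \<eta>_def)
    have "C0 * \<eta> \<le> C0 * (1 / C0)" using c0 by (intro mult_left_mono) (auto simp: \<eta>_def)
    then show "C0 * \<eta> \<le> 1" using c0 by simp
    have "\<eta> * T \<le> (min 1 \<delta> / (2 * T)) * T" using T by (intro mult_right_mono) (auto simp: \<eta>_def)
    then show "\<eta> * T < \<delta>" "\<eta> * T \<le> 1" using T c0 by auto
  qed
  \<comment> \<open>The further division by \<open>M\<close> removes the constant in the decay of
    \<open>\<eta> * y n\<close>.\<close>
  define M where "M = max 1 (C2 powr (1 / (2 * P)))"
  define \<theta> where "\<theta> = \<eta> / M"
  have M: "M \<ge> 1" "C2 powr (1 / (2 * P)) \<le> M" by (auto simp: M_def)
  have \<theta>: "\<theta> > 0" "\<theta> \<le> \<eta>" using M \<eta> by (auto simp: \<theta>_def field_simps)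
  define K2 where "K2 = (C1 * (1 + S)) powr (1 / P) / \<theta>"
  have K2: "K2 > 0" using C1(1) S(1) \<theta> by (auto simp: K2_def)
  have suff2: "lz_le p p \<alpha> K2 y"
    if y: "antimono y" "\<And>n. 0 \<le> y n" and le: "(\<Sum>n. A (ennreal (y n))) \<le> 1" for y
  proof -
    have yT: "y n < T" for n
      by (rule young_modular_bounded[OF A T(2) le])
    have GA: "G (s * y n) \<le> A (ennreal (y n))" if "0 < s" "s \<le> \<eta>" "y n > 0" for s n
    proof -
      have "s * y n \<le> \<eta> * T" using that yT[of n] by (intro mult_mono) auto
      then have "zero_at_0 G (s * y n) \<le> A (ennreal (C0 * (s * y n)))"
        using \<eta> that by (intro c0(5)) auto
      also have "\<dots> \<le> A (ennreal (y n))"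
      proof (intro Amono ennreal_leI)
        have "C0 * s \<le> C0 * \<eta>"
          using that c0 by (intro mult_left_mono) auto
        then have "(C0 * s) * y n \<le> 1 * y n"
          using that \<eta>(2) by (intro mult_right_mono) auto
        then show "C0 * (s * y n) \<le> y n" by simp
      qed
      finally show ?thesis using that by (simp add: zero_at_0_def)
    qed
    have bd: "ennreal (\<theta> powr P) * ennreal (y n powr P * (1 + ln (real (Suc n))) powr \<beta>)
      \<le> ennreal C1 * (A (ennreal (y n)) + ennreal (1 / real (Suc n) ^ 2))" for n
    proof (cases "y n = 0")
      case True
      then show ?thesis by simp
    next
      case False
      then have yn: "y n > 0" using y(2)[of n] by simp
      have "\<eta> * y n \<le> \<eta> * T" using \<eta> yT[of n] by (intro mult_left_mono) auto
      then have "\<eta> * y n \<le> 1" using \<eta>(4) by linarith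
      then have "(\<eta> * y n) powr (2 * P) \<le> C2 * G (\<eta> * y n)"
        using \<eta>(1) yn by (intro G_ge) auto
      moreover have "G (\<eta> * y n) \<le> 1 / real (Suc n)"
      proof -
        have "ennreal (G (\<eta> * y n)) \<le> A (ennreal (y n))"
          using \<eta>(1) yn by (intro GA) auto
        also have "\<dots> \<le> ennreal (1 / real (Suc n))"
          by (rule young_modular_decay[OF A y le])
        finally show ?thesis by (subst (asm) ennreal_le_iff) auto
      qed
      then have "C2 * G (\<eta> * y n) \<le> C2 * (1 / real (Suc n))"
        using C2 by (intro mult_left_mono) auto
      ultimately have "(\<eta> * y n) powr (2 * P) \<le> C2 * (1 / real (Suc n))" by linarith
      then have "((\<eta> * y n) powr (2 * P)) powr (1 / (2 * P)) \<le> (C2 * (1 / real (Suc n))) powr (1 / (2 * P))"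
        using P by (intro powr_mono2) auto
      then have "\<eta> * y n \<le> C2 powr (1 / (2 * P)) * real (Suc n) powr (- 1 / (2 * P))"
        using P C2 \<eta> yn by (simp add: powr_powr powr_mult powr_divide powr_minus field_simps del: of_nat_Suc)
      also have "\<dots> \<le> M * real (Suc n) powr (- 1 / (2 * P))"
        using M by (intro mult_right_mono) auto
      finally have small: "\<theta> * y n \<le> real (Suc n) powr (- 1 / (2 * P))"
        using M by (simp add: \<theta>_def field_simps del: of_nat_Suc)
      have "(\<theta> * y n) powr P * (1 + ln (real (Suc n))) powr \<beta> \<le> C1 * (G (\<theta> * y n) + 1 / real (Suc n) ^ 2)"
        using \<theta> yn small by (intro C1(3)) auto
      then have "ennreal ((\<theta> * y n) powr P * (1 + ln (real (Suc n))) powr \<beta>)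
          \<le> ennreal (C1 * (G (\<theta> * y n) + 1 / real (Suc n) ^ 2))"
        by (rule ennreal_leI)
      also have "\<dots> = ennreal C1 * (ennreal (G (\<theta> * y n)) + ennreal (1 / real (Suc n) ^ 2))"
        using C1(1) by (subst ennreal_plus[symmetric]) (auto simp: G_def ennreal_mult)
      also have "\<dots> \<le> ennreal C1 * (A (ennreal (y n)) + ennreal (1 / real (Suc n) ^ 2))"
        using GA[of \<theta> n] \<theta> yn by (intro mult_left_mono add_right_mono) auto
      finally show ?thesis
        using \<theta> yn by (simp add: powr_mult mult.assoc flip: ennreal_mult del: of_nat_Suc)
    qed
    have "ennreal (\<theta> powr P) * (\<Sum>n. ennreal (y n powr P * (1 + ln (real (Suc n))) powr \<beta>))
        \<le> (\<Sum>n. ennreal C1 * (A (ennreal (y n)) + ennreal (1 / real (Suc n) ^ 2)))"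
      unfolding ennreal_suminf_cmult[symmetric] by (intro suminf_le bd) auto
    also have "\<dots> = ennreal C1 * ((\<Sum>n. A (ennreal (y n))) + ennreal S)"
      unfolding ennreal_suminf_cmult by (subst suminf_add[symmetric]) (simp_all only: S(2) summableI)
    also have "\<dots> \<le> ennreal C1 * (1 + ennreal S)"
      by (intro mult_left_mono add_right_mono le) auto
    also have "\<dots> = ennreal (C1 * (1 + S))"
      using C1(1) S(1) by (simp add: ennreal_mult flip: ennreal_plus ennreal_1)
    finally have "ennreal (1 / \<theta> powr P) * (ennreal (\<theta> powr P) *
        (\<Sum>n. ennreal (y n powr P * (1 + ln (real (Suc n))) powr \<beta>)))
        \<le> ennreal (1 / \<theta> powr P) * ennreal (C1 * (1 + S))"
      by (intro mult_left_mono) auto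
    moreover have "ennreal (1 / \<theta> powr P) * (ennreal (\<theta> powr P) * X) = X" for X
      using \<theta> by (simp flip: mult.assoc ennreal_mult)
    moreover have "ennreal (1 / \<theta> powr P) * ennreal (C1 * (1 + S)) = ennreal (K2 powr P)"
      using \<theta> P C1(1) S(1) by (simp add: K2_def powr_divide powr_powr flip: ennreal_mult)
    ultimately show ?thesis
      using lz[OF y(2)] by simp
  qed

  have mono_K: "lz_le p p \<alpha> (max K1 K2) y" if "lz_le p p \<alpha> K2 y" "\<And>n. 0 \<le> y n" for y
    using that K2 P unfolding lz[OF that(2)]
    by (elim order_trans) (intro ennreal_leI powr_mono2, auto)
  show ?thesis
    unfolding lz_eq_orlicz_iff[OF p(1) A]
  proof (intro exI[of _ "max K1 K2"] conjI allI impI; (elim conjE)?)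
    fix y :: "nat \<Rightarrow> real" assume y: "antimono y" "\<forall>n. 0 \<le> y n"
    {
      assume "lz_le p p \<alpha> 1 y"
      have "(\<Sum>n. A (ennreal (y n / max K1 K2))) \<le> (\<Sum>n. A (ennreal (y n / K1)))"
        using K1 y by (intro suminf_le Amono ennreal_leI divide_left_mono) auto
      also have "\<dots> \<le> 1" using suff1 y \<open>lz_le p p \<alpha> 1 y\<close> by blast
      finally show "(\<Sum>n. A (ennreal (y n / max K1 K2))) \<le> 1" .
    next
      assume "(\<Sum>n. A (ennreal (y n))) \<le> 1"
      then show "lz_le p p \<alpha> (max K1 K2) y" using suff2 y mono_K by blast
    }
  qed (use K1 in auto)
qed

subsection \<open>Step sequences and the fundamental function\<close>

lemma recip_eq: "0 < p \<Longrightarrow> p < \<infinity> \<Longrightarrow> recip p = 1 / enn2real p"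
  by (cases p) (auto simp: recip_def divide_ennreal ennreal_1[symmetric] simp del: ennreal_1)

lemma recip_top [simp]: "recip top = 0"
  by (simp add: recip_def)

lemma recip_le_1_iff: "0 < p \<Longrightarrow> p < \<infinity> \<Longrightarrow> recip p < 1 \<longleftrightarrow> 1 < p"
  by (cases p) (auto simp: recip_def divide_ennreal ennreal_1[symmetric] simp del: ennreal_1 simp: ennreal_less_iff)

lemma recip_eq_1_iff: "0 < p \<Longrightarrow> p < \<infinity> \<Longrightarrow> recip p = 1 \<longleftrightarrow> p = 1"
  by (cases p) (auto simp: recip_def divide_ennreal ennreal_1[symmetric] simp del: ennreal_1)

text \<open>The conditions on \<open>A\<close> say that its generalised inverse at
  \<open>1 / n\<close> is comparable to \<open>1 / v n\<close>, and the limits say the same of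
  \<open>G\<close>, since \<open>t\<close> is comparable to \<open>1 / v (\<kappa> / G t)\<close>.
  Taking \<open>n\<close> near \<open>1 / G t\<close> compares \<open>A\<close> with
  \<open>G\<close>: rounding up bounds \<open>A\<close> from above, rounding down from
  below.\<close>

lemma equiv_near_0_of_fundamental:
  fixes A :: "ennreal \<Rightarrow> ennreal" and v G :: "real \<Rightarrow> real"
  assumes A: "young_function A"
    and v: "\<And>x. 1 \<le> x \<Longrightarrow> 0 < v x" "D > 0" "\<And>x y. \<lbrakk>1 \<le> x; x \<le> y\<rbrakk> \<Longrightarrow> v x \<le> D * v y"
    and C1: "C1 > 0" "\<And>n::nat. n \<ge> 1 \<Longrightarrow> A (ennreal (1 / (C1 * v (real n)))) \<le> ennreal (1 / real n)"
    and C2: "C2 > 0" "\<And>(n::nat) t. \<lbrakk>n \<ge> 1; 0 < t; A (ennreal t) \<le> ennreal (1 / real n)\<rbrakk> \<Longrightarrow> t \<le> C2 / v (real n)"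
    and G: "\<forall>\<^sub>F t in at_right 0. 0 < G t" "(G \<longlongrightarrow> 0) (at_right 0)"
    and lim: "\<And>\<kappa>. \<kappa> > 0 \<Longrightarrow> \<exists>l>0. ((\<lambda>t. v (\<kappa> / G t) * t) \<longlongrightarrow> l) (at_right 0)"
  shows "equiv_near_0 (\<lambda>t. A (ennreal t)) (zero_at_0 G)"
proof -
  note Amono = monoD[OF young_function_mono[OF A]]
  \<comment> \<open>With \<open>g = 1 / G t\<close> the rounded \<open>n\<close> stays between
    \<open>g / 2\<close> and \<open>2 * g\<close>; hence the two values of \<kappa>.\<close>
  obtain l1 where l1: "l1 > 0" "((\<lambda>t. v (2 / G t) * t) \<longlongrightarrow> l1) (at_right 0)"
    using lim[of 2] by auto
  obtain l2 where l2: "l2 > 0" "((\<lambda>t. v ((1/2) / G t) * t) \<longlongrightarrow> l2) (at_right 0)"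
    using lim[of "1/2"] by auto
  have "\<forall>\<^sub>F t in at_right 0. 0 < G t \<and> G t < 1/2 \<and> v (2 / G t) * t < 2 * l1 \<and> v ((1/2) / G t) * t > l2 / 2"
    using G(1) order_tendstoD(2)[OF G(2), of "1/2"] order_tendstoD(2)[OF l1(2), of "2 * l1"]
      order_tendstoD(1)[OF l2(2), of "l2 / 2"] l1(1) l2(1)
    by (auto simp: eventually_conj_iff)
  then obtain \<delta> where \<delta>: "\<delta> > 0" "\<And>t. \<lbrakk>0 < t; t < \<delta>\<rbrakk> \<Longrightarrow> 0 < G t \<and> G t < 1/2 \<and>
      v (2 / G t) * t < 2 * l1 \<and> v ((1/2) / G t) * t > l2 / 2"
    by (auto simp: eventually_at_right_field)
  define c where "c = 1 / (C1 * D * (2 * l1))"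
  \<comment> \<open>If \<open>A (C * t) \<le> 1 / n\<close> held, \<open>C * t * v n\<close> would
    be at most \<open>C2\<close>, whereas \<open>D * v n * t > l2 / 2\<close> makes it at least
    \<open>2 * C2\<close>.\<close>
  define C where "C = 4 * C2 * D / l2"
  have c: "c > 0" "C > 0" using C1 C2 v l1 l2 by (auto simp: c_def C_def)
  have "A (ennreal (c * t)) \<le> zero_at_0 G t \<and> zero_at_0 G t \<le> A (ennreal (C * t))"
    if t: "0 \<le> t" "t < \<delta>" for t
  proof (cases "t = 0")
    case True
    then show ?thesis by (simp add: zero_at_0_def young_functionD[OF A])
  next
    case False
    then have t0: "t > 0" using t by simp
    define g where "g = 1 / G t"
    have Gt: "0 < G t" "G t < 1/2" "v (2 * g) * t < 2 * l1" "v (g / 2) * t > l2 / 2"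
      using \<delta>(2)[OF t0 t(2)] by (auto simp: g_def mult.commute)
    have g: "g > 2" "G t = 1 / g" using Gt by (auto simp: g_def field_simps)
    have "A (ennreal (c * t)) \<le> ennreal (G t)"
    proof -
      define n where "n = nat \<lceil>g\<rceil>"
      have n: "n \<ge> 1" "g \<le> real n" "real n \<le> 2 * g"
        using g unfolding n_def by linarith+
      have "v (real n) * t \<le> D * v (2 * g) * t"
        using n t0 v by (intro mult_right_mono) auto
      also have "\<dots> \<le> D * (2 * l1)"
        using Gt v(2) by (simp add: mult.assoc)
      finally have "v (real n) * t \<le> D * (2 * l1)" .
      then have "C1 * (v (real n) * t) \<le> C1 * (D * (2 * l1))"
        using C1 by (intro mult_left_mono) auto
      then have "c * t \<le> 1 / (C1 * v (real n))"
        using n v C1 l1 by (simp add: c_def field_simps)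
      then have "A (ennreal (c * t)) \<le> A (ennreal (1 / (C1 * v (real n))))"
        by (intro Amono ennreal_leI)
      also have "\<dots> \<le> ennreal (1 / real n)" using n by (intro C1)
      also have "\<dots> \<le> ennreal (G t)"
        unfolding g(2) using n g by (intro ennreal_leI divide_left_mono) auto
      finally show ?thesis .
    qed
    moreover have "ennreal (G t) \<le> A (ennreal (C * t))"
    proof -
      define n where "n = nat \<lfloor>g\<rfloor>"
      have n: "n \<ge> 1" "real n \<le> g" "g / 2 \<le> real n"
        using g unfolding n_def by linarith+
      have "\<not> A (ennreal (C * t)) \<le> ennreal (1 / real n)"
      proof
        assume "A (ennreal (C * t)) \<le> ennreal (1 / real n)"
        then have "C * t \<le> C2 / v (real n)"
          using C2 n c t0 by (intro C2) auto
        then have "C * t * v (real n) \<le> C2"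
          using v(1)[of "real n"] n by (simp add: field_simps)
        moreover have "l2 / 2 < D * v (real n) * t"
        proof -
          have "v (g / 2) * t \<le> D * v (real n) * t"
            using n g t0 by (intro mult_right_mono v) auto
          then show ?thesis using Gt by linarith
        qed
        then have "4 * C2 / l2 * (l2 / 2) \<le> 4 * C2 / l2 * (D * v (real n) * t)"
          using C2 l2 by (intro mult_left_mono) auto
        then have "2 * C2 \<le> C * t * v (real n)"
          using l2 by (simp add: C_def mult_ac)
        ultimately show False using C2 by linarith
      qed
      moreover have "ennreal (G t) \<le> ennreal (1 / real n)"
        unfolding g(2) using n g by (intro ennreal_leI divide_left_mono) auto
      ultimately show ?thesis by (meson le_less_trans less_imp_le not_le)
    qed
    ultimately show ?thesis using t0 by (simp add: zero_at_0_def)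
  qed
  then show ?thesis
    unfolding equiv_near_0_def using c \<delta>(1) by blast
qed

definition step_seq :: "nat \<Rightarrow> real \<Rightarrow> nat \<Rightarrow> real" where
  "step_seq n t k = (if k < n then t else 0)"

lemma step_seq_props:
  assumes "0 \<le> t"
  shows "antimono (step_seq n t)" "\<And>k. 0 \<le> step_seq n t k"
  using assms by (auto simp: step_seq_def monotone_def)

lemma step_seq_scale: "(\<lambda>k. s * step_seq n t k) = step_seq n (s * t)"
  "(\<lambda>k. step_seq n t k / s) = step_seq n (t / s)"
  by (auto simp: step_seq_def)

lemma young_modular_step:
  assumes "young_function A"
  shows "(\<Sum>k. A (ennreal (step_seq n t k))) = of_nat n * A (ennreal t)"
proof -
  have "(\<Sum>k. A (ennreal (step_seq n t k))) = (\<Sum>k<n. A (ennreal (step_seq n t k)))"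
    by (intro suminf_finite) (auto simp: step_seq_def young_functionD[OF assms])
  then show ?thesis by (simp add: step_seq_def)
qed

lemma lz_le_step_iff:
  assumes "0 < q" "0 \<le> t" "0 \<le> B"
  shows "lz_le p q \<alpha> B (step_seq n t) \<longleftrightarrow>
    (if q = \<infinity> then \<forall>k<n. t * plog (recip p) \<alpha> (real (Suc k)) \<le> B
     else t powr enn2real q *
       (\<Sum>k<n. plog (recip p * enn2real q - 1) (\<alpha> * enn2real q) (real (Suc k))) \<le> B powr enn2real q)"
proof (cases "q = \<infinity>")
  case True
  then show ?thesis
    using assms by (auto simp: lz_le_def step_seq_def)
next
  case False
  define r where "r = enn2real q"
  have r: "r > 0" using False assms(1) exponent_pos by (simp add: r_def)
  have rq: "recip q = 1 / r"
    using False assms(1) recip_eq[of q] by (simp add: r_def less_top)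
  have "(\<Sum>k. ennreal ((step_seq n t k * plog (recip p - recip q) \<alpha> (real (Suc k))) powr r))
      = (\<Sum>k<n. ennreal ((step_seq n t k * plog (recip p - recip q) \<alpha> (real (Suc k))) powr r))"
    by (intro suminf_finite) (auto simp: step_seq_def)
  also have "\<dots> = (\<Sum>k<n. ennreal (t powr r * plog (recip p * r - 1) (\<alpha> * r) (real (Suc k))))"
  proof (intro sum.cong refl arg_cong[where f = ennreal])
    fix k assume "k \<in> {..<n}"
    then show "(step_seq n t k * plog (recip p - recip q) \<alpha> (real (Suc k))) powr r =
        t powr r * plog (recip p * r - 1) (\<alpha> * r) (real (Suc k))"
      using assms r by (simp add: step_seq_def powr_mult plog_powr rq left_diff_distrib del: of_nat_Suc)
  qed
  also have "\<dots> = ennreal (t powr r * (\<Sum>k<n. plog (recip p * r - 1) (\<alpha> * r) (real (Suc k))))"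
    by (simp add: sum_distrib_left sum_nonneg del: of_nat_Suc)
  finally show ?thesis
    using False by (simp add: lz_le_def r_def[symmetric] ennreal_le_iff del: of_nat_Suc)
qed

text \<open>The modular of a step of height \<open>t\<close> and length \<open>n\<close> is
  \<open>n * A t\<close>, so it is at most 1 exactly when \<open>A t \<le> 1 / n\<close>;
  \<open>up\<close> and \<open>lo\<close> express that the Lorentz-Zygmund functional of this step
  is comparable to \<open>t * v n\<close>. The two conclusions bound the generalised inverse of
  \<open>A\<close> at \<open>1 / n\<close> from below and from above.\<close>

lemma fundamental_conditions:
  fixes v :: "real \<Rightarrow> real"
  assumes q: "0 < q" and A: "young_function A" and eq: "lz_eq_orlicz p q \<alpha> A"
    and v: "\<And>n::nat. n \<ge> 1 \<Longrightarrow> 0 < v (real n)" and cC: "c > 0" "C > 0"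
    and up: "\<And>n t. \<lbrakk>n \<ge> 1; 0 \<le> t\<rbrakk> \<Longrightarrow> lz_le p q \<alpha> (C * t * v (real n)) (step_seq n t)"
    and lo: "\<And>n t B. \<lbrakk>n \<ge> 1; 0 \<le> t; 0 \<le> B; lz_le p q \<alpha> B (step_seq n t)\<rbrakk> \<Longrightarrow> c * t * v (real n) \<le> B"
  shows "\<exists>C1>0. \<forall>n::nat. n \<ge> 1 \<longrightarrow> A (ennreal (1 / (C1 * v (real n)))) \<le> ennreal (1 / real n)"
    and "\<exists>C2>0. \<forall>(n::nat) t. n \<ge> 1 \<longrightarrow> 0 < t \<longrightarrow> A (ennreal t) \<le> ennreal (1 / real n) \<longrightarrow> t \<le> C2 / v (real n)"
proof -
  obtain K where K: "K > 0"
    "\<And>y. \<lbrakk>antimono y; \<forall>n. 0 \<le> y n; lz_le p q \<alpha> 1 y\<rbrakk> \<Longrightarrow> (\<Sum>n. A (ennreal (y n / K))) \<le> 1"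
    "\<And>y. \<lbrakk>antimono y; \<forall>n. 0 \<le> y n; (\<Sum>n. A (ennreal (y n))) \<le> 1\<rbrakk> \<Longrightarrow> lz_le p q \<alpha> K y"
    using eq unfolding lz_eq_orlicz_iff[OF q A] by blast
  have iff: "of_nat n * X \<le> 1 \<longleftrightarrow> X \<le> ennreal (1 / real n)" if "n \<ge> 1" for n and X :: ennreal
    using that by (cases X) (auto simp: ennreal_of_nat_eq_real_of_nat ennreal_mult_top ennreal_le_1 top_unique
        field_simps simp flip: ennreal_mult)
  show "\<exists>C1>0. \<forall>n::nat. n \<ge> 1 \<longrightarrow> A (ennreal (1 / (C1 * v (real n)))) \<le> ennreal (1 / real n)"
  proof (intro exI[of _ "K * C"] conjI allI impI)
    show "K * C > 0" using K cC by simp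
    fix n :: nat assume n: "n \<ge> 1"
    define t where "t = 1 / (C * v (real n))"
    have t: "t \<ge> 0" "C * t * v (real n) = 1" using v[OF n] cC by (auto simp: t_def)
    have "(\<Sum>k. A (ennreal (step_seq n t k / K))) \<le> 1"
      using up[OF n t(1)] step_seq_props[OF t(1)] t(2) by (intro K(2)) auto
    then have "of_nat n * A (ennreal (t / K)) \<le> 1"
      by (simp add: step_seq_scale[THEN fun_cong] young_modular_step[OF A])
    then show "A (ennreal (1 / (K * C * v (real n)))) \<le> ennreal (1 / real n)"
      using iff[OF n] by (simp add: t_def mult_ac)
  qed
  show "\<exists>C2>0. \<forall>(n::nat) t. n \<ge> 1 \<longrightarrow> 0 < t \<longrightarrow> A (ennreal t) \<le> ennreal (1 / real n) \<longrightarrow> t \<le> C2 / v (real n)"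
  proof (intro exI[of _ "K / c"] conjI allI impI)
    show "K / c > 0" using K cC by simp
    fix n :: nat and t :: real
    assume n: "n \<ge> 1" and t: "0 < t" "A (ennreal t) \<le> ennreal (1 / real n)"
    have "(\<Sum>k. A (ennreal (step_seq n t k))) \<le> 1"
      using iff[OF n] t by (simp add: young_modular_step[OF A])
    then have "lz_le p q \<alpha> K (step_seq n t)"
      using step_seq_props[of t n] t by (intro K(3)) auto
    then have "c * t * v (real n) \<le> K"
      using n t K by (intro lo) auto
    then show "t \<le> K / c / v (real n)"
      using v[OF n] cC by (simp add: field_simps)
  qed
qed

text \<open>For finite \<open>q\<close> the \<open>q\<close>-th power of the fundamental function is
  a partial sum of \<open>plog\<close> with leading exponent \<open>q / p - 1\<close>, so
  \<open>1 / p > 0\<close> makes it comparable to its last term times \<open>n\<close>. For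
  \<open>q = \<infinity>\<close> it is a running maximum of \<open>plog\<close>, comparable to the
  last value by almost monotonicity.\<close>

lemma lz_le_step_bounds:
  assumes q: "0 < q"
    and s: "recip p > 0 \<or> q = \<infinity> \<and> recip p = 0 \<and> \<alpha> \<ge> 0"
  obtains c C where "c > 0" "C > 0"
    "\<And>n t. \<lbrakk>n \<ge> 1; 0 \<le> t\<rbrakk> \<Longrightarrow> lz_le p q \<alpha> (C * t * plog (recip p) \<alpha> (real n)) (step_seq n t)"
    "\<And>n t B. \<lbrakk>n \<ge> 1; 0 \<le> t; 0 \<le> B; lz_le p q \<alpha> B (step_seq n t)\<rbrakk> \<Longrightarrow> c * t * plog (recip p) \<alpha> (real n) \<le> B"
proof (cases "q = \<infinity>")
  case True
  have "\<exists>D>0. \<forall>x y. 1 \<le> x \<longrightarrow> x \<le> y \<longrightarrow> plog (recip p) \<alpha> x \<le> D * plog (recip p) \<alpha> y"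
  proof (cases "recip p > 0")
    case True
    then show ?thesis using plog_almost_mono by metis
  next
    case False
    then have "plog (recip p) \<alpha> x \<le> 1 * plog (recip p) \<alpha> y" if "1 \<le> x" "x \<le> y" for x y
      using s that by (auto simp: plog_def intro!: powr_mono2)
    then show ?thesis using zero_less_one by blast
  qed
  then obtain D where D: "D > 0" "\<And>x y. \<lbrakk>1 \<le> x; x \<le> y\<rbrakk> \<Longrightarrow> plog (recip p) \<alpha> x \<le> D * plog (recip p) \<alpha> y"
    by blast
  show ?thesis
  proof (rule that[of 1 D])
    fix n :: nat and t :: real assume n: "n \<ge> 1" and t: "0 \<le> t"
    have "t * plog (recip p) \<alpha> (real (Suc k)) \<le> t * (D * plog (recip p) \<alpha> (real n))" if "k < n" for k
      using that t by (intro mult_left_mono D) auto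
    moreover have "0 \<le> D * t * plog (recip p) \<alpha> (real n)"
      using D(1) t plog_pos[of "real n"] n by (intro mult_nonneg_nonneg) (auto intro: less_imp_le)
    ultimately show "lz_le p q \<alpha> (D * t * plog (recip p) \<alpha> (real n)) (step_seq n t)"
      using True q t by (simp add: lz_le_step_iff mult_ac del: of_nat_Suc)
  next
    fix n :: nat and t B :: real
    assume n: "n \<ge> 1" and t: "0 \<le> t" "0 \<le> B" "lz_le p q \<alpha> B (step_seq n t)"
    then have "\<forall>k<n. t * plog (recip p) \<alpha> (real (Suc k)) \<le> B"
      using True q by (simp add: lz_le_step_iff del: of_nat_Suc)
    then have "t * plog (recip p) \<alpha> (real (Suc (n - 1))) \<le> B"
      by (rule allE[of _ "n - 1"]) (use n in simp)
    then show "1 * t * plog (recip p) \<alpha> (real n) \<le> B" using n by simp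
  qed (use D in auto)
next
  case False
  define r where "r = enn2real q"
  have r: "r > 0" using False q exponent_pos by (simp add: r_def)
  have sr: "recip p * r > 0" using r s False by auto
  define \<Phi> where "\<Phi> n = (\<Sum>k<n. plog (recip p * r - 1) (\<alpha> * r) (real (Suc k)))" for n
  obtain E where E: "E > 0" "\<And>n. n \<ge> 1 \<Longrightarrow> \<Phi> n \<le> E * plog (recip p * r) (\<alpha> * r) (real n)"
    using sum_plog_le[OF sr, of "\<alpha> * r"] unfolding \<Phi>_def by metis
  obtain e where e: "e > 0" "\<And>n. n \<ge> 1 \<Longrightarrow> e * plog (recip p * r) (\<alpha> * r) (real n) \<le> \<Phi> n"
    using sum_plog_ge[of "recip p * r" "\<alpha> * r"] unfolding \<Phi>_def by metis
  have lz: "lz_le p q \<alpha> B (step_seq n t) \<longleftrightarrow> t powr r * \<Phi> n \<le> B powr r" if "0 \<le> t" "0 \<le> B" for n t B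
    using lz_le_step_iff[OF q that] False by (simp add: r_def \<Phi>_def del: of_nat_Suc)
  have pw: "plog (recip p * r) (\<alpha> * r) (real n) = plog (recip p) \<alpha> (real n) powr r" if "n \<ge> 1" for n :: nat
    using that by (simp add: plog_powr)
  show ?thesis
  proof (rule that[of "e powr (1 / r)" "E powr (1 / r)"])
    fix n :: nat and t :: real assume n: "n \<ge> 1" and t: "0 \<le> t"
    have "t powr r * \<Phi> n \<le> t powr r * (E * plog (recip p) \<alpha> (real n) powr r)"
      using E(2)[OF n] pw[OF n] by (intro mult_left_mono) auto
    also have "\<dots> = (E powr (1 / r) * t * plog (recip p) \<alpha> (real n)) powr r"
      using r E(1) by (simp add: powr_mult powr_powr mult_ac)
    finally show "lz_le p q \<alpha> (E powr (1 / r) * t * plog (recip p) \<alpha> (real n)) (step_seq n t)"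
      using t n plog_pos[of "real n" "recip p" \<alpha>] by (subst lz) auto
  next
    fix n :: nat and t B :: real
    assume n: "n \<ge> 1" and t: "0 \<le> t" "0 \<le> B" "lz_le p q \<alpha> B (step_seq n t)"
    have "(e powr (1 / r) * t * plog (recip p) \<alpha> (real n)) powr r
        = t powr r * (e * plog (recip p) \<alpha> (real n) powr r)"
      using r e(1) by (simp add: powr_mult powr_powr mult_ac)
    also have "\<dots> \<le> t powr r * \<Phi> n"
      using e(2)[OF n] pw[OF n] by (intro mult_left_mono) auto
    also have "\<dots> \<le> B powr r" using lz t by simp
    finally show "e powr (1 / r) * t * plog (recip p) \<alpha> (real n) \<le> B"
      using t(2) r powr_less_mono2[of r B "e powr (1 / r) * t * plog (recip p) \<alpha> (real n)"] by (meson not_le)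
  qed (use e E in auto)
qed

subsection \<open>Spaces with first exponent infinity\<close>

lemma equiv_near_0_zeroD:
  assumes "equiv_near_0 (\<lambda>t. A (ennreal t)) (\<lambda>t. 0)"
  obtains \<tau> where "\<tau> > 0" "A (ennreal \<tau>) = 0"
proof -
  obtain c C \<delta> where *: "c > 0" "C > 0" "\<delta> > 0"
    "\<forall>t. 0 \<le> t \<and> t < \<delta> \<longrightarrow> A (ennreal (c * t)) \<le> 0 \<and> 0 \<le> A (ennreal (C * t))"
    using assms unfolding equiv_near_0_def by blast
  have "A (ennreal (c * (\<delta> / 2))) = 0" using *(4)[rule_format, of "\<delta> / 2"] *(3) by simp
  with * show ?thesis by (intro that[of "c * (\<delta> / 2)"]) auto
qed

lemma equiv_near_0_zeroI:
  assumes "young_function A" "\<tau> > 0" "A (ennreal \<tau>) = 0"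
  shows "equiv_near_0 (\<lambda>t. A (ennreal t)) (\<lambda>t. 0)"
proof -
  have "A (ennreal (\<tau> * t)) \<le> 0" if "0 \<le> t" "t < 1" for t
  proof -
    have "A (ennreal (\<tau> * t)) \<le> A (ennreal \<tau>)"
      using that assms(2) by (intro monoD[OF young_function_mono[OF assms(1)]] ennreal_leI) (auto simp: mult_left_le)
    then show ?thesis using assms(3) by simp
  qed
  then show ?thesis
    unfolding equiv_near_0_def using assms(2)
    by (intro exI[of _ \<tau>] exI[of _ 1]) auto
qed

lemma lz_le_mono:
  assumes "0 < q" "lz_le p q \<alpha> B y" "\<And>n. 0 \<le> z n" "\<And>n. z n \<le> y n" "0 \<le> B" "B \<le> B'"
  shows "lz_le p q \<alpha> B' z"
proof -
  define w where "w n = plog (recip p - recip q) \<alpha> (real (Suc n))" for n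
  have w: "0 \<le> w n" for n unfolding w_def by (rule plog_Suc_pos)
  have zy: "z n * w n \<le> y n * w n" "0 \<le> z n * w n" for n
    using assms(3,4)[of n] w[of n] by (auto intro: mult_right_mono)
  show ?thesis
  proof (cases "q = \<infinity>")
    case True
    have "z n * w n \<le> B'" for n
    proof -
      have "z n * w n \<le> y n * w n" by (rule zy)
      also have "\<dots> \<le> B" using assms(2) True by (simp add: lz_le_def w_def del: of_nat_Suc)
      finally show ?thesis using assms(6) by simp
    qed
    then show ?thesis using True by (simp add: lz_le_def w_def del: of_nat_Suc)
  next
    case False
    have "(\<Sum>n. ennreal ((z n * w n) powr enn2real q)) \<le> (\<Sum>n. ennreal ((y n * w n) powr enn2real q))"
      using zy exponent_pos[OF assms(1) False] by (intro suminf_le ennreal_leI powr_mono2) auto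
    also have "\<dots> \<le> ennreal (B powr enn2real q)"
      using assms(2) False by (simp add: lz_le_def w_def del: of_nat_Suc)
    also have "\<dots> \<le> ennreal (B' powr enn2real q)"
      using assms(5,6) exponent_pos[OF assms(1) False] by (intro ennreal_leI powr_mono2) auto
    finally show ?thesis using False by (simp add: lz_le_def w_def del: of_nat_Suc)
  qed
qed

text \<open>Both functionals are comparable to \<open>y 0\<close>, the supremum. The weight at the
  first position is 1, so \<open>lz_le\<close> with bound 1 gives \<open>y 0 \<le> 1\<close>, and
  then \<open>A\<close> vanishes along a fixed dilation of \<open>y\<close>; conversely a modular of
  at most 1 bounds \<open>y\<close> by \<open>T\<close>, and \<open>W\<close> is a bound for the
  constant sequence 1.\<close>

lemma lz_eq_orlicz_trivial:
  assumes q: "0 < q" and A: "young_function A" and eq: "equiv_near_0 (\<lambda>t. A (ennreal t)) (\<lambda>t. 0)"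
    and p: "p = \<infinity>" and W: "W > 0" "lz_le p q \<alpha> W (\<lambda>_. 1)"
  shows "lz_eq_orlicz p q \<alpha> A"
proof -
  obtain \<tau> where \<tau>: "\<tau> > 0" "A (ennreal \<tau>) = 0" using equiv_near_0_zeroD[OF eq] .
  obtain T where T: "T > 0" "A (ennreal T) > 1" using young_function_large[OF A] .
  have y0: "y 0 \<le> 1" if "lz_le p q \<alpha> 1 y" "\<forall>n. 0 \<le> y n" for y
  proof (cases "q = \<infinity>")
    case True
    then have "y 0 * plog (recip p - recip q) \<alpha> (real (Suc 0)) \<le> 1"
      using that(1) unfolding lz_le_def by (auto simp del: of_nat_Suc)
    then show ?thesis by simp
  next
    case False
    define f where "f n = ennreal ((y n * plog (recip p - recip q) \<alpha> (real (Suc n))) powr enn2real q)" for n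
    have "f 0 \<le> (\<Sum>n. f n)" using sum_le_suminf[of f "{0}"] by simp
    also have "\<dots> \<le> 1" using that(1) False by (simp add: lz_le_def f_def[abs_def] del: of_nat_Suc)
    finally have "y 0 powr enn2real q \<le> 1 powr enn2real q"
      by (simp add: f_def ennreal_le_1)
    then show ?thesis
      using powr_less_mono2[of "enn2real q" 1 "y 0"] exponent_pos[OF q False] by (meson not_le zero_le_one)
  qed
  have yT: "lz_le p q \<alpha> (T * W) y" if y: "\<forall>n. 0 \<le> y n" "\<And>n. y n \<le> T" for y
  proof -
    have *: "lz_le p q \<alpha> (T * W) (\<lambda>_. T * 1)"
      using T W lz_le_scale[of T W "\<lambda>_. 1" p q \<alpha>] by simp
    show ?thesis
      using y T W by (intro lz_le_mono[OF q *]) auto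
  qed
  define K where "K = max (1 / \<tau>) (T * W)"
  have K: "K > 0" "1 / \<tau> \<le> K" "T * W \<le> K" using \<tau> by (auto simp: K_def less_max_iff_disj)
  show ?thesis
    unfolding lz_eq_orlicz_iff[OF q A]
  proof (intro exI[of _ K] conjI allI impI K(1); elim conjE)
    fix y :: "nat \<Rightarrow> real" assume y: "antimono y" "\<forall>n. 0 \<le> y n"
    {
      assume le: "lz_le p q \<alpha> 1 y"
      have "A (ennreal (y n / K)) = 0" for n
      proof -
        have "y n \<le> 1" using y0[OF le y(2)] antimonoD[OF y(1), of 0 n] by simp
        then have "y n / K \<le> 1 / K" using K by (intro divide_right_mono) auto
        also have "\<dots> \<le> \<tau>" using K \<tau> by (simp add: field_simps)
        finally have "A (ennreal (y n / K)) \<le> A (ennreal \<tau>)"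
          by (intro monoD[OF young_function_mono[OF A]] ennreal_leI)
        then show ?thesis using \<tau> by simp
      qed
      then show "(\<Sum>n. A (ennreal (y n / K))) \<le> 1" by simp
    next
      assume "(\<Sum>n. A (ennreal (y n))) \<le> 1"
      then have le: "lz_le p q \<alpha> (T * W) y"
        using young_modular_bounded[OF A T(2)] y(2) by (intro yT) (auto intro: less_imp_le)
      show "lz_le p q \<alpha> K y"
        by (rule lz_le_mono[OF q le]) (use K T W y(2) in auto)
    }
  qed
qed

text \<open>The weights are bounded for \<open>q = \<infinity>\<close>; for finite \<open>q\<close>
  their \<open>q\<close>-th powers are \<open>plog (-1) (\<alpha> * q)\<close>, which is summable
  because \<open>\<alpha> * q < -1\<close>.\<close>

lemma lz_le_one_infinity:
  assumes "q = \<infinity> \<and> \<alpha> \<le> 0 \<or> 0 < q \<and> q < \<infinity> \<and> \<alpha> < - recip q"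
  obtains W where "W > 0" "lz_le \<infinity> q \<alpha> W (\<lambda>_. 1)"
proof (cases "q = \<infinity>")
  case True
  have "(1 + ln (real (Suc n))) powr \<alpha> \<le> 1" for n
    using assms True powr_mono2'[of \<alpha> 1 "1 + ln (real (Suc n))"] by auto
  then show ?thesis
    using True by (intro that[of 1]) (auto simp: lz_le_def plog_def)
next
  case False
  then have q: "0 < q" "q < \<infinity>" "\<alpha> < - recip q" using assms by auto
  define r where "r = enn2real q"
  have r: "r > 0" "recip q = 1 / r" using q exponent_pos[of q] recip_eq[of q] by (auto simp: r_def)
  have "\<alpha> * r < -1" using q(3) r by (simp add: field_simps)
  then have s: "summable (\<lambda>n. plog (-1) (\<alpha> * r) (real (Suc n)))"
    using summable_plog_iff by blast
  define V where "V = (\<Sum>n. plog (-1) (\<alpha> * r) (real (Suc n)))"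
  have V: "V > 0" unfolding V_def using s by (intro suminf_pos plog_Suc_pos)
  have "(\<Sum>n. ennreal (plog (-1) (\<alpha> * r) (real (Suc n)))) = ennreal V"
    unfolding V_def using s by (intro suminf_ennreal2 plog_Suc_pos)
  moreover have "plog (recip \<infinity> - recip q) \<alpha> (real (Suc n)) powr r = plog (-1) (\<alpha> * r) (real (Suc n))" for n
    using r by (simp add: plog_powr)
  ultimately have "lz_le \<infinity> q \<alpha> (V powr (1 / r)) (\<lambda>_. 1)"
    using False V r by (simp add: lz_le_def powr_powr flip: r_def del: of_nat_Suc)
  then show ?thesis using V by (intro that[of "V powr (1 / r)"]) auto
qed

text \<open>Pointwise bounds suffice because replacing \<open>1 / n\<close> by
  \<open>1 / n^2\<close> costs only a constant factor inside \<open>A\<close>: from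
  \<open>y n \<le> (1 + ln (n + 1)) powr (- \<alpha>)\<close> a dilation of \<open>y\<close> has
  modular terms below \<open>1 / (n + 1)^2\<close>, and the decay
  \<open>A (y n) \<le> 1 / (n + 1)\<close> returns the same bound on \<open>y\<close> up to a
  constant.\<close>

lemma lz_eq_orlicz_exp:
  assumes A: "young_function A" and \<alpha>: "\<alpha> > 0"
    and eq: "equiv_near_0 (\<lambda>t. A (ennreal t)) (zero_at_0 (\<lambda>t. exp (- (t powr (- 1 / \<alpha>)))))"
  shows "lz_eq_orlicz \<infinity> \<infinity> \<alpha> A"
proof -
  define G where "G = (\<lambda>t. exp (- (t powr (- 1 / \<alpha>))))"
  obtain c0 C0 \<delta> where *: "c0 > 0" "C0 > 0" "\<delta> > 0"
    "\<And>t. \<lbrakk>0 \<le> t; t < \<delta>\<rbrakk> \<Longrightarrow> A (ennreal (c0 * t)) \<le> zero_at_0 G t"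
    "\<And>t. \<lbrakk>0 \<le> t; t < \<delta>\<rbrakk> \<Longrightarrow> zero_at_0 G t \<le> A (ennreal (C0 * t))"
    using eq unfolding equiv_near_0_def G_def by blast
  have "A (ennreal (c0 * t)) \<le> ennreal (exp (- (t powr (- 1 / \<alpha>))))"
    "ennreal (exp (- (t powr (- 1 / \<alpha>)))) \<le> A (ennreal (C0 * t))" if "0 < t" "t < \<delta>" for t
    using *(4,5)[of t] that by (simp_all add: zero_at_0_def G_def)
  note c0 = *(1-3) this
  have lz: "lz_le \<infinity> \<infinity> \<alpha> B y \<longleftrightarrow> (\<forall>n. y n * (1 + ln (real (Suc n))) powr \<alpha> \<le> B)" for B y
    unfolding lz_le_def plog_def by (simp del: of_nat_Suc)
  note Amono = monoD[OF young_function_mono[OF A]]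
  obtain S where S: "S \<ge> 0" "(\<Sum>n. ennreal (1 / real (Suc n) ^ 2)) = ennreal S"
    using suminf_inverse_squares .
  \<comment> \<open>Under the power \<open>- 1 / \<alpha>\<close> the factor
    \<open>2 powr (- \<alpha>)\<close> becomes the 2 in the exponent that produces the square in
    \<open>1 / (n + 1)^2\<close>.\<close>
  define \<epsilon> where "\<epsilon> = min (2 powr (- \<alpha>)) (\<delta> / 2)"
  have \<epsilon>: "\<epsilon> > 0" "\<epsilon> \<le> 2 powr (- \<alpha>)" "\<epsilon> < \<delta>" using c0 by (auto simp: \<epsilon>_def)
  have inv: "2 * (1 + ln (real (Suc n))) \<le> (\<epsilon> * (1 + ln (real (Suc n))) powr (- \<alpha>)) powr (- 1 / \<alpha>)" for n
  proof -
    define L where "L = 1 + ln (real (Suc n))"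
    have L: "L > 0" using one_plus_ln_pos[of "real (Suc n)"] by (simp add: L_def)
    have "(2 powr (- \<alpha>)) powr (- 1 / \<alpha>) \<le> \<epsilon> powr (- 1 / \<alpha>)"
      using \<epsilon> \<alpha> by (intro powr_mono2') auto
    then have "2 * L \<le> \<epsilon> powr (- 1 / \<alpha>) * L" using L \<alpha> by (simp add: powr_powr)
    also have "\<dots> = (\<epsilon> * L powr (- \<alpha>)) powr (- 1 / \<alpha>)"
      using L \<alpha> \<epsilon> by (simp add: powr_mult powr_powr)
    finally show ?thesis by (simp add: L_def)
  qed
  define K1 where "K1 = max 1 S / (c0 * \<epsilon>)"
  have K1: "K1 > 0" using c0 \<epsilon> by (auto simp: K1_def intro!: divide_pos_pos)
  have suff1: "(\<Sum>n. A (ennreal (y n / K1))) \<le> 1" if y: "\<forall>n. 0 \<le> y n" and le: "lz_le \<infinity> \<infinity> \<alpha> 1 y" for y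
  proof -
    have bd: "A (ennreal (c0 * (\<epsilon> * y n))) \<le> ennreal (1 / real (Suc n) ^ 2)" for n
    proof -
      define L where "L = 1 + ln (real (Suc n))"
      have L: "L \<ge> 1" by (simp add: L_def)
      have "y n * L powr \<alpha> \<le> 1" using le unfolding lz L_def by blast
      then have "y n \<le> L powr (- \<alpha>)" using L by (simp add: powr_minus field_simps)
      then have "A (ennreal (c0 * (\<epsilon> * y n))) \<le> A (ennreal (c0 * (\<epsilon> * L powr (- \<alpha>))))"
        using c0 \<epsilon> by (intro Amono ennreal_leI mult_left_mono) auto
      also have "\<dots> \<le> ennreal (exp (- ((\<epsilon> * L powr (- \<alpha>)) powr (- 1 / \<alpha>))))"
      proof (rule c0(4))
        have "\<epsilon> * L powr (- \<alpha>) \<le> \<epsilon> * 1"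
          using L \<alpha> \<epsilon> powr_mono2'[of "- \<alpha>" 1 L] by (intro mult_left_mono) auto
        then show "\<epsilon> * L powr (- \<alpha>) < \<delta>" using \<epsilon>(3) by linarith
        show "0 < \<epsilon> * L powr (- \<alpha>)" using L \<epsilon> by simp
      qed
      also have "\<dots> \<le> ennreal (exp (- (2 * ln (real (Suc n)))))"
        using inv[of n] by (intro ennreal_leI) (simp add: L_def)
      also have "exp (- (2 * ln (real (Suc n)))) = 1 / real (Suc n) ^ 2"
        by (simp add: exp_minus exp_double divide_inverse del: of_nat_Suc)
      finally show ?thesis .
    qed
    have "(\<Sum>n. A (ennreal (c0 * (\<epsilon> * y n)))) \<le> ennreal S"
      unfolding S(2)[symmetric] by (intro suminf_le bd) auto
    also have "\<dots> \<le> ennreal (max 1 S)" by (intro ennreal_leI) auto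
    finally have "(\<Sum>n. A (ennreal (c0 * (\<epsilon> * y n) / max 1 S))) \<le> 1"
      using c0 \<epsilon> y by (intro young_modular_scale[OF A]) auto
    then show ?thesis using c0 \<epsilon> by (simp add: K1_def mult_ac)
  qed
  obtain T where T: "T > 0" "A (ennreal T) > 1" using young_function_large[OF A] .
  define \<eta> where "\<eta> = min (1 / C0) (min 1 \<delta> / (2 * T))"
  have \<eta>: "\<eta> > 0" "C0 * \<eta> \<le> 1" "\<eta> * T < \<delta>" "\<eta> * T \<le> 1"
  proof -
    show "\<eta> > 0" using c0 T by (auto simp: \<eta>_def)
    have "C0 * \<eta> \<le> C0 * (1 / C0)" using c0 by (intro mult_left_mono) (auto simp: \<eta>_def)
    then show "C0 * \<eta> \<le> 1" using c0 by simp
    have "\<eta> * T \<le> (min 1 \<delta> / (2 * T)) * T" using T by (intro mult_right_mono) (auto simp: \<eta>_def)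
    then show "\<eta> * T < \<delta>" "\<eta> * T \<le> 1" using T c0 by auto
  qed
  define K2 where "K2 = 2 powr \<alpha> / \<eta>"
  have K2: "K2 > 0" using \<eta> by (simp add: K2_def)
  have suff2: "lz_le \<infinity> \<infinity> \<alpha> K2 y"
    if y: "antimono y" "\<forall>n. 0 \<le> y n" and le: "(\<Sum>n. A (ennreal (y n))) \<le> 1" for y
    unfolding lz
  proof
    fix n
    show "y n * (1 + ln (real (Suc n))) powr \<alpha> \<le> K2"
    proof (cases "y n = 0")
      case True
      then show ?thesis using K2 by simp
    next
      case False
      then have yn: "y n > 0" using y(2) by (simp add: less_le)
      define z where "z = \<eta> * y n"
      define w where "w = z powr (- 1 / \<alpha>)"
      have "z \<le> \<eta> * T"
        unfolding z_def using \<eta> young_modular_bounded[OF A T(2) le, of n] by (intro mult_left_mono) auto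
      then have z: "z < \<delta>" "z \<le> 1" using \<eta>(3,4) by linarith+
      have z0: "0 < z" using \<eta> yn by (simp add: z_def)
      note z = z0 z
      have "ennreal (exp (- w)) \<le> A (ennreal (C0 * z))"
        unfolding w_def using z by (intro c0(5))
      also have "\<dots> \<le> A (ennreal (y n))"
      proof (intro Amono ennreal_leI)
        have "(C0 * \<eta>) * y n \<le> 1 * y n" using \<eta> yn by (intro mult_right_mono) auto
        then show "C0 * z \<le> y n" by (simp add: z_def mult_ac)
      qed
      also have "\<dots> \<le> ennreal (1 / real (Suc n))"
        using y(2) by (intro young_modular_decay[OF A y(1) _ le]) auto
      finally have "exp (- w) \<le> 1 / real (Suc n)" by (subst (asm) ennreal_le_iff) auto
      then have "ln (exp (- w)) \<le> ln (1 / real (Suc n))" by (intro ln_mono) auto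
      then have "ln (real (Suc n)) \<le> w" by (simp add: ln_div del: of_nat_Suc)
      \<comment> \<open>This pays for the summand 1 in \<open>1 + ln (n + 1)\<close>, which the
        bound \<open>ln (n + 1) \<le> w\<close> does not cover.\<close>
      moreover have "1 \<le> w"
        using z \<alpha> powr_mono2'[of "- 1 / \<alpha>" z 1] by (simp add: w_def)
      ultimately have "1 + ln (real (Suc n)) \<le> 2 * w" by simp
      then have "(1 + ln (real (Suc n))) powr \<alpha> \<le> (2 * w) powr \<alpha>"
        using \<alpha> by (intro powr_mono2) auto
      also have "w powr \<alpha> = z powr (- 1)" using \<alpha> by (simp add: w_def powr_powr)
      then have "(2 * w) powr \<alpha> = 2 powr \<alpha> / z"
        using z by (simp add: powr_mult powr_minus divide_inverse)
      finally have "y n * (1 + ln (real (Suc n))) powr \<alpha> \<le> y n * (2 powr \<alpha> / z)"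
        using yn by (intro mult_left_mono) auto
      also have "\<dots> = K2" using yn \<eta> by (simp add: K2_def z_def)
      finally show ?thesis .
    qed
  qed
  show ?thesis
    unfolding lz_eq_orlicz_iff[OF ennreal_zero_less_top[folded infinity_ennreal_def] A]
  proof (intro exI[of _ "max K1 K2"] conjI allI impI; (elim conjE)?)
    fix y :: "nat \<Rightarrow> real" assume y: "antimono y" "\<forall>n. 0 \<le> y n"
    {
      assume le: "lz_le \<infinity> \<infinity> \<alpha> 1 y"
      have "(\<Sum>n. A (ennreal (y n / max K1 K2))) \<le> (\<Sum>n. A (ennreal (y n / K1)))"
        using K1 y by (intro suminf_le Amono ennreal_leI divide_left_mono) auto
      also have "\<dots> \<le> 1" by (rule suff1[OF y(2) le])
      finally show "(\<Sum>n. A (ennreal (y n / max K1 K2))) \<le> 1" .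
    next
      assume le: "(\<Sum>n. A (ennreal (y n))) \<le> 1"
      show "lz_le \<infinity> \<infinity> \<alpha> (max K1 K2) y"
        using suff2[OF y le] unfolding lz by (auto intro: max.coboundedI2)
    }
  qed (use K1 in auto)
qed

subsection \<open>Different second exponents\<close>

lemma lz_le_divide:
  assumes "0 < s" "0 \<le> B" "\<And>n. 0 \<le> y n"
  shows "lz_le p q \<alpha> B (\<lambda>n. y n / s) \<longleftrightarrow> lz_le p q \<alpha> (s * B) y"
  using lz_le_scale[of s B "\<lambda>n. y n / s" p q \<alpha>] assms by simp

lemma lz_le_finite_iff:
  assumes "0 < p" "p < \<infinity>" "0 < q" "q < \<infinity>"
  shows "lz_le p q \<alpha> B y \<longleftrightarrow> (\<Sum>n. ennreal ((y n * plog (recip p) \<alpha> (real (Suc n)) *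
    real (Suc n) powr - recip q) powr enn2real q)) \<le> ennreal (B powr enn2real q)"
proof -
  have "q \<noteq> \<infinity>" using assms by auto
  then show ?thesis
    using plog_mult_powr[of "recip p" \<alpha> _ "- recip q"]
    by (simp add: lz_le_def mult.assoc del: of_nat_Suc)
qed

text \<open>
  The separating sequence is \<open>(1 + ln n) powr (- 1 / q) / V n\<close>, where the increasing function \<open>V\<close> is
  comparable to the fundamental function: its quasi-norm is governed by the
  series \<open>1 / (n * (1 + ln n) powr (r / q))\<close> with \<open>r\<close> the second exponent.
\<close>

lemma lz_le_exponent_strict:
  assumes p: "0 < p" "p < \<infinity>" and q: "0 < q" "q < q'"
  shows "\<not> (\<exists>K>0. \<forall>y. antimono y \<and> (\<forall>n. 0 \<le> y n) \<and> lz_le p q' \<alpha> 1 y \<longrightarrow> lz_le p q \<alpha> K y)"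
proof
  assume "\<exists>K>0. \<forall>y. antimono y \<and> (\<forall>n. 0 \<le> y n) \<and> lz_le p q' \<alpha> 1 y \<longrightarrow> lz_le p q \<alpha> K y"
  then obtain K where K: "K > 0"
    "\<And>y. \<lbrakk>antimono y; \<forall>n. 0 \<le> y n; lz_le p q' \<alpha> 1 y\<rbrakk> \<Longrightarrow> lz_le p q \<alpha> K y" by blast
  have qf: "q < \<infinity>" using q(2) by (rule order.strict_trans2) simp
  define u where "u = enn2real q"
  have u: "u > 0" "recip q = 1 / u"
    using q(1) qf exponent_pos[of q] recip_eq[of q] by (auto simp: u_def)
  define v where "v n = plog (recip p) \<alpha> (real (Suc n))" for n
  have v: "v n > 0" for n unfolding v_def by (rule plog_Suc_pos)
  have rp: "recip p > 0"
    using recip_eq[OF p] exponent_pos[of p] p by simp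
  obtain D where D: "D > 0" "\<And>x y. \<lbrakk>1 \<le> x; x \<le> y\<rbrakk> \<Longrightarrow> plog (recip p) \<alpha> x \<le> D * plog (recip p) \<alpha> y"
    using plog_almost_mono[OF rp, of \<alpha>] by metis
  \<comment> \<open>The weight \<open>v\<close> is only almost increasing, but the test sequence
    must be exactly non-increasing; the running maximum costs the factor \<open>D\<close>.\<close>
  define V where "V n = Max (v ` {..n})" for n
  have V: "v n \<le> V n" "V n \<le> D * v n" for n
  proof -
    show "v n \<le> V n" unfolding V_def by (intro Max_ge) auto
    show "V n \<le> D * v n"
      unfolding V_def v_def by (intro Max.boundedI) (auto intro!: D(2) simp del: of_nat_Suc)
  qed
  have Vpos: "V n > 0" for n using V(1)[of n] v[of n] by linarith
  have Vmono: "V m \<le> V n" if "m \<le> n" for m n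
    unfolding V_def using that by (intro Max_mono) auto
  define L where "L n = 1 + ln (real (Suc n))" for n
  have L: "L n \<ge> 1" for n by (simp add: L_def)
  have Lmono: "L m \<le> L n" if "m \<le> n" for m n
    using that by (simp add: L_def)
  define y where "y n = L n powr (- 1 / u) / V n" for n
  have y0: "0 \<le> y n" for n using Vpos[of n] by (simp add: y_def)
  have ymono: "antimono y"
  proof (rule antimonoI)
    fix m n :: nat assume "m \<le> n"
    have "L n powr (- 1 / u) \<le> L m powr (- 1 / u)"
      using Lmono[OF \<open>m \<le> n\<close>] u L[of m] by (intro powr_mono2') auto
    then show "y n \<le> y m"
      unfolding y_def using Vmono[OF \<open>m \<le> n\<close>] Vpos by (intro frac_le) auto
  qed
  have yv: "y n * v n \<le> L n powr (- 1 / u)" "L n powr (- 1 / u) / D \<le> y n * v n" for n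
  proof -
    have "y n * v n = L n powr (- 1 / u) * (v n / V n)" by (simp add: y_def)
    moreover have "v n / V n \<le> 1" "1 / D \<le> v n / V n"
      using V[of n] Vpos[of n] D(1) by (auto simp: field_simps)
    ultimately show "y n * v n \<le> L n powr (- 1 / u)" "L n powr (- 1 / u) / D \<le> y n * v n"
      using mult_left_mono[of "v n / V n" 1 "L n powr (- 1 / u)"]
        mult_left_mono[of "1 / D" "v n / V n" "L n powr (- 1 / u)"] by auto
  qed
  have "\<exists>B>0. lz_le p q' \<alpha> B y"
  proof (cases "q' = \<infinity>")
    case True
    have "y n * v n \<le> 1" for n
    proof -
      have "L n powr (- 1 / u) \<le> 1" using L[of n] u powr_mono2'[of "- 1 / u" 1 "L n"] by simp
      then show ?thesis using yv(1)[of n] by linarith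
    qed
    then have "lz_le p q' \<alpha> 1 y"
      using True by (simp add: lz_le_def v_def del: of_nat_Suc)
    then show ?thesis using zero_less_one by blast
  next
    case False
    define r where "r = enn2real q'"
    have q': "0 < q'" "q' < \<infinity>" using q False by (auto simp: less_top)
    have r: "r > 0" "recip q' = 1 / r"
      using q' exponent_pos[of q'] recip_eq[of q'] by (auto simp: r_def)
    have "q = ennreal u" "q' = ennreal r" using qf q' by (simp_all add: u_def r_def)
    then have "u < r" using q(2) u by (simp add: ennreal_less_iff)
    \<comment> \<open>This is where \<open>q < q'\<close> enters: the series for the larger exponent
      converges, while for \<open>q\<close> itself the logarithmic exponent below is exactly
      -1.\<close>
    then have "- (r / u) < -1" using u by (simp add: field_simps)
    then have s: "summable (\<lambda>n. plog (-1) (- (r / u)) (real (Suc n)))"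
      using summable_plog_iff by blast
    define S where "S = (\<Sum>n. plog (-1) (- (r / u)) (real (Suc n)))"
    have S: "S > 0" unfolding S_def using s by (intro suminf_pos plog_Suc_pos)
    have "(\<Sum>n. ennreal ((y n * v n * real (Suc n) powr - recip q') powr r))
        \<le> (\<Sum>n. ennreal (plog (-1) (- (r / u)) (real (Suc n))))"
    proof (intro suminf_le ennreal_leI)
      fix n
      have "(y n * v n * real (Suc n) powr - recip q') powr r
          \<le> (L n powr (- 1 / u) * real (Suc n) powr - recip q') powr r"
        using yv(1)[of n] y0[of n] v[of n] r by (intro powr_mono2 mult_right_mono mult_nonneg_nonneg) auto
      also have "\<dots> = plog (-1) (- (r / u)) (real (Suc n))"
        using r L[of n] by (simp add: powr_mult powr_powr plog_def L_def del: of_nat_Suc)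
      finally show "(y n * v n * real (Suc n) powr - recip q') powr r \<le> plog (-1) (- (r / u)) (real (Suc n))" .
    qed auto
    also have "\<dots> = ennreal S"
      unfolding S_def using s by (intro suminf_ennreal2 plog_Suc_pos)
    also have "S = (S powr (1 / r)) powr r" using S r by (simp add: powr_powr)
    finally have "lz_le p q' \<alpha> (S powr (1 / r)) y"
      unfolding lz_le_finite_iff[OF p q'] r_def v_def .
    then show ?thesis using S by (intro exI[of _ "S powr (1 / r)"]) auto
  qed
  then obtain B where B: "B > 0" "lz_le p q' \<alpha> B y" by blast
  then have "lz_le p q' \<alpha> 1 (\<lambda>n. y n / B)"
    using y0 by (subst lz_le_divide) auto
  then have "lz_le p q \<alpha> K (\<lambda>n. y n / B)"
    using y0 ymono B(1) by (intro K(2)) (auto simp: monotone_def divide_right_mono)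
  then have "lz_le p q \<alpha> (B * K) y"
    using y0 B K(1) by (subst (asm) lz_le_divide) auto
  then have fin: "(\<Sum>n. ennreal ((y n * v n * real (Suc n) powr - recip q) powr u)) \<le> ennreal ((B * K) powr u)"
    unfolding lz_le_finite_iff[OF p q(1) qf] u_def v_def .
  \<comment> \<open>The \<open>u\<close>-th power turns \<open>L n powr (- 1 / u)\<close> into
    \<open>1 / L n\<close>, so the divergent series of \<open>1 / (n * (1 + ln n))\<close> is a
    minorant up to the constant \<open>D powr u\<close>.\<close>
  have "(\<Sum>n. ennreal (plog (-1) (-1) (real (Suc n)) / D powr u))
      \<le> (\<Sum>n. ennreal ((y n * v n * real (Suc n) powr - recip q) powr u))"
  proof (intro suminf_le ennreal_leI)
    fix n
    have "plog (-1) (-1) (real (Suc n)) / D powr u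
        = (L n powr (- 1 / u) / D * real (Suc n) powr - recip q) powr u"
      using u L[of n] D(1) by (simp add: powr_mult powr_divide powr_powr plog_def L_def del: of_nat_Suc)
    also have "\<dots> \<le> (y n * v n * real (Suc n) powr - recip q) powr u"
      using yv(2)[of n] u D(1) by (intro powr_mono2 mult_right_mono) auto
    finally show "plog (-1) (-1) (real (Suc n)) / D powr u \<le> (y n * v n * real (Suc n) powr - recip q) powr u" .
  qed auto
  then have "(\<Sum>n. ennreal (plog (-1) (-1) (real (Suc n)) / D powr u)) \<noteq> top"
    using fin by (auto simp: top_unique dest: order_trans)
  then have "summable (\<lambda>n. plog (-1) (-1) (real (Suc n)) / D powr u)"
    using D(1) by (intro summable_suminf_not_top) (auto simp del: of_nat_Suc)
  then have "summable (\<lambda>n. plog (-1) (-1) (real (Suc n)) / D powr u * D powr u)"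
    by (rule summable_mult2)
  then have "summable (\<lambda>n. plog (-1) (-1) (real (Suc n)))"
    using D(1) by simp
  then show False using summable_plog_iff[of "-1"] by simp
qed

text \<open>Passing through the modular of \<open>A\<close> puts each Lorentz-Zygmund unit ball into
  a multiple of the other, which \<open>lz_le_exponent_strict\<close> forbids for whichever exponent
  is smaller.\<close>

lemma lz_eq_orlicz_same_exponent:
  assumes p: "0 < p" "p < \<infinity>" and q: "0 < q" "0 < q'" and A: "young_function A"
    and eq: "lz_eq_orlicz p q \<alpha> A" "lz_eq_orlicz p q' \<alpha> A"
  shows "q = q'"
proof -
  have le: "\<exists>K>0. \<forall>y. antimono y \<and> (\<forall>n. 0 \<le> y n) \<and> lz_le p q1 \<alpha> 1 y \<longrightarrow> lz_le p q2 \<alpha> K y"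
    if q12: "0 < q1" "0 < q2" and eqs: "lz_eq_orlicz p q1 \<alpha> A" "lz_eq_orlicz p q2 \<alpha> A" for q1 q2
  proof -
    obtain K1 where K1: "K1 > 0"
      "\<And>y. \<lbrakk>antimono y; \<forall>n. 0 \<le> y n; lz_le p q1 \<alpha> 1 y\<rbrakk> \<Longrightarrow> (\<Sum>n. A (ennreal (y n / K1))) \<le> 1"
      using eqs(1) unfolding lz_eq_orlicz_iff[OF q12(1) A] by blast
    obtain K2 where K2: "K2 > 0"
      "\<And>y. \<lbrakk>antimono y; \<forall>n. 0 \<le> y n; (\<Sum>n. A (ennreal (y n))) \<le> 1\<rbrakk> \<Longrightarrow> lz_le p q2 \<alpha> K2 y"
      using eqs(2) unfolding lz_eq_orlicz_iff[OF q12(2) A] by blast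
    have "lz_le p q2 \<alpha> (K1 * K2) y" if y: "antimono y" "\<forall>n. 0 \<le> y n" "lz_le p q1 \<alpha> 1 y" for y
    proof -
      have "lz_le p q2 \<alpha> K2 (\<lambda>n. y n / K1)"
        using K1(2)[OF y] y K1(1) by (intro K2(2)) (auto simp: monotone_def divide_right_mono)
      then show ?thesis
        using y(2) K1(1) K2(1) by (subst (asm) lz_le_divide) auto
    qed
    then show ?thesis using K1(1) K2(1) by (intro exI[of _ "K1 * K2"]) auto
  qed
  show ?thesis
    using lz_le_exponent_strict[OF p q(1), of q' \<alpha>] le[OF q(2) q(1) eq(2,1)]
      lz_le_exponent_strict[OF p q(2), of q \<alpha>] le[OF q eq] by (cases q q' rule: linorder_cases) blast+
qed

section \<open>Asymptotic inverses of the fundamental functions\<close>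

lemma fundamental_limit_power:
  fixes P \<alpha> \<kappa> :: real
  assumes "P > 0" "\<kappa> > 0"
  shows "((\<lambda>t. plog (1 / P) \<alpha> (\<kappa> / (t powr P * (1 - ln t) powr (\<alpha> * P))) * t) \<longlongrightarrow> \<kappa> powr (1 / P) * P powr \<alpha>) (at_right 0)"
proof -
  \<comment> \<open>With \<open>G t = t powr P * (1 - ln t) powr (\<alpha> * P)\<close> one has
    \<open>G t powr (1 / P) = t * (1 - ln t) powr \<alpha>\<close>, so the powers of
    \<open>t\<close> cancel and only this quotient of logarithms survives, raised to \<alpha>; its
    limit \<open>P\<close> is positive.\<close>
  have "((\<lambda>t. (1 + ln \<kappa> - P * ln t - \<alpha> * P * ln (1 - ln t)) / (1 - ln t)) \<longlongrightarrow> P) (at_right 0)"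
    using assms by real_asymp
  then have "((\<lambda>t. \<kappa> powr (1 / P) * ((1 + ln \<kappa> - P * ln t - \<alpha> * P * ln (1 - ln t)) / (1 - ln t)) powr \<alpha>)
      \<longlongrightarrow> \<kappa> powr (1 / P) * P powr \<alpha>) (at_right 0)"
    using assms by (intro tendsto_intros) auto
  moreover have "\<forall>\<^sub>F t in at_right 0. \<kappa> powr (1 / P) * ((1 + ln \<kappa> - P * ln t - \<alpha> * P * ln (1 - ln t)) / (1 - ln t)) powr \<alpha>
      = plog (1 / P) \<alpha> (\<kappa> / (t powr P * (1 - ln t) powr (\<alpha> * P))) * t"
    unfolding eventually_at_right_field
  proof (intro exI[of _ 1] conjI allI impI)
    fix t :: real assume t: "0 < t" "t < 1"
    have L: "1 - ln t > 0" using t by (smt (verit) ln_less_zero_iff)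
    define G where "G = t powr P * (1 - ln t) powr (\<alpha> * P)"
    have G: "G > 0" using t L by (simp add: G_def)
    have lnG: "ln G = P * ln t + \<alpha> * P * ln (1 - ln t)"
      using t L by (simp add: G_def ln_mult ln_powr)
    have "G powr (1 / P) = t * (1 - ln t) powr \<alpha>"
      using t L assms by (simp add: G_def powr_mult powr_powr)
    then have "plog (1 / P) \<alpha> (\<kappa> / G) * t
        = \<kappa> powr (1 / P) / (t * (1 - ln t) powr \<alpha>) * (1 + ln \<kappa> - ln G) powr \<alpha> * t"
      using assms G by (simp add: plog_def powr_divide ln_div add_diff_eq)
    also have "\<dots> = \<kappa> powr (1 / P) * ((1 + ln \<kappa> - ln G) powr \<alpha> / (1 - ln t) powr \<alpha>)"
      using t by simp
    also have "(1 + ln \<kappa> - ln G) powr \<alpha> / (1 - ln t) powr \<alpha> = ((1 + ln \<kappa> - ln G) / (1 - ln t)) powr \<alpha>"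
      by (simp add: powr_divide)
    finally show "\<kappa> powr (1 / P) * ((1 + ln \<kappa> - P * ln t - \<alpha> * P * ln (1 - ln t)) / (1 - ln t)) powr \<alpha>
      = plog (1 / P) \<alpha> (\<kappa> / (t powr P * (1 - ln t) powr (\<alpha> * P))) * t"
      by (simp add: lnG G_def[symmetric] diff_diff_add)
  qed auto
  ultimately show ?thesis by (rule Lim_transform_eventually)
qed

lemma fundamental_limit_exp:
  fixes \<alpha> \<kappa> :: real
  assumes "\<alpha> > 0" "\<kappa> > 0"
  shows "((\<lambda>t. plog 0 \<alpha> (\<kappa> / exp (- (t powr (- 1 / \<alpha>)))) * t) \<longlongrightarrow> 1) (at_right 0)"
proof -
  \<comment> \<open>The logarithm of \<open>\<kappa> / G t\<close> is exactly
    \<open>ln \<kappa> + t powr (- 1 / \<alpha>)\<close>; after multiplication by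
    \<open>t powr (1 / \<alpha>)\<close> the contribution of \<kappa> vanishes in the limit.\<close>
  have lim: "((\<lambda>t. (1 + ln \<kappa>) * t powr (1 / \<alpha>) + 1) \<longlongrightarrow> 1) (at_right 0)"
    using assms by real_asymp
  then have "((\<lambda>t. ((1 + ln \<kappa>) * t powr (1 / \<alpha>) + 1) powr \<alpha>) \<longlongrightarrow> 1 powr \<alpha>) (at_right 0)"
    by (intro tendsto_intros) auto
  then have "((\<lambda>t. ((1 + ln \<kappa>) * t powr (1 / \<alpha>) + 1) powr \<alpha>) \<longlongrightarrow> 1) (at_right 0)" by simp
  moreover have "\<forall>\<^sub>F t in at_right 0. ((1 + ln \<kappa>) * t powr (1 / \<alpha>) + 1) powr \<alpha>
      = plog 0 \<alpha> (\<kappa> / exp (- (t powr (- 1 / \<alpha>)))) * t"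
    using eventually_at_right_less[of 0] order_tendstoD(1)[OF lim zero_less_one]
  proof eventually_elim
    case (elim t)
    have "plog 0 \<alpha> (\<kappa> / exp (- (t powr (- 1 / \<alpha>)))) * t = (1 + ln \<kappa> + t powr (- 1 / \<alpha>)) powr \<alpha> * (t powr (1 / \<alpha>)) powr \<alpha>"
      using assms elim by (simp add: plog_def ln_div powr_powr add.assoc)
    also have "\<dots> = ((1 + ln \<kappa> + t powr (- 1 / \<alpha>)) * t powr (1 / \<alpha>)) powr \<alpha>"
      by (simp add: powr_mult)
    also have "(1 + ln \<kappa> + t powr (- 1 / \<alpha>)) * t powr (1 / \<alpha>) = (1 + ln \<kappa>) * t powr (1 / \<alpha>) + 1"
      using elim by (simp add: distrib_right flip: powr_add)
    finally show ?case by simp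
  qed
  ultimately show ?thesis by (rule Lim_transform_eventually)
qed

section \<open>The case \<open>p = \<infinity>\<close>, \<open>q < \<infinity>\<close> with
  divergent weights, and the Abel-Dini theorem\<close>

lemma not_summable_div_partial_sums:
  fixes a :: "nat \<Rightarrow> real"
  assumes pos: "\<And>n. a n > 0" and "\<not> summable a"
  shows "\<not> summable (\<lambda>n. a n / (\<Sum>k<Suc n. a k))"
proof
  define \<Phi> where "\<Phi> n = (\<Sum>k<n. a k)" for n
  assume "summable (\<lambda>n. a n / (\<Sum>k<Suc n. a k))"
  then have "summable (\<lambda>n. a n / \<Phi> (Suc n))" by (simp add: \<Phi>_def del: sum.lessThan_Suc)
  then obtain N where N: "\<And>n. norm (\<Sum>k\<in>{Suc N..<n}. a k / \<Phi> (Suc k)) < 1/2"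
    unfolding summable_Cauchy by (metis half_gt_zero le_Suc_eq le_refl zero_less_one)
  have mono: "\<Phi> m \<le> \<Phi> n" if "m \<le> n" for m n
    unfolding \<Phi>_def using that by (intro sum_mono2) (auto intro: less_imp_le[OF pos])
  \<comment> \<open>Once the partial sums have more than doubled, the block from
    \<open>Suc N\<close> to \<open>m\<close> contributes at least
    \<open>(\<Phi> m - \<Phi> (Suc N)) / \<Phi> m > 1/2\<close>, against the Cauchy
    criterion.\<close>
  have "\<exists>m. \<Phi> m > 2 * \<Phi> (Suc N)"
  proof (rule ccontr)
    assume "\<not> ?thesis"
    then have "(\<Sum>k<n. a k) \<le> 2 * \<Phi> (Suc N)" for n by (auto simp: \<Phi>_def not_less)
    then have "summable a"
      by (intro bounded_imp_summable) (auto intro: less_imp_le[OF pos] simp: lessThan_Suc_atMost[symmetric] simp del: sum.lessThan_Suc)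
    then show False using assms(2) by simp
  qed
  then obtain m where m: "\<Phi> m > 2 * \<Phi> (Suc N)" by blast
  have P0: "\<Phi> (Suc N) > 0" unfolding \<Phi>_def using pos by (intro sum_pos) auto
  have Nm: "Suc N \<le> m"
  proof (rule ccontr)
    assume "\<not> Suc N \<le> m"
    then have "\<Phi> m \<le> \<Phi> (Suc N)" by (intro mono) auto
    then show False using m P0 by simp
  qed
  have Pm: "\<Phi> m > 0" using m P0 by simp
  have "\<Phi> m - \<Phi> (Suc N) = (\<Sum>k\<in>{Suc N..<m}. a k)"
    unfolding \<Phi>_def using Nm sum_diff[of "{..<m}" "{..<Suc N}" a]
    by (simp add: lessThan_minus_lessThan del: sum.lessThan_Suc)
  then have "(\<Phi> m - \<Phi> (Suc N)) / \<Phi> m = (\<Sum>k\<in>{Suc N..<m}. a k / \<Phi> m)"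
    by (simp add: sum_divide_distrib)
  also have "\<dots> \<le> (\<Sum>k\<in>{Suc N..<m}. a k / \<Phi> (Suc k))"
  proof (rule sum_mono)
    fix k assume k: "k \<in> {Suc N..<m}"
    have "0 < \<Phi> (Suc k)" using P0 mono[of "Suc N" "Suc k"] k by auto
    moreover have "\<Phi> (Suc k) \<le> \<Phi> m" using k by (intro mono) auto
    ultimately show "a k / \<Phi> m \<le> a k / \<Phi> (Suc k)"
      using pos[of k] by (intro divide_left_mono) auto
  qed
  also have "\<dots> < 1/2" using N[of m] by simp
  finally show False using m Pm by (simp add: field_simps)
qed

lemma sum_plog_square_le:
  obtains M where "M > 0"
    "\<And>n. n \<ge> 1 \<Longrightarrow> (\<Sum>k<n ^ 2. plog (-1) \<beta> (real (Suc k))) \<le> M * (\<Sum>k<n. plog (-1) \<beta> (real (Suc k)))"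
proof -
  define \<Phi> where "\<Phi> n = (\<Sum>k<n. plog (-1) \<beta> (real (Suc k)))" for n
  define M where "M = 3 * max (1 powr \<beta>) (3 powr \<beta>)"
  have M: "M > 0" by (simp add: M_def less_max_iff_disj)
  \<comment> \<open>The bound \<open>n * (n + 2)\<close> is \<open>(n + 1)^2 - 1\<close>: it
    vanishes at 0, and raising \<open>n\<close> by one adds \<open>2 * n + 3 \<le> 3 * b\<close>
    terms whose arguments lie between \<open>b^2\<close> and \<open>4 * b^2\<close>, where
    \<open>b = n + 1\<close>. Each is of order \<open>plog (-2) \<beta> b\<close>, so the block is
    at most \<open>M\<close> times the new term of \<open>\<Phi>\<close>. The base 3 comes from
    \<open>1 + 2 * ln 2 + 2 * ln b \<le> 3 * (1 + ln b)\<close>.\<close>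
  have main: "\<Phi> (n * (n + 2)) \<le> M * \<Phi> n" for n
  proof (induction n)
    case 0
    then show ?case by (simp add: \<Phi>_def)
  next
    case (Suc n)
    define b where "b = real (Suc n)"
    have b: "b \<ge> 1" by (simp add: b_def)
    let ?I = "{n * (n + 2)..<Suc n * (Suc n + 2)}"
    have "\<Phi> (Suc n * (Suc n + 2)) = \<Phi> (n * (n + 2)) + (\<Sum>k\<in>?I. plog (-1) \<beta> (real (Suc k)))"
      unfolding \<Phi>_def lessThan_atLeast0 by (intro sum.atLeastLessThan_concat[symmetric]) auto
    also have "(\<Sum>k\<in>?I. plog (-1) \<beta> (real (Suc k))) \<le> (\<Sum>k\<in>?I. max (1 powr \<beta>) (3 powr \<beta>) * plog (-2) \<beta> b)"
    proof (rule sum_mono)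
      fix k assume k: "k \<in> ?I"
      have "Suc n * Suc n \<le> Suc k" "Suc k \<le> (2 * Suc n) * (2 * Suc n)" using k by auto
      then have "real (Suc n * Suc n) \<le> real (Suc k)" "real (Suc k) \<le> real ((2 * Suc n) * (2 * Suc n))"
        by (simp_all only: of_nat_le_iff)
      then have kb: "b * b \<le> real (Suc k)" "real (Suc k) \<le> (2 * b) * (2 * b)"
        unfolding b_def by (simp_all only: of_nat_mult of_nat_numeral)
      have "ln (b * b) \<le> ln (real (Suc k))" "ln (real (Suc k)) \<le> ln ((2 * b) * (2 * b))"
        using kb b by (auto intro!: ln_mono mult_pos_pos simp del: of_nat_Suc)
      moreover have "ln (b * b) = ln b + ln b" "ln (2 * b) = ln 2 + ln b"
        "ln ((2 * b) * (2 * b)) = ln (2 * b) + ln (2 * b)"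
        using b by (simp_all only: ln_mult) auto
      ultimately have "2 * ln b \<le> ln (real (Suc k))" "ln (real (Suc k)) \<le> 2 * ln 2 + 2 * ln b"
        by linarith+
      then have "(1 + ln (real (Suc k))) powr \<beta> \<le> max (1 powr \<beta>) (3 powr \<beta>) * (1 + ln b) powr \<beta>"
        using one_plus_ln_pos[OF b] ln_ge_zero[OF b] ln_2_less_1
        by (intro powr_comparable) (auto simp del: of_nat_Suc ln_ge_zero_iff)
      moreover have "real (Suc k) powr (-1) \<le> b powr (-2)"
      proof -
        have "real (Suc k) powr (-1) \<le> (b * b) powr (-1)"
          using kb b by (intro powr_mono2') auto
        also have "(b * b) powr (-1) = b powr (-1) * b powr (-1)" using b by (simp only: powr_mult)
        also have "\<dots> = b powr (-1 + -1)" by (rule powr_add[symmetric])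
        also have "-1 + -1 = (-2 :: real)" by simp
        finally show ?thesis .
      qed
      ultimately have "real (Suc k) powr (-1) * (1 + ln (real (Suc k))) powr \<beta>
          \<le> b powr (-2) * (max (1 powr \<beta>) (3 powr \<beta>) * (1 + ln b) powr \<beta>)"
        by (intro mult_mono) auto
      then show "plog (-1) \<beta> (real (Suc k)) \<le> max (1 powr \<beta>) (3 powr \<beta>) * plog (-2) \<beta> b"
        unfolding plog_def by (simp only: mult_ac)
    qed
    also have "\<dots> = real (2 * n + 3) * (max (1 powr \<beta>) (3 powr \<beta>) * plog (-2) \<beta> b)"
      by (simp add: algebra_simps)
    also have "\<dots> \<le> (3 * b) * (max (1 powr \<beta>) (3 powr \<beta>) * plog (-2) \<beta> b)"
      using plog_pos[OF b, of "-2" \<beta>]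
      by (intro mult_right_mono mult_nonneg_nonneg) (auto simp: b_def le_max_iff_disj less_imp_le)
    also have "\<dots> = M * (b * plog (-2) \<beta> b)" by (simp add: M_def)
    also have "b * plog (-2) \<beta> b = plog (-1) \<beta> b"
      using plog_mult_powr[of "-2" \<beta> b 1] b by (simp add: mult.commute)
    finally show ?case using Suc.IH by (simp add: \<Phi>_def b_def distrib_left del: of_nat_Suc)
  qed
  have "\<Phi> (n ^ 2) \<le> M * \<Phi> n" for n
  proof -
    have "\<Phi> (n ^ 2) \<le> \<Phi> (n * (n + 2))"
      unfolding \<Phi>_def by (intro sum_mono2) (auto simp: power2_eq_square less_imp_le simp del: of_nat_Suc)
    then show ?thesis using main[of n] by linarith
  qed
  then show ?thesis using M by (intro that[of M]) (auto simp: \<Phi>_def)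
qed

text \<open>
  The fundamental function \<open>\<phi> n\<close> satisfies \<open>\<phi> (n\<^sup>2) \<le> const * \<phi> n\<close>, so \<open>A (c / \<phi> n) \<le> 1 / n\<^sup>2\<close> and the sequence
  \<open>1 / \<phi>\<close> lies in the Orlicz space; its Lorentz-Zygmund quasi-norm is infinite by Dini's theorem.
\<close>

lemma not_lz_eq_orlicz_infinity:
  assumes q: "0 < q" "q < \<infinity>" and \<alpha>: "- recip q \<le> \<alpha>" and A: "young_function A"
  shows "\<not> lz_eq_orlicz \<infinity> q \<alpha> A"
proof
  assume "lz_eq_orlicz \<infinity> q \<alpha> A"
  then obtain K where K: "K > 0"
    "\<And>y. \<lbrakk>antimono y; \<forall>n. 0 \<le> y n; lz_le \<infinity> q \<alpha> 1 y\<rbrakk> \<Longrightarrow> (\<Sum>n. A (ennreal (y n / K))) \<le> 1"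
    "\<And>y. \<lbrakk>antimono y; \<forall>n. 0 \<le> y n; (\<Sum>n. A (ennreal (y n))) \<le> 1\<rbrakk> \<Longrightarrow> lz_le \<infinity> q \<alpha> K y"
    unfolding lz_eq_orlicz_iff[OF q(1) A] by blast
  note Amono = monoD[OF young_function_mono[OF A]]
  define r \<beta> where "r = enn2real q" and "\<beta> = \<alpha> * enn2real q"
  have qinf: "q \<noteq> \<infinity>" using q by simp
  have r: "r > 0" "recip q = 1 / r" using q exponent_pos[of q] recip_eq[of q] by (auto simp: r_def)
  have \<beta>: "\<beta> \<ge> -1" using \<alpha> r by (simp add: \<beta>_def field_simps flip: r_def)
  \<comment> \<open>The exact \<open>r\<close>-th power of the fundamental function is kept as a
    sum, which also covers the iterated logarithm at \<open>\<beta> = -1\<close>.\<close>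
  define \<Phi> where "\<Phi> n = (\<Sum>k<n. plog (-1) \<beta> (real (Suc k)))" for n
  have \<Phi>pos: "\<Phi> n > 0" if "n \<ge> 1" for n
    unfolding \<Phi>_def using that by (intro sum_pos plog_Suc_pos) (auto simp: lessThan_empty_iff)
  have \<Phi>mono: "\<Phi> m \<le> \<Phi> n" if "m \<le> n" for m n
    unfolding \<Phi>_def using that by (intro sum_mono2) (auto intro: less_imp_le simp del: of_nat_Suc)
  obtain M where M: "M > 0" "\<And>n. n \<ge> 1 \<Longrightarrow> \<Phi> (n ^ 2) \<le> M * \<Phi> n"
    unfolding \<Phi>_def using sum_plog_square_le[of \<beta>] by metis
  define \<phi> where "\<phi> n = \<Phi> n powr (1 / r)" for n
  have \<phi>: "\<phi> n > 0" "\<phi> n powr r = \<Phi> n" if "n \<ge> 1" for n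
    using \<Phi>pos[OF that] r by (auto simp: \<phi>_def powr_powr)
  have \<phi>mono: "\<phi> m \<le> \<phi> n" if "m \<le> n" "1 \<le> m" for m n
    unfolding \<phi>_def using that \<Phi>mono \<Phi>pos[of m] r by (intro powr_mono2) auto
  have A\<phi>: "A (ennreal (1 / \<phi> n / K)) \<le> ennreal (1 / real n)" if n: "n \<ge> 1" for n
  proof -
    \<comment> \<open>This height gives the step of length \<open>n\<close> functional value exactly
      1; the decay estimate is read off at its last non-zero position \<open>n - 1\<close>.\<close>
    define t where "t = 1 / \<phi> n"
    have t: "0 \<le> t" "t powr r * \<Phi> n = 1"
      using \<phi>[OF n] \<Phi>pos[OF n] by (auto simp: t_def powr_divide)
    have "lz_le \<infinity> q \<alpha> 1 (step_seq n t)"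
      using lz_le_step_iff[OF q(1) t(1) zero_le_one, of \<infinity> \<alpha> n] qinf t(2)
      by (simp add: \<Phi>_def \<beta>_def r_def del: of_nat_Suc)
    then have "(\<Sum>k. A (ennreal (step_seq n t k / K))) \<le> 1"
      using step_seq_props[OF t(1)] by (intro K(2)) auto
    then have *: "(\<Sum>k. A (ennreal (step_seq n (t / K) k))) \<le> 1"
      by (simp add: step_seq_scale[THEN fun_cong])
    have "A (ennreal (step_seq n (t / K) (n - 1))) \<le> ennreal (1 / real (Suc (n - 1)))"
      using step_seq_props[of "t / K" n] t K by (intro young_modular_decay[OF A _ _ *]) auto
    then show ?thesis using n by (simp add: step_seq_def t_def)
  qed
  define M' where "M' = M powr (1 / r)"
  have M': "M' > 0" using M by (simp add: M'_def)
  have \<phi>sq: "\<phi> (n ^ 2) \<le> M' * \<phi> n" if "n \<ge> 1" for n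
  proof -
    have "\<Phi> (n ^ 2) powr (1 / r) \<le> (M * \<Phi> n) powr (1 / r)"
      using M(2)[OF that] \<Phi>pos[of "n ^ 2"] that r by (intro powr_mono2) auto
    then show ?thesis by (simp add: \<phi>_def M'_def powr_mult)
  qed
  obtain S where S: "S \<ge> 0" "(\<Sum>n. ennreal (1 / real (Suc n) ^ 2)) = ennreal S"
    using suminf_inverse_squares .
  define y where "y n = 1 / \<phi> (Suc n)" for n
  have y0: "0 < y n" for n using \<phi>[of "Suc n"] by (simp add: y_def)
  have ymono: "antimono y"
    unfolding y_def by (intro antimonoI divide_left_mono \<phi>mono mult_pos_pos \<phi>) auto
  \<comment> \<open>\<open>M'\<close> passes from \<open>\<phi> (n^2)\<close> to
    \<open>\<phi> n\<close>, \<open>K\<close> is the constant of the assumed equality of spaces, and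
    \<open>max 1 S\<close> normalises the resulting modular.\<close>
  define B where "B = M' * K * max 1 S"
  have B: "B > 0" using M' K by (auto simp: B_def intro!: mult_pos_pos)
  have "A (ennreal (y n / (M' * K))) \<le> ennreal (1 / real (Suc n) ^ 2)" for n
  proof -
    have "1 / (M' * \<phi> (Suc n)) \<le> 1 / \<phi> ((Suc n) ^ 2)"
      using \<phi>sq[of "Suc n"] \<phi>[of "(Suc n) ^ 2"] M' \<phi>[of "Suc n"] by (intro divide_left_mono mult_pos_pos) auto
    then have "1 / (M' * \<phi> (Suc n)) / K \<le> 1 / \<phi> ((Suc n) ^ 2) / K"
      using K by (intro divide_right_mono) auto
    then have "A (ennreal (y n / (M' * K))) \<le> A (ennreal (1 / \<phi> ((Suc n) ^ 2) / K))"
      by (intro Amono ennreal_leI) (simp add: y_def mult_ac)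
    also have "\<dots> \<le> ennreal (1 / real ((Suc n) ^ 2))" by (intro A\<phi>) auto
    finally show ?thesis by (simp only: of_nat_power)
  qed
  then have "(\<Sum>n. A (ennreal (y n / (M' * K)))) \<le> ennreal S"
    unfolding S(2)[symmetric] by (intro suminf_le) auto
  also have "\<dots> \<le> ennreal (max 1 S)" by (intro ennreal_leI) auto
  finally have "(\<Sum>n. A (ennreal (y n / (M' * K) / max 1 S))) \<le> 1"
    using M' K less_imp_le[OF y0] by (intro young_modular_scale[OF A]) auto
  then have "(\<Sum>n. A (ennreal (y n / B))) \<le> 1" by (simp add: B_def)
  then have "lz_le \<infinity> q \<alpha> K (\<lambda>n. y n / B)"
    using ymono less_imp_le[OF y0] B by (intro K(3)) (auto simp: monotone_def divide_right_mono)
  then have "lz_le \<infinity> q \<alpha> (B * K) (\<lambda>n. B * (y n / B))"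
    using B K less_imp_le[OF y0] by (subst lz_le_scale) auto
  then have "lz_le \<infinity> q \<alpha> (B * K) y" using B by simp
  \<comment> \<open>The \<open>r\<close>-th power of the weighted sequence is a term of a divergent
    series over its own partial sum, the form treated by
    \<open>not_summable_div_partial_sums\<close>.\<close>
  moreover have "(y n * plog (recip \<infinity> - recip q) \<alpha> (real (Suc n))) powr r
      = plog (-1) \<beta> (real (Suc n)) / (\<Sum>k<Suc n. plog (-1) \<beta> (real (Suc k)))" for n
    using r \<phi>[of "Suc n"]
    by (simp add: y_def powr_mult powr_divide plog_powr \<beta>_def \<Phi>_def flip: r_def del: of_nat_Suc sum.lessThan_Suc)
  ultimately have "(\<Sum>n. ennreal (plog (-1) \<beta> (real (Suc n)) / (\<Sum>k<Suc n. plog (-1) \<beta> (real (Suc k)))))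
      \<le> ennreal ((B * K) powr r)"
    using qinf by (simp add: lz_le_def flip: r_def del: of_nat_Suc sum.lessThan_Suc)
  then have "summable (\<lambda>n. plog (-1) \<beta> (real (Suc n)) / (\<Sum>k<Suc n. plog (-1) \<beta> (real (Suc k))))"
    by (intro summable_suminf_not_top)
      (auto simp: top_unique sum_nonneg simp del: of_nat_Suc sum.lessThan_Suc)
  moreover have "\<not> summable (\<lambda>n. plog (-1) \<beta> (real (Suc n)))"
    using summable_plog_iff[of \<beta>] \<beta> by simp
  ultimately show False
    using not_summable_div_partial_sums[of "\<lambda>n. plog (-1) \<beta> (real (Suc n))"] plog_Suc_pos(1) by blast
qed

subsection \<open>The characterisation\<close>

lemma lz_eq_orlicz_fundamental:
  assumes q: "0 < q" and A: "young_function A" and eq: "lz_eq_orlicz p q \<alpha> A"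
    and s: "recip p > 0 \<or> q = \<infinity> \<and> recip p = 0 \<and> \<alpha> \<ge> 0"
  shows "\<exists>C1>0. \<forall>n::nat. n \<ge> 1 \<longrightarrow> A (ennreal (1 / (C1 * plog (recip p) \<alpha> (real n)))) \<le> ennreal (1 / real n)"
    and "\<exists>C2>0. \<forall>(n::nat) t. n \<ge> 1 \<longrightarrow> 0 < t \<longrightarrow> A (ennreal t) \<le> ennreal (1 / real n) \<longrightarrow>
      t \<le> C2 / plog (recip p) \<alpha> (real n)"
proof -
  obtain c C where cC: "c > 0" "C > 0"
    "\<And>n t. \<lbrakk>n \<ge> 1; 0 \<le> t\<rbrakk> \<Longrightarrow> lz_le p q \<alpha> (C * t * plog (recip p) \<alpha> (real n)) (step_seq n t)"
    "\<And>n t B. \<lbrakk>n \<ge> 1; 0 \<le> t; 0 \<le> B; lz_le p q \<alpha> B (step_seq n t)\<rbrakk> \<Longrightarrow> c * t * plog (recip p) \<alpha> (real n) \<le> B"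
    using lz_le_step_bounds[OF q s] by blast
  have v: "0 < plog (recip p) \<alpha> (real n)" if "n \<ge> 1" for n :: nat
    using that by (intro plog_pos) auto
  show "\<exists>C1>0. \<forall>n::nat. n \<ge> 1 \<longrightarrow> A (ennreal (1 / (C1 * plog (recip p) \<alpha> (real n)))) \<le> ennreal (1 / real n)"
    by (rule fundamental_conditions(1)[OF q A eq v cC]) assumption+
  show "\<exists>C2>0. \<forall>(n::nat) t. n \<ge> 1 \<longrightarrow> 0 < t \<longrightarrow> A (ennreal t) \<le> ennreal (1 / real n) \<longrightarrow>
      t \<le> C2 / plog (recip p) \<alpha> (real n)"
    by (rule fundamental_conditions(2)[OF q A eq v cC]) assumption+
qed

lemma filterlim_plog_at_top:
  assumes "s > 0 \<or> s = 0 \<and> \<alpha> > 0"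
  shows "filterlim (\<lambda>n. plog s \<alpha> (real n)) at_top sequentially"
proof -
  have "filterlim (\<lambda>x::real. x powr s * (1 + ln x) powr \<alpha>) at_top at_top"
  proof (cases "s > 0")
    case True
    consider "\<alpha> < 0" | "\<alpha> = 0" | "\<alpha> > 0" by linarith
    then show ?thesis
    proof cases
      case 2
      show ?thesis unfolding 2 using True by real_asymp
    qed (use True in real_asymp)+
  next
    case False
    then have "s = 0" "\<alpha> > 0" using assms by auto
    then show ?thesis by (simp only:) real_asymp
  qed
  then show ?thesis
    unfolding plog_def by (rule filterlim_compose[OF _ filterlim_real_sequentially])
qed

text \<open>At most linear growth of \<open>A\<close> at 0 gives
  \<open>A (1 / (B * n)) \<le> 1 / n\<close> for large \<open>n\<close>, so
  \<open>1 / (B * n)\<close> is at most a multiple of \<open>1 / \<phi> n\<close>. Thus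
  \<open>\<phi> n / n\<close>, of order \<open>plog (1 / p - 1) \<alpha> n\<close>, stays bounded,
  which fails outside the stated range.\<close>

lemma lz_eq_orlicz_exponent_ge_1:
  assumes p: "0 < p" "p < \<infinity>" and q: "0 < q" and A: "young_function A" and eq: "lz_eq_orlicz p q \<alpha> A"
  shows "recip p < 1 \<or> recip p = 1 \<and> \<alpha> \<le> 0"
proof (rule ccontr)
  assume neg: "\<not> ?thesis"
  have rp: "recip p > 0" using recip_eq[OF p] exponent_pos[of p] p by simp
  obtain C2 where C2: "C2 > 0" "\<And>(n::nat) t. \<lbrakk>n \<ge> 1; 0 < t; A (ennreal t) \<le> ennreal (1 / real n)\<rbrakk>
      \<Longrightarrow> t \<le> C2 / plog (recip p) \<alpha> (real n)"
    using lz_eq_orlicz_fundamental(2)[OF q A eq] rp by blast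
  obtain t0 B where B: "t0 > 0" "B > 0" "\<And>s. \<lbrakk>0 \<le> s; s \<le> t0\<rbrakk> \<Longrightarrow> A (ennreal s) \<le> ennreal (B * s)"
    using young_function_le_linear[OF A] by blast
  have "filterlim (\<lambda>n. plog (recip p - 1) \<alpha> (real n)) at_top sequentially"
    using neg by (intro filterlim_plog_at_top) auto
  then have "\<forall>\<^sub>F n in sequentially. plog (recip p - 1) \<alpha> (real n) > C2 * B"
    by (simp add: filterlim_at_top_dense)
  moreover have "\<forall>\<^sub>F n in sequentially. real n > max 1 (1 / (B * t0))"
    by (rule filterlim_real_sequentially[unfolded filterlim_at_top_dense, rule_format])
  ultimately have "\<forall>\<^sub>F n in sequentially. plog (recip p - 1) \<alpha> (real n) > C2 * B \<and> real n > max 1 (1 / (B * t0))"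
    by (rule eventually_conj)
  then obtain n where n: "plog (recip p - 1) \<alpha> (real n) > C2 * B" "real n > 1" "real n > 1 / (B * t0)"
    unfolding eventually_sequentially by auto
  define t where "t = 1 / (B * real n)"
  have t: "0 < t" "t \<le> t0" using n B by (auto simp: t_def field_simps)
  have "A (ennreal t) \<le> ennreal (1 / real n)"
    using B(3)[of t] t B(2) n by (simp add: t_def)
  then have "t \<le> C2 / plog (recip p) \<alpha> (real n)"
    using n t by (intro C2(2)) auto
  moreover have "plog (recip p) \<alpha> (real n) = plog (recip p - 1) \<alpha> (real n) * real n"
    using plog_mult_powr[of "recip p - 1" \<alpha> "real n" 1] n by simp
  moreover have "plog (recip p - 1) \<alpha> (real n) > 0" using n by (intro plog_pos) auto
  ultimately show False
    using n B by (simp add: t_def field_simps)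
qed

text \<open>The fundamental function is of order \<open>plog (1 / p) \<alpha>\<close> for every
  \<open>q\<close>, so the form of \<open>A\<close> is found while \<open>q\<close> is still
  arbitrary; \<open>fundamental_limit_power\<close> verifies the candidate.\<close>

lemma lz_eq_orlicz_finite:
  assumes p: "0 < p" "p < \<infinity>" and q: "0 < q" and A: "young_function A" and eq: "lz_eq_orlicz p q \<alpha> A"
  shows "equiv_near_0 (\<lambda>t. A (ennreal t))
      (zero_at_0 (\<lambda>t. t powr enn2real p * (1 - ln t) powr (\<alpha> * enn2real p)))"
proof -
  define P where "P = enn2real p"
  have P: "P > 0" "recip p = 1 / P"
    using recip_eq[OF p] exponent_pos[of p] p by (auto simp: P_def)
  have rp: "recip p > 0" using P by simp
  obtain D where D: "D > 0" "\<And>x y. \<lbrakk>1 \<le> x; x \<le> y\<rbrakk> \<Longrightarrow> plog (recip p) \<alpha> x \<le> D * plog (recip p) \<alpha> y"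
    using plog_almost_mono[OF rp, of \<alpha>] by metis
  obtain C1 where C1: "C1 > 0"
    "\<And>n::nat. n \<ge> 1 \<Longrightarrow> A (ennreal (1 / (C1 * plog (recip p) \<alpha> (real n)))) \<le> ennreal (1 / real n)"
    using lz_eq_orlicz_fundamental(1)[OF q A eq] rp by blast
  obtain C2 where C2: "C2 > 0" "\<And>(n::nat) t. \<lbrakk>n \<ge> 1; 0 < t; A (ennreal t) \<le> ennreal (1 / real n)\<rbrakk>
      \<Longrightarrow> t \<le> C2 / plog (recip p) \<alpha> (real n)"
    using lz_eq_orlicz_fundamental(2)[OF q A eq] rp by blast
  have G0: "((\<lambda>t. t powr P * (1 - ln t) powr (\<alpha> * P)) \<longlongrightarrow> 0) (at_right 0)"
  proof -
    define \<beta> where "\<beta> = \<alpha> * P"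
    have "((\<lambda>t. t powr P * (1 - ln t) powr \<beta>) \<longlongrightarrow> 0) (at_right 0)"
    proof -
      consider "\<beta> < 0" | "\<beta> = 0" | "\<beta> > 0" by linarith
      then show ?thesis
      proof cases
        case 2
        show ?thesis unfolding 2 using P(1) by real_asymp
      qed (use P(1) in real_asymp)+
    qed
    then show ?thesis by (simp only: \<beta>_def)
  qed
  have Gpos: "\<forall>\<^sub>F t in at_right 0. 0 < t powr P * (1 - ln t) powr (\<alpha> * P)"
    unfolding eventually_at_right_field
  proof (intro exI[of _ 1] conjI allI impI)
    fix t :: real assume t: "0 < t" "t < 1"
    then have "ln t < 0" by simp
    then have "t \<noteq> 0" "1 - ln t \<noteq> 0" using t by linarith+
    then show "0 < t powr P * (1 - ln t) powr (\<alpha> * P)"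
      by (intro mult_pos_pos powr_gt_zero[THEN iffD2])
  qed auto
  show ?thesis
    unfolding P_def[symmetric]
  proof (rule equiv_near_0_of_fundamental[OF A plog_pos D C1 C2 Gpos G0])
    fix \<kappa> :: real assume "\<kappa> > 0"
    then show "\<exists>l>0. ((\<lambda>t. plog (recip p) \<alpha> (\<kappa> / (t powr P * (1 - ln t) powr (\<alpha> * P))) * t) \<longlongrightarrow> l) (at_right 0)"
      using fundamental_limit_power[OF P(1), of \<kappa> \<alpha>] P
      by (intro exI[of _ "\<kappa> powr (1 / P) * P powr \<alpha>"]) auto
  qed
qed

lemma lz_eq_orlicz_infinity:
  assumes A: "young_function A" and \<alpha>: "\<alpha> > 0" and eq: "lz_eq_orlicz \<infinity> \<infinity> \<alpha> A"
  shows "equiv_near_0 (\<lambda>t. A (ennreal t)) (zero_at_0 (\<lambda>t. exp (- (t powr (- 1 / \<alpha>)))))"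
proof -
  have q: "0 < (\<infinity> :: ennreal)" by simp
  obtain C1 where C1: "C1 > 0"
    "\<And>n::nat. n \<ge> 1 \<Longrightarrow> A (ennreal (1 / (C1 * plog 0 \<alpha> (real n)))) \<le> ennreal (1 / real n)"
    using lz_eq_orlicz_fundamental(1)[OF q A eq] \<alpha> by auto
  obtain C2 where C2: "C2 > 0" "\<And>(n::nat) t. \<lbrakk>n \<ge> 1; 0 < t; A (ennreal t) \<le> ennreal (1 / real n)\<rbrakk>
      \<Longrightarrow> t \<le> C2 / plog 0 \<alpha> (real n)"
    using lz_eq_orlicz_fundamental(2)[OF q A eq] \<alpha> by auto
  have D: "plog 0 \<alpha> x \<le> 1 * plog 0 \<alpha> y" if "1 \<le> x" "x \<le> y" for x y
    using that \<alpha> by (auto simp: plog_def intro!: powr_mono2)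
  have G0: "((\<lambda>t. exp (- (t powr (- 1 / \<alpha>)))) \<longlongrightarrow> 0) (at_right 0)"
    using \<alpha> by real_asymp
  show ?thesis
  proof (rule equiv_near_0_of_fundamental[OF A plog_pos zero_less_one D C1 C2 _ G0])
    fix \<kappa> :: real assume "\<kappa> > 0"
    then show "\<exists>l>0. ((\<lambda>t. plog 0 \<alpha> (\<kappa> / exp (- (t powr (- 1 / \<alpha>)))) * t) \<longlongrightarrow> l) (at_right 0)"
      using fundamental_limit_exp[OF \<alpha>, of \<kappa>] by (intro exI[of _ 1]) auto
  qed auto
qed

text \<open>The constant sequence \<open>1 / W\<close> lies in the unit ball, so a sum of infinitely
  many equal terms \<open>A (1 / W / K)\<close> is at most 1; the decay estimate bounds the common
  term by \<open>1 / (n + 1)\<close> for every \<open>n\<close>.\<close>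

lemma lz_eq_orlicz_trivialD:
  assumes q: "0 < q" and A: "young_function A" and eq: "lz_eq_orlicz p q \<alpha> A"
    and W: "W > 0" "lz_le p q \<alpha> W (\<lambda>_. 1)"
  shows "equiv_near_0 (\<lambda>t. A (ennreal t)) (\<lambda>t. 0)"
proof -
  obtain K where K: "K > 0"
    "\<And>y. \<lbrakk>antimono y; \<forall>n. 0 \<le> y n; lz_le p q \<alpha> 1 y\<rbrakk> \<Longrightarrow> (\<Sum>n. A (ennreal (y n / K))) \<le> 1"
    using eq unfolding lz_eq_orlicz_iff[OF q A] by blast
  have "lz_le p q \<alpha> 1 (\<lambda>_. 1 / W)"
    using W lz_le_divide[of W 1 "\<lambda>_. 1" p q \<alpha>] by simp
  then have le: "(\<Sum>n. A (ennreal (1 / W / K))) \<le> 1"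
    using W by (intro K(2)) (auto simp: monotone_def)
  have "A (ennreal (1 / W / K)) = 0"
  proof -
    have "A (ennreal (1 / W / K)) \<le> ennreal (1 / real (Suc n))" for n
      using K W by (intro young_modular_decay[OF A _ _ le]) (auto simp: monotone_def)
    moreover have "(\<lambda>n. ennreal (1 / real (Suc n))) \<longlonglongrightarrow> ennreal 0"
      using LIMSEQ_inverse_real_of_nat by (intro tendsto_ennrealI) (simp add: inverse_eq_divide)
    ultimately have "A (ennreal (1 / W / K)) \<le> ennreal 0"
      by (intro LIMSEQ_le_const) auto
    then show ?thesis by simp
  qed
  then show ?thesis
    using K W by (intro equiv_near_0_zeroI[OF A, of "1 / W / K"]) auto
qed

lemma equiv_near_0_cong:
  assumes "\<And>t. 0 < t \<Longrightarrow> f t = g t"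
  shows "equiv_near_0 F (zero_at_0 f) \<longleftrightarrow> equiv_near_0 F (zero_at_0 g)"
proof -
  have "zero_at_0 f t = zero_at_0 g t" if "0 \<le> t" for t
    using assms[of t] that by (auto simp: zero_at_0_def)
  then show ?thesis unfolding equiv_near_0_def by (metis (no_types))
qed

theorem theorem6p5:
  fixes p q :: ennreal and \<alpha> :: real and A :: "ennreal \<Rightarrow> ennreal"
  assumes "0 < p" and "0 < q" and "young_function A"
  shows "lz_eq_orlicz p q \<alpha> A \<longleftrightarrow>
    (1 < p \<and> p < \<infinity> \<and> q = p \<and>
       equiv_near_0 (\<lambda>t. A (ennreal t))
         (zero_at_0 (\<lambda>t. t powr enn2real p * (1 - ln t) powr (\<alpha> * enn2real p)))) \<or>
    (p = 1 \<and> q = 1 \<and> \<alpha> \<le> 0 \<and>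
       equiv_near_0 (\<lambda>t. A (ennreal t)) (zero_at_0 (\<lambda>t. t * (1 - ln t) powr \<alpha>))) \<or>
    (p = \<infinity> \<and> q = \<infinity> \<and> \<alpha> > 0 \<and>
       equiv_near_0 (\<lambda>t. A (ennreal t)) (zero_at_0 (\<lambda>t. exp (- (t powr (- 1 / \<alpha>)))))) \<or>
    (((p = \<infinity> \<and> q < \<infinity> \<and> \<alpha> < - recip q) \<or> (p = \<infinity> \<and> q = \<infinity> \<and> \<alpha> \<le> 0)) \<and>
       equiv_near_0 (\<lambda>t. A (ennreal t)) (\<lambda>t. 0))"
proof -
  note A = assms(3)
  let ?G = "zero_at_0 (\<lambda>t. t powr enn2real p * (1 - ln t) powr (\<alpha> * enn2real p))"
  have one: "equiv_near_0 (\<lambda>t. A (ennreal t)) ?G \<longleftrightarrow>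
      equiv_near_0 (\<lambda>t. A (ennreal t)) (zero_at_0 (\<lambda>t. t * (1 - ln t) powr \<alpha>))" if "p = 1"
    unfolding that by (rule equiv_near_0_cong) simp
  show ?thesis
  proof (cases "p = \<infinity>")
    case False
    then have p: "0 < p" "p < \<infinity>" using assms(1) by (auto simp: less_top)
    have "lz_eq_orlicz p q \<alpha> A \<longleftrightarrow>
      (1 < p \<or> p = 1 \<and> \<alpha> \<le> 0) \<and> q = p \<and> equiv_near_0 (\<lambda>t. A (ennreal t)) ?G"
    proof
      assume eq: "lz_eq_orlicz p q \<alpha> A"
      have G: "equiv_near_0 (\<lambda>t. A (ennreal t)) ?G"
        by (rule lz_eq_orlicz_finite[OF p assms(2) A eq])
      \<comment> \<open>The form of \<open>A\<close> just obtained makes its Orlicz space equal to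
        the space with second exponent \<open>p\<close> too, so two second exponents belong to the
        same \<open>A\<close>.\<close>
      moreover have "q = p"
        by (rule lz_eq_orlicz_same_exponent[OF p assms(2) p(1) A eq lz_eq_orlicz_diag[OF p A G]])
      moreover have "1 < p \<or> p = 1 \<and> \<alpha> \<le> 0"
        using lz_eq_orlicz_exponent_ge_1[OF p assms(2) A eq] recip_le_1_iff[OF p] recip_eq_1_iff[OF p] by auto
      ultimately show "(1 < p \<or> p = 1 \<and> \<alpha> \<le> 0) \<and> q = p \<and> equiv_near_0 (\<lambda>t. A (ennreal t)) ?G" by blast
    next
      assume "(1 < p \<or> p = 1 \<and> \<alpha> \<le> 0) \<and> q = p \<and> equiv_near_0 (\<lambda>t. A (ennreal t)) ?G"
      then show "lz_eq_orlicz p q \<alpha> A" using lz_eq_orlicz_diag[OF p A] by blast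
    qed
    then show ?thesis using False p(2) one by auto
  next
    case True
    have triv: "lz_eq_orlicz p q \<alpha> A \<longleftrightarrow> equiv_near_0 (\<lambda>t. A (ennreal t)) (\<lambda>t. 0)"
      if c: "q = \<infinity> \<and> \<alpha> \<le> 0 \<or> 0 < q \<and> q < \<infinity> \<and> \<alpha> < - recip q"
    proof -
      obtain W where W: "W > 0" "lz_le p q \<alpha> W (\<lambda>_. 1)"
        using lz_le_one_infinity[OF c] True by blast
      show ?thesis
        using lz_eq_orlicz_trivialD[OF assms(2) A _ W] lz_eq_orlicz_trivial[OF assms(2) A _ True W] by blast
    qed
    \<comment> \<open>The two middle ranges are those where constant sequences have finite
      functional; in the last one no Young function fits.\<close>
    consider "q = \<infinity>" "\<alpha> > 0" | "q = \<infinity>" "\<alpha> \<le> 0" | "q < \<infinity>" "\<alpha> < - recip q" | "q < \<infinity>" "- recip q \<le> \<alpha>"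
      by (metis infinity_ennreal_def not_le top.not_eq_extremum)
    then show ?thesis
    proof cases
      case 1
      then show ?thesis
        using True lz_eq_orlicz_infinity[OF A] lz_eq_orlicz_exp[OF A] by auto
    next
      case 2
      then show ?thesis using True triv by auto
    next
      case 3
      then show ?thesis using True triv assms(2) by auto
    next
      case 4
      then show ?thesis using True not_lz_eq_orlicz_infinity[OF assms(2) 4 A] by auto
    qed
  qed
qed

end
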